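(* Let $p,q\ge2$ be even, let $P>0$, and choose constants $\ell_1,\ell_2>0$ such that $p/\ell_1^2=q/\ell_2^2=:\lambda$. On the fixed Riemannian product manifold $$\bigl((\mathbb R/P\mathbb Z)\times\mathbb S^p\times\mathbb S^q,\ dt^2+\ell_1^2g_{\mathbb S^p}+\ell_2^2g_{\mathbb S^q}\bigr),$$ the maps into $\mathbb S^{p+q+1}\subset\mathbb R^{p+1}\oplus\mathbb R^{q+1}$ $$\widehat G_m(t,x,y)=\left(\cos\frac{2\pi mt}{P}\,x,\ \sin\frac{2\pi mt}{P}\,y\right),\qquad m=1,2,\ldots,$$ satisfy $$\Delta\widehat G_m=-\left(\lambda+\frac{4\pi^2m^2}{P^2}\right)\widehat G_m,\qquad \deg\widehat G_m=4m.$$ Thus one fixed Riemannian product metric supports spherical eigenmaps of arbitrarily large degree.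
   Context: $\mathbb S^n$ is the unit round sphere in $\mathbb R^{n+1}$ with round metric $g_{\mathbb S^n}$. $\Delta$ is the Laplacian with the sign convention $\Delta=d^2/dt^2$ on $\mathbb R$, applied componentwise. A spherical eigenmap is a harmonic map $f$ into a unit sphere (i.e. $\Delta f=-|df|^2f$) with constant energy density $|df|^2$. Degree is taken with the product orientation given by increasing $t$ and the standard orientations of $\mathbb S^p$, $\mathbb S^q$, and the standard orientation of $\mathbb S^{p+q+1}\subset\mathbb R^{p+1}\oplus\mathbb R^{q+1}$ (the $x$-block first). *)

theory Defs
  imports "HOL-Analysis.Analysis" "Jordan_Normal_Form.Determinant"
begin

no_notation Matrix.vec_index (infixl "$" 100)
no_notation Matrix.scalar_prod (infix "\<bullet>" 70)

text \<open>
  With \<open>p = CARD('p)\<close> and \<open>q = CARD('q)\<close>, the index types \<open>1 + 'p\<close>, \<open>1 + 'q\<close> and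
  \<open>1 + 'p + 'q\<close> have \<open>p + 1\<close>, \<open>q + 1\<close> and \<open>p + q + 1\<close> elements. The manifold
  \<open>(\<real>/P\<int>) \<times> S\<^sup>p \<times> S\<^sup>q\<close> is the image of \<open>cover = \<real> \<times> S\<^sup>p \<times> S\<^sup>q\<close> under \<open>proj P\<close>, a point
  of \<open>\<real>/P\<int>\<close> being a coset of \<open>P\<int>\<close>.
\<close>

type_synonym ('p, 'q) ambient = "real \<times> (real^(1 + 'p)) \<times> (real^(1 + 'q))"
type_synonym ('p, 'q) point = "real set \<times> (real^(1 + 'p)) \<times> (real^(1 + 'q))"
type_synonym ('p, 'q) target = "(real^(1 + 'p)) \<times> (real^(1 + 'q))"

definition circle_point :: "real \<Rightarrow> real \<Rightarrow> real set" where
  "circle_point P t = {t + of_int k * P | k. True}"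

definition cover :: "('p::finite, 'q::finite) ambient set" where
  "cover = UNIV \<times> sphere 0 1 \<times> sphere 0 1"

definition proj :: "real \<Rightarrow> ('p::finite, 'q::finite) ambient \<Rightarrow> ('p, 'q) point" where
  "proj P = (\<lambda>(t, x, y). (circle_point P t, x, y))"

definition manifold :: "real \<Rightarrow> ('p::finite, 'q::finite) point set" where
  "manifold P = range (circle_point P) \<times> sphere 0 1 \<times> sphere 0 1"

text \<open>
  Tangent vectors are represented in the ambient space of the cover; translations in \<open>t\<close> do
  not change them, so the tangent space and the metric make sense on the quotient.
\<close>

definition tangent_space :: "('p::finite, 'q::finite) point \<Rightarrow> ('p, 'q) ambient set" where
  "tangent_space = (\<lambda>(T, x, y). {(a, v, w). x \<bullet> v = 0 \<and> y \<bullet> w = 0})"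

definition product_metric ::
  "real \<Rightarrow> real \<Rightarrow> ('p::finite, 'q::finite) ambient \<Rightarrow> ('p, 'q) ambient \<Rightarrow> real" where
  "product_metric l1 l2 = (\<lambda>(a, v, w) (a', v', w'). a * a' + l1\<^sup>2 * (v \<bullet> v') + l2\<^sup>2 * (w \<bullet> w'))"

section \<open>Smoothness and charts\<close>

text \<open>\<open>Ck_on k U f\<close> is meant for open \<open>U\<close>: \<open>f\<close> is \<open>k\<close> times continuously differentiable on \<open>U\<close>.\<close>

primrec Ck_on :: "nat \<Rightarrow> 'a::euclidean_space set \<Rightarrow> ('a \<Rightarrow> 'b::real_normed_vector) \<Rightarrow> bool" where
  "Ck_on 0 U f \<longleftrightarrow> continuous_on U f"
| "Ck_on (Suc k) U f \<longleftrightarrow>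
     f differentiable_on U \<and> (\<forall>v. Ck_on k U (\<lambda>x. frechet_derivative f (at x) v))"

definition smooth_on :: "'a::euclidean_space set \<Rightarrow> ('a \<Rightarrow> 'b::real_normed_vector) \<Rightarrow> bool" where
  "smooth_on U f \<longleftrightarrow> (\<forall>k. Ck_on k U f)"

definition partial :: "'n::finite \<Rightarrow> (real^'n \<Rightarrow> 'b::real_normed_vector) \<Rightarrow> real^'n \<Rightarrow> 'b" where
  "partial i F u = frechet_derivative F (at u) (axis i 1)"

text \<open>
  A smooth local parametrization \<open>proj P \<circ> \<phi>\<close> of the manifold, given through its lift \<open>\<phi>\<close> to the
  cover. Domain and manifold have the same dimension, so an injective immersion is
  automatically a diffeomorphism onto an open subset.
\<close>

definition local_param ::
  "real \<Rightarrow> (real^(1 + 'p + 'q)) set \<Rightarrow> (real^(1 + 'p + 'q) \<Rightarrow> ('p::finite, 'q::finite) ambient) \<Rightarrow> bool"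
  where
  "local_param P U \<phi> \<longleftrightarrow> open U \<and> smooth_on U \<phi> \<and> \<phi> ` U \<subseteq> cover \<and> inj_on (proj P \<circ> \<phi>) U \<and>
     (\<forall>u\<in>U. inj (frechet_derivative \<phi> (at u)))"

definition smooth_map ::
  "real \<Rightarrow> (('p::finite, 'q::finite) point \<Rightarrow> 'b::real_normed_vector) \<Rightarrow> bool" where
  "smooth_map P f \<longleftrightarrow> (\<forall>U \<phi>. local_param P U \<phi> \<longrightarrow> smooth_on U (f \<circ> proj P \<circ> \<phi>))"

section \<open>Laplacian, energy density, spherical eigenmaps\<close>

text \<open>
  Coordinate expressions with respect to a metric tensor \<open>g\<close>, with \<open>g\<^sup>i\<^sup>j\<close> the entries of the
  inverse matrix: \<open>\<Delta>F = (det g)\<^sup>-\<^sup>1\<^sup>/\<^sup>2 \<Sum>\<^sub>i \<partial>\<^sub>i (\<Sum>\<^sub>j (det g)\<^sup>1\<^sup>/\<^sup>2 g\<^sup>i\<^sup>j \<partial>\<^sub>j F)\<close> and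
  \<open>\<bar>dF\<bar>\<^sup>2 = \<Sum>\<^sub>i\<^sub>j g\<^sup>i\<^sup>j \<langle>\<partial>\<^sub>i F, \<partial>\<^sub>j F\<rangle>\<close>. For vector-valued \<open>F\<close> the former acts componentwise.
\<close>

definition coord_laplacian ::
  "(real^'n::finite \<Rightarrow> real^'n^'n) \<Rightarrow> (real^'n \<Rightarrow> 'b::real_normed_vector) \<Rightarrow> real^'n \<Rightarrow> 'b" where
  "coord_laplacian g F u =
     (1 / sqrt (Determinants.det (g u))) *\<^sub>R
       (\<Sum>i\<in>UNIV. partial i
          (\<lambda>w. \<Sum>j\<in>UNIV. (sqrt (Determinants.det (g w)) * matrix_inv (g w) $ i $ j) *\<^sub>R partial j F w) u)"

definition coord_energy ::
  "(real^'n::finite \<Rightarrow> real^'n^'n) \<Rightarrow> (real^'n \<Rightarrow> 'b::real_inner) \<Rightarrow> real^'n \<Rightarrow> real" where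
  "coord_energy g F u =
     (\<Sum>i\<in>UNIV. \<Sum>j\<in>UNIV. matrix_inv (g u) $ i $ j * (partial i F u \<bullet> partial j F u))"

definition coord_metric ::
  "real \<Rightarrow> real \<Rightarrow> (real^(1 + 'p + 'q) \<Rightarrow> ('p::finite, 'q::finite) ambient) \<Rightarrow>
     real^(1 + 'p + 'q) \<Rightarrow> real^(1 + 'p + 'q)^(1 + 'p + 'q)" where
  "coord_metric l1 l2 \<phi> u = (\<chi> i j. product_metric l1 l2 (partial i \<phi> u) (partial j \<phi> u))"

text \<open>The value that the coordinate expression takes in every parametrization around \<open>z\<close>.\<close>

definition laplacian ::
  "real \<Rightarrow> real \<Rightarrow> real \<Rightarrow> (('p::finite, 'q::finite) point \<Rightarrow> 'b::real_normed_vector) \<Rightarrow>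
     ('p, 'q) point \<Rightarrow> 'b" where
  "laplacian P l1 l2 f z =
     (THE L. \<forall>U \<phi> u. local_param P U \<phi> \<and> u \<in> U \<and> proj P (\<phi> u) = z \<longrightarrow>
        coord_laplacian (coord_metric l1 l2 \<phi>) (f \<circ> proj P \<circ> \<phi>) u = L)"

definition energy_density ::
  "real \<Rightarrow> real \<Rightarrow> real \<Rightarrow> (('p::finite, 'q::finite) point \<Rightarrow> 'b::real_inner) \<Rightarrow>
     ('p, 'q) point \<Rightarrow> real" where
  "energy_density P l1 l2 f z =
     (THE e. \<forall>U \<phi> u. local_param P U \<phi> \<and> u \<in> U \<and> proj P (\<phi> u) = z \<longrightarrow>
        coord_energy (coord_metric l1 l2 \<phi>) (f \<circ> proj P \<circ> \<phi>) u = e)"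

definition harmonic_sphere_map ::
  "real \<Rightarrow> real \<Rightarrow> real \<Rightarrow> (('p::finite, 'q::finite) point \<Rightarrow> 'b::real_inner) \<Rightarrow> bool" where
  "harmonic_sphere_map P l1 l2 f \<longleftrightarrow>
     smooth_map P f \<and> f ` manifold P \<subseteq> sphere 0 1 \<and>
     (\<forall>z\<in>manifold P. laplacian P l1 l2 f z = - energy_density P l1 l2 f z *\<^sub>R f z)"

definition spherical_eigenmap ::
  "real \<Rightarrow> real \<Rightarrow> real \<Rightarrow> (('p::finite, 'q::finite) point \<Rightarrow> 'b::real_inner) \<Rightarrow> bool" where
  "spherical_eigenmap P l1 l2 f \<longleftrightarrow>
     harmonic_sphere_map P l1 l2 f \<and> (\<exists>c. \<forall>z\<in>manifold P. energy_density P l1 l2 f z = c)"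

section \<open>Orientations and the degree\<close>

text \<open>
  Standard ordered bases of \<open>\<real>\<^sup>p\<^sup>+\<^sup>1\<close> and of \<open>\<real>\<^sup>p\<^sup>+\<^sup>1 \<oplus> \<real>\<^sup>q\<^sup>+\<^sup>1\<close> (first block first). The linear order
  on the index type serves only to enumerate the coordinates.
\<close>

definition std_basis :: "(real^(1 + 'p::{finite,linorder})) list" where
  "std_basis = axis (Inl 1) 1 # map (\<lambda>i. axis (Inr i) 1) (sorted_list_of_set UNIV)"

definition std_basis_sum :: "('p::{finite,linorder}, 'q::{finite,linorder}) target list" where
  "std_basis_sum = map (\<lambda>e. (e, 0)) std_basis @ map (\<lambda>e. (0, e)) std_basis"

definition list_det :: "'a::real_inner list \<Rightarrow> 'a list \<Rightarrow> real" where
  "list_det es vs =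
     Determinant.det (Matrix.mat (length es) (length es) (\<lambda>(i, j). (es ! i) \<bullet> (vs ! j)))"

text \<open>
  Positively oriented bases of the tangent space at \<open>x\<close> of the unit sphere, the ambient space
  being oriented by the ordered orthonormal basis \<open>es\<close>; outward normal first.
\<close>

definition positive_sphere_frame :: "'a::real_inner list \<Rightarrow> 'a \<Rightarrow> 'a list \<Rightarrow> bool" where
  "positive_sphere_frame es x vs \<longleftrightarrow>
     length vs + 1 = length es \<and> (\<forall>v\<in>set vs. x \<bullet> v = 0) \<and> list_det es (x # vs) > 0"

definition product_frame ::
  "(real^(1 + 'p::finite)) list \<Rightarrow> (real^(1 + 'q::finite)) list \<Rightarrow> ('p, 'q) ambient list" where
  "product_frame vs ws = (1, 0, 0) # map (\<lambda>v. (0, v, 0)) vs @ map (\<lambda>w. (0, 0, w)) ws"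

text \<open>\<open>df\<^sub>z(\<gamma>'(0)) = (f \<circ> \<gamma>)'(0)\<close> for every curve \<open>\<gamma>\<close> through \<open>z\<close>, with \<open>\<gamma>\<close> given by a lift to the cover.\<close>

definition differential ::
  "real \<Rightarrow> (('p::finite, 'q::finite) point \<Rightarrow> 'b::real_normed_vector) \<Rightarrow> ('p, 'q) point \<Rightarrow>
     ('p, 'q) ambient \<Rightarrow> 'b" where
  "differential P f z v =
     (THE w. \<forall>\<gamma>. range \<gamma> \<subseteq> cover \<and> proj P (\<gamma> 0) = z \<and> (\<gamma> has_vector_derivative v) (at 0) \<longrightarrow>
        ((f \<circ> proj P \<circ> \<gamma>) has_vector_derivative w) (at 0))"

definition regular_point ::
  "real \<Rightarrow> (('p::finite, 'q::finite) point \<Rightarrow> ('p, 'q) target) \<Rightarrow> ('p, 'q) point \<Rightarrow> bool" where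
  "regular_point P f z \<longleftrightarrow> differential P f z ` tangent_space z = {w. f z \<bullet> w = 0}"

definition regular_value ::
  "real \<Rightarrow> (('p::finite, 'q::finite) point \<Rightarrow> ('p, 'q) target) \<Rightarrow> ('p, 'q) target \<Rightarrow> bool" where
  "regular_value P f y \<longleftrightarrow> y \<in> sphere 0 1 \<and> (\<forall>z\<in>manifold P. f z = y \<longrightarrow> regular_point P f z)"

definition orientation_preserving_at ::
  "real \<Rightarrow> (('p::{finite,linorder}, 'q::{finite,linorder}) point \<Rightarrow> ('p, 'q) target) \<Rightarrow>
     ('p, 'q) point \<Rightarrow> bool" where
  "orientation_preserving_at P f = (\<lambda>(T, x, y). \<exists>vs ws.
     positive_sphere_frame std_basis x vs \<and> positive_sphere_frame std_basis y ws \<and>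
     positive_sphere_frame std_basis_sum (f (T, x, y))
       (map (differential P f (T, x, y)) (product_frame vs ws)))"

text \<open>
  Degree of a smooth map into the unit sphere: the number of preimages of any regular value,
  counted with orientation signs.
\<close>

definition mapping_degree ::
  "real \<Rightarrow> (('p::{finite,linorder}, 'q::{finite,linorder}) point \<Rightarrow> ('p, 'q) target) \<Rightarrow> int" where
  "mapping_degree P f =
     (THE d. \<forall>y. regular_value P f y \<longrightarrow>
        (\<Sum>z | z \<in> manifold P \<and> f z = y. if orientation_preserving_at P f z then 1 else -1) = d)"

section \<open>The maps\<close>

text \<open>Defined through a representative of the coset; independent of its choice for integral \<open>m\<close>.\<close>

definition G_hat ::
  "real \<Rightarrow> nat \<Rightarrow> ('p::finite, 'q::finite) point \<Rightarrow> ('p, 'q) target" where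
  "G_hat P m = (\<lambda>(T, x, y). let t = (SOME t. t \<in> T) in
     (cos (2 * pi * real m * t / P) *\<^sub>R x, sin (2 * pi * real m * t / P) *\<^sub>R y))"

end

(*
  Let \<Phi> be a local parametrization of \<real> \<times> S^p(l1) \<times> S^q(l2) in the ambient Euclidean space and g its
  Gram matrix. By Jacobi's formula for the derivative of det g, the coordinate Laplacian of \<Phi> is
  normal to the manifold, and \<Sum>_ij g^ij <d_j \<Phi>, v> d_i \<Phi> is the tangential projection of v. Hence
  \<Delta> t = 0, while \<Delta> x and \<Delta> y are multiples of x and y; applying \<Delta> to <x, x> = 1 identifies the
  factor as minus the energy of x, a trace of the projection, which equals p / l1^2. The product rule
  for \<Delta> then gives the eigenvalue of (cos(a t) x, sin(a t) y), and \<Delta> of its squared norm 1 gives the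
  energy density, in every chart at once.

  For the degree, a value (X, Y) with X = 0 or Y = 0 is singular, since one of the two sphere factors
  is collapsed over it. Every other value has exactly 4 m preimages, two for each half period of the
  circle. There the differential maps the product frame to the target frame up to a factor
  cos(a t)^p sin(a t)^q a, and this is positive because p and q are even.
*)
theory Submission
  imports Defs
begin

section \<open>Smooth functions\<close>

text \<open>\<open>laplacian\<close>, \<open>energy_density\<close>, \<open>differential\<close> and
  \<open>mapping_degree\<close> are definite descriptions over all charts, all curves or all regular
  values. Each evaluation therefore has two halves: an arbitrary chart, curve or regular value
  yields the stated closed form, and at least one exists, which pins the description down. In the
  first half nothing is known about the chart, so the contractions with the inverse metric are not
  computed in coordinates: they are read off from an orthogonal projection whose image, the tangent
  space of a product of round spheres, is known explicitly. In the second half, products of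
  stereographic parametrizations supply charts, similar rational curves realize every tangent
  vector, and a value with blocks of length 3/5 and 4/5 is regular. The assumption p / l1^2 = q /
  l2^2 gives the blocks cos(a t) x and sin(a t) y the same eigenvalue. Parity settles the sign at
  every preimage: cos(a t) and sin(a t) change sign from one preimage to another, and bringing the
  normal vectors of both blocks to the front contributes a further (-1)^p.\<close>

lemma Ck_on_has_derivative:
  assumes "Ck_on (Suc k) U f" "open U" "x \<in> U"
  shows "(f has_derivative frechet_derivative f (at x)) (at x)"
proof -
  have "f differentiable at x within U"
    using assms by (auto simp: differentiable_on_def)
  then show ?thesis
    using assms(2,3) by (metis at_within_open frechet_derivative_works)
qed

text \<open>Openness makes the Frechet derivatives of \<open>f\<close> and \<open>g\<close> agree at
  every point of \<open>U\<close>, so the induction hypothesis applies to them; the induction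
  therefore runs over all pairs of functions.\<close>

lemma Ck_on_cong:
  fixes f g :: "'a::euclidean_space \<Rightarrow> 'b::real_normed_vector"
  assumes "open U" "\<And>x. x \<in> U \<Longrightarrow> f x = g x" "Ck_on k U f"
  shows "Ck_on k U g"
  using assms(2,3)
proof (induction k arbitrary: f g)
  case 0
  then show ?case by (simp cong: continuous_on_cong)
next
  case (Suc k)
  have D: "(g has_derivative frechet_derivative f (at x)) (at x)" if "x \<in> U" for x
    by (rule has_derivative_transform_within_open[OF Ck_on_has_derivative[OF Suc.prems(2) \<open>open U\<close> that]
          \<open>open U\<close> that]) (simp add: Suc.prems(1))
  have "g differentiable_on U"
    using D by (auto simp: differentiable_on_def differentiable_def intro: has_derivative_at_withinI)
  moreover have "Ck_on k U (\<lambda>x. frechet_derivative g (at x) v)" for v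
  proof (rule Suc.IH)
    show "frechet_derivative f (at x) v = frechet_derivative g (at x) v" if "x \<in> U" for x
      using frechet_derivative_at[OF D[OF that]] by simp
    show "Ck_on k U (\<lambda>x. frechet_derivative f (at x) v)"
      using Suc.prems(2) by simp
  qed
  ultimately show ?case by simp
qed

text \<open>The closure properties below exhibit a derivative in closed form; this rule lets such an
  expression stand in for the opaque \<open>frechet_derivative\<close>.\<close>

lemma Ck_on_SucI:
  assumes "\<And>x. x \<in> U \<Longrightarrow> (f has_derivative f' x) (at x)"
    and "\<And>v. Ck_on k U (\<lambda>x. f' x v)" and "open U"
  shows "Ck_on (Suc k) U f"
proof -
  have "f differentiable_on U"
    using assms(1) by (auto simp: differentiable_on_def differentiable_def intro: has_derivative_at_withinI)
  moreover have "Ck_on k U (\<lambda>x. frechet_derivative f (at x) v)" for v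
    by (rule Ck_on_cong[OF assms(3) _ assms(2)[of v]]) (simp add: frechet_derivative_at[OF assms(1), symmetric])
  ultimately show ?thesis by simp
qed

lemma Ck_on_Suc_imp:
  fixes f :: "'a::euclidean_space \<Rightarrow> 'b::real_normed_vector"
  shows "Ck_on (Suc k) U f \<Longrightarrow> Ck_on k U f"
proof (induction k arbitrary: f)
  case 0
  then show ?case using differentiable_imp_continuous_on by auto
next
  case (Suc k)
  show ?case unfolding Ck_on.simps(2)[of k]
  proof (intro conjI allI)
    show "f differentiable_on U" using Suc.prems by simp
    show "Ck_on k U (\<lambda>x. frechet_derivative f (at x) v)" for v
      by (rule Suc.IH) (use Suc.prems Ck_on.simps(2) in blast)
  qed
qed

lemma Ck_on_const: "Ck_on k U (\<lambda>x. c)"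
  by (induction k arbitrary: c) auto

lemma Ck_on_bounded_linear:
  assumes "open U" "bounded_linear L" "Ck_on k U f"
  shows "Ck_on k U (\<lambda>x. L (f x))"
  using assms(3)
proof (induction k arbitrary: f)
  case 0
  then show ?case using assms(2) by (auto intro: bounded_linear.continuous_on)
next
  case (Suc k)
  show ?case
  proof (rule Ck_on_SucI)
    show "((\<lambda>x. L (f x)) has_derivative (\<lambda>v. L (frechet_derivative f (at x) v))) (at x)" if "x \<in> U" for x
      by (rule bounded_linear.has_derivative[OF assms(2) Ck_on_has_derivative[OF Suc.prems \<open>open U\<close> that]])
    show "Ck_on k U (\<lambda>x. L (frechet_derivative f (at x) v))" for v
      using Suc by auto
  qed (use \<open>open U\<close> in auto)
qed

lemma Ck_on_linear:
  assumes "open U" "bounded_linear L"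
  shows "Ck_on k U L"
proof (cases k)
  case 0
  then show ?thesis by (simp add: assms(2) linear_continuous_on)
next
  case (Suc k')
  show ?thesis unfolding Suc
    by (rule Ck_on_SucI[where f' = "\<lambda>x. L"])
      (use assms in \<open>auto intro: bounded_linear_imp_has_derivative Ck_on_const\<close>)
qed

lemma Ck_on_add:
  assumes "open U" "Ck_on k U f" "Ck_on k U g"
  shows "Ck_on k U (\<lambda>x. f x + g x)"
  using assms(2,3)
proof (induction k arbitrary: f g)
  case 0
  then show ?case by (auto intro: continuous_on_add)
next
  case (Suc k)
  show ?case
  proof (rule Ck_on_SucI)
    show "((\<lambda>x. f x + g x) has_derivative
        (\<lambda>v. frechet_derivative f (at x) v + frechet_derivative g (at x) v)) (at x)" if "x \<in> U" for x
      by (intro has_derivative_add Ck_on_has_derivative[OF Suc.prems(1) \<open>open U\<close> that]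
          Ck_on_has_derivative[OF Suc.prems(2) \<open>open U\<close> that])
    show "Ck_on k U (\<lambda>x. frechet_derivative f (at x) v + frechet_derivative g (at x) v)" for v
      using Suc by auto
  qed (use \<open>open U\<close> in auto)
qed

text \<open>The product rule yields two values of the same \<open>B\<close>, so an induction
  hypothesis general in both arguments covers them once the undifferentiated factor is lowered by
  \<open>Ck_on_Suc_imp\<close>.\<close>

lemma Ck_on_bilinear:
  assumes "open U" "bounded_bilinear B" "Ck_on k U f" "Ck_on k U g"
  shows "Ck_on k U (\<lambda>x. B (f x) (g x))"
  using assms(3,4)
proof (induction k arbitrary: f g)
  case 0
  then show ?case using assms(2) by (auto intro: bounded_bilinear.continuous_on)
next
  case (Suc k)
  show ?case
  proof (rule Ck_on_SucI)
    show "((\<lambda>x. B (f x) (g x)) has_derivative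
        (\<lambda>v. B (f x) (frechet_derivative g (at x) v) + B (frechet_derivative f (at x) v) (g x))) (at x)"
      if "x \<in> U" for x
      by (intro bounded_bilinear.FDERIV[OF assms(2)] Ck_on_has_derivative[OF Suc.prems(1) \<open>open U\<close> that]
          Ck_on_has_derivative[OF Suc.prems(2) \<open>open U\<close> that])
    show "Ck_on k U (\<lambda>x. B (f x) (frechet_derivative g (at x) v) + B (frechet_derivative f (at x) v) (g x))" for v
      by (intro Ck_on_add \<open>open U\<close> Suc.IH) (use Suc.prems Ck_on_Suc_imp in auto)
  qed (use \<open>open U\<close> in auto)
qed

text \<open>Up to sign, each function is the outer derivative of the other, hence one joint
  induction.\<close>

lemma Ck_on_cos_sin:
  fixes h :: "'a::euclidean_space \<Rightarrow> real"
  assumes "open U" "Ck_on k U h"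
  shows "Ck_on k U (\<lambda>x. cos (h x)) \<and> Ck_on k U (\<lambda>x. sin (h x))"
  using assms(2)
proof (induction k)
  case 0
  then show ?case by (auto intro: continuous_intros)
next
  case (Suc k)
  let ?D = "\<lambda>x. frechet_derivative h (at x)"
  have D: "(h has_derivative ?D x) (at x)" if "x \<in> U" for x
    by (rule Ck_on_has_derivative[OF Suc.prems \<open>open U\<close> that])
  have IH: "Ck_on k U (\<lambda>x. cos (h x))" "Ck_on k U (\<lambda>x. sin (h x))"
    using Suc Ck_on_Suc_imp by auto
  have Dv: "Ck_on k U (\<lambda>x. ?D x v)" for v
    using Suc.prems by simp
  have "Ck_on (Suc k) U (\<lambda>x. cos (h x))"
  proof (rule Ck_on_SucI)
    show "((\<lambda>x. cos (h x)) has_derivative (\<lambda>v. - (sin (h x) * ?D x v))) (at x)" if "x \<in> U" for x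
      using D[OF that] by (auto intro!: derivative_eq_intros)
    show "Ck_on k U (\<lambda>x. - (sin (h x) * ?D x v))" for v
      by (intro Ck_on_bounded_linear[OF \<open>open U\<close> bounded_linear_minus[OF bounded_linear_ident]]
          Ck_on_bilinear[OF \<open>open U\<close> bounded_bilinear_mult] IH Dv)
  qed (use \<open>open U\<close> in auto)
  moreover have "Ck_on (Suc k) U (\<lambda>x. sin (h x))"
  proof (rule Ck_on_SucI)
    show "((\<lambda>x. sin (h x)) has_derivative (\<lambda>v. cos (h x) * ?D x v)) (at x)" if "x \<in> U" for x
      using D[OF that] by (auto intro!: derivative_eq_intros)
    show "Ck_on k U (\<lambda>x. cos (h x) * ?D x v)" for v
      by (intro Ck_on_bilinear[OF \<open>open U\<close> bounded_bilinear_mult] IH Dv)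
  qed (use \<open>open U\<close> in auto)
  ultimately show ?case by blast
qed

text \<open>The derivative is again a product of \<open>inverse (h x)\<close> and a derivative of
  \<open>h\<close>, so order \<open>k\<close> gives order \<open>k + 1\<close>.\<close>

lemma Ck_on_inverse:
  fixes h :: "'a::euclidean_space \<Rightarrow> real"
  assumes "open U" "\<And>x. x \<in> U \<Longrightarrow> h x \<noteq> 0" "Ck_on k U h"
  shows "Ck_on k U (\<lambda>x. inverse (h x))"
  using assms(3)
proof (induction k)
  case 0
  then show ?case using assms(2) by (auto intro: continuous_on_inverse)
next
  case (Suc k)
  let ?D = "\<lambda>x. frechet_derivative h (at x)"
  have IH: "Ck_on k U (\<lambda>x. inverse (h x))"
    using Suc Ck_on_Suc_imp by auto
  show ?case
  proof (rule Ck_on_SucI)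
    show "((\<lambda>x. inverse (h x)) has_derivative (\<lambda>v. - (inverse (h x) * ?D x v * inverse (h x)))) (at x)"
      if "x \<in> U" for x
      by (intro Deriv.has_derivative_inverse assms(2) that Ck_on_has_derivative[OF Suc.prems \<open>open U\<close> that])
    show "Ck_on k U (\<lambda>x. - (inverse (h x) * ?D x v * inverse (h x)))" for v
      by (intro Ck_on_bounded_linear[OF \<open>open U\<close> bounded_linear_minus[OF bounded_linear_ident]]
          Ck_on_bilinear[OF \<open>open U\<close> bounded_bilinear_mult] IH) (use Suc.prems in auto)
  qed (use \<open>open U\<close> in auto)
qed

lemma smooth_on_has_derivative:
  assumes "smooth_on U f" "open U" "x \<in> U"
  shows "(f has_derivative frechet_derivative f (at x)) (at x)"
  using assms Ck_on_has_derivative unfolding smooth_on_def by blast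

lemma smooth_on_differentiable:
  assumes "smooth_on U f" "open U" "x \<in> U"
  shows "f differentiable at x"
  using smooth_on_has_derivative[OF assms] by (auto simp: differentiable_def)

lemma smooth_on_continuous_on: "smooth_on U f \<Longrightarrow> continuous_on U f"
  unfolding smooth_on_def using Ck_on.simps(1) by blast

lemma smooth_on_partial: "smooth_on U F \<Longrightarrow> smooth_on U (partial i F)"
  unfolding smooth_on_def partial_def[abs_def] by (metis Ck_on.simps(2))

lemma smooth_on_const: "smooth_on U (\<lambda>x. c)"
  by (simp add: smooth_on_def Ck_on_const)

lemma smooth_on_linear: "open U \<Longrightarrow> bounded_linear L \<Longrightarrow> smooth_on U L"
  by (simp add: smooth_on_def Ck_on_linear)

lemma smooth_on_bounded_linear:
  "open U \<Longrightarrow> bounded_linear L \<Longrightarrow> smooth_on U f \<Longrightarrow> smooth_on U (\<lambda>x. L (f x))"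
  by (simp add: smooth_on_def Ck_on_bounded_linear)

lemma smooth_on_add:
  "open U \<Longrightarrow> smooth_on U f \<Longrightarrow> smooth_on U g \<Longrightarrow> smooth_on U (\<lambda>x. f x + g x)"
  by (simp add: smooth_on_def Ck_on_add)

lemma smooth_on_bilinear:
  "open U \<Longrightarrow> bounded_bilinear B \<Longrightarrow> smooth_on U f \<Longrightarrow> smooth_on U g \<Longrightarrow> smooth_on U (\<lambda>x. B (f x) (g x))"
  by (simp add: smooth_on_def Ck_on_bilinear)

lemma smooth_on_cos: "open U \<Longrightarrow> smooth_on U h \<Longrightarrow> smooth_on U (\<lambda>x. cos (h x :: real))"
  and smooth_on_sin: "open U \<Longrightarrow> smooth_on U h \<Longrightarrow> smooth_on U (\<lambda>x. sin (h x :: real))"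
  by (simp_all add: smooth_on_def Ck_on_cos_sin)

lemma smooth_on_inverse:
  "open U \<Longrightarrow> (\<And>x. x \<in> U \<Longrightarrow> h x \<noteq> 0) \<Longrightarrow> smooth_on U h \<Longrightarrow> smooth_on U (\<lambda>x. inverse (h x :: real))"
  by (simp add: smooth_on_def Ck_on_inverse)

lemma smooth_on_Pair:
  assumes "open U" "smooth_on U f" "smooth_on U g"
  shows "smooth_on U (\<lambda>x. (f x, g x))"
proof -
  have "smooth_on U (\<lambda>x. (f x, 0) + (0, g x))"
    by (intro smooth_on_add assms smooth_on_bounded_linear[where L = "\<lambda>x. (x, 0)"]
        smooth_on_bounded_linear[where L = "\<lambda>x. (0, x)"] bounded_linear_Pair
        bounded_linear_ident bounded_linear_zero)
  then show ?thesis by simp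
qed

section \<open>Partial derivatives\<close>

lemma partial_has_derivative:
  assumes "(F has_derivative F') (at u)"
  shows "partial i F u = F' (axis i 1)"
  unfolding partial_def using frechet_derivative_at[OF assms] by simp

lemma vec_eq_sum_axis: "v = (\<Sum>i\<in>UNIV. (v $ i) *\<^sub>R axis i (1::real))"
  using basis_expansion[of v] by (simp add: scalar_mult_eq_scaleR)

lemma has_derivative_partial:
  assumes "F differentiable at u"
  shows "(F has_derivative (\<lambda>v. \<Sum>i\<in>UNIV. (v $ i) *\<^sub>R partial i F u)) (at u)"
proof -
  have D: "(F has_derivative frechet_derivative F (at u)) (at u)"
    using assms frechet_derivative_works by blast
  then interpret L: bounded_linear "frechet_derivative F (at u)"
    by (rule has_derivative_bounded_linear)
  have "frechet_derivative F (at u) v = (\<Sum>i\<in>UNIV. (v $ i) *\<^sub>R partial i F u)" for v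
  proof -
    have "frechet_derivative F (at u) v = frechet_derivative F (at u) (\<Sum>i\<in>UNIV. (v $ i) *\<^sub>R axis i 1)"
      using vec_eq_sum_axis[of v] by simp
    then show ?thesis by (simp add: L.sum L.scaleR partial_def)
  qed
  then show ?thesis using D by presburger
qed

lemma partial_cong:
  assumes "open U" "u \<in> U" "\<And>w. w \<in> U \<Longrightarrow> F w = G w" "F differentiable at u"
  shows "partial i F u = partial i G u"
  unfolding partial_def using frechet_derivative_transform_within_open[OF assms(4,1,2,3)] by simp

lemma partial_bounded_linear:
  assumes "bounded_linear L" "F differentiable at u"
  shows "partial i (\<lambda>w. L (F w)) u = L (partial i F u)"
  using partial_has_derivative[OF bounded_linear.has_derivative[OF assms(1)]] assms(2)
  unfolding partial_def frechet_derivative_works by blast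

lemma partial_bilinear:
  assumes "bounded_bilinear B" "F differentiable at u" "G differentiable at u"
  shows "partial i (\<lambda>w. B (F w) (G w)) u = B (F u) (partial i G u) + B (partial i F u) (G u)"
  using partial_has_derivative[OF bounded_bilinear.FDERIV[OF assms(1)]] assms(2,3)
  unfolding partial_def frechet_derivative_works by blast

lemma differentiable_bilinear:
  assumes "bounded_bilinear B" "F differentiable at u" "G differentiable at u"
  shows "(\<lambda>w. B (F w) (G w)) differentiable at u"
  using bounded_bilinear.FDERIV[OF assms(1)] assms(2,3) unfolding differentiable_def by blast

lemma differentiable_bounded_linear:
  assumes "bounded_linear L" "F differentiable at u"
  shows "(\<lambda>w. L (F w)) differentiable at u"
  using bounded_linear.has_derivative[OF assms(1)] assms(2) unfolding differentiable_def by blast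

section \<open>Symmetry of second partial derivatives\<close>

lemma has_real_derivative_along_axis:
  fixes f :: "real^'n \<Rightarrow> real"
  assumes "f differentiable at (u + t *\<^sub>R axis i 1)"
  shows "((\<lambda>t. f (u + t *\<^sub>R axis i 1)) has_real_derivative partial i f (u + t *\<^sub>R axis i 1)) (at t)"
proof -
  let ?D = "frechet_derivative f (at (u + t *\<^sub>R axis i 1))"
  have D: "(f has_derivative ?D) (at (u + t *\<^sub>R axis i 1))"
    using assms frechet_derivative_works by blast
  then interpret L: bounded_linear ?D
    by (rule has_derivative_bounded_linear)
  have "((\<lambda>t. u + t *\<^sub>R axis i 1) has_derivative (\<lambda>s. s *\<^sub>R axis i 1)) (at t)"
    by (auto intro!: derivative_eq_intros)
  from has_derivative_compose[OF this D] show ?thesis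
    by (simp add: has_field_derivative_def L.scaleR partial_def mult_commute_abs)
qed

text \<open>Two mean value arguments: one in direction \<open>i\<close> for the increment of
  \<open>f\<close> over a step \<open>s\<close> in direction \<open>j\<close>, then one in direction
  \<open>j\<close> for \<open>partial i f\<close>. Each displacement is at most \<open>s\<close>,
  which explains the radius \<open>2 * s\<close>.\<close>

lemma second_difference_eq_partial:
  fixes f :: "real^'n \<Rightarrow> real"
  assumes "0 < s" and sub: "cball u (2 * s) \<subseteq> U"
    and f: "\<And>w. w \<in> U \<Longrightarrow> f differentiable at w"
    and f': "\<And>w. w \<in> U \<Longrightarrow> partial i f differentiable at w"
  shows "\<exists>w\<in>cball u (2 * s). f (u + s *\<^sub>R axis i 1 + s *\<^sub>R axis j 1) - f (u + s *\<^sub>R axis i 1)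
    - f (u + s *\<^sub>R axis j 1) + f u = s\<^sup>2 * partial j (partial i f) w"
proof -
  have near: "u + a *\<^sub>R axis i 1 + b *\<^sub>R axis j 1 \<in> cball u (2 * s)"
    if "0 \<le> a" "a \<le> s" "0 \<le> b" "b \<le> s" for a b
  proof -
    have "norm (a *\<^sub>R axis i 1 + b *\<^sub>R axis j (1::real)) \<le> \<bar>a\<bar> + \<bar>b\<bar>"
      using norm_triangle_ineq[of "a *\<^sub>R axis i 1" "b *\<^sub>R axis j (1::real)"] by simp
    moreover have "dist u (u + a *\<^sub>R axis i 1 + b *\<^sub>R axis j 1) = norm (a *\<^sub>R axis i 1 + b *\<^sub>R axis j (1::real))"
      unfolding dist_commute[of u] by (simp add: dist_norm add.assoc)
    ultimately show ?thesis using that by simp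
  qed
  let ?h = "\<lambda>a. f ((u + s *\<^sub>R axis j 1) + a *\<^sub>R axis i 1) - f (u + a *\<^sub>R axis i 1)"
  have "\<exists>z. 0 < z \<and> z < s \<and> ?h s - ?h 0 = (s - 0) *
      (partial i f ((u + s *\<^sub>R axis j 1) + z *\<^sub>R axis i 1) - partial i f (u + z *\<^sub>R axis i 1))"
  proof (rule MVT2[OF \<open>0 < s\<close>])
    fix a assume a: "0 \<le> a" "a \<le> s"
    have "(u + s *\<^sub>R axis j 1) + a *\<^sub>R axis i 1 \<in> U" "u + a *\<^sub>R axis i 1 \<in> U"
      using near[of a s] near[of a 0] a sub \<open>0 < s\<close> by (auto simp: algebra_simps)
    then show "(?h has_real_derivative
      (partial i f ((u + s *\<^sub>R axis j 1) + a *\<^sub>R axis i 1) - partial i f (u + a *\<^sub>R axis i 1))) (at a)"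
      by (intro DERIV_diff has_real_derivative_along_axis f)
  qed
  then obtain z where z: "0 < z" "z < s" and hz: "?h s - ?h 0 = s *
      (partial i f ((u + s *\<^sub>R axis j 1) + z *\<^sub>R axis i 1) - partial i f (u + z *\<^sub>R axis i 1))"
    by auto
  let ?v = "u + z *\<^sub>R axis i 1"
  have "\<exists>y. 0 < y \<and> y < s \<and> partial i f (?v + s *\<^sub>R axis j 1) - partial i f (?v + 0 *\<^sub>R axis j 1) =
      (s - 0) * partial j (partial i f) (?v + y *\<^sub>R axis j 1)"
  proof (rule MVT2[OF \<open>0 < s\<close>])
    fix b assume b: "0 \<le> b" "b \<le> s"
    have "?v + b *\<^sub>R axis j 1 \<in> U"
      using near[of z b] b z sub by auto
    then show "((\<lambda>b. partial i f (?v + b *\<^sub>R axis j 1)) has_real_derivative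
      partial j (partial i f) (?v + b *\<^sub>R axis j 1)) (at b)"
      by (intro has_real_derivative_along_axis f')
  qed
  then obtain y where y: "0 < y" "y < s" and hy: "partial i f (?v + s *\<^sub>R axis j 1) - partial i f ?v =
      s * partial j (partial i f) (?v + y *\<^sub>R axis j 1)"
    by auto
  have "?h s - ?h 0 = s\<^sup>2 * partial j (partial i f) (?v + y *\<^sub>R axis j 1)"
    using hz hy by (simp add: power2_eq_square algebra_simps)
  moreover have "?v + y *\<^sub>R axis j 1 \<in> cball u (2 * s)"
    using near[of z y] z y by auto
  ultimately show ?thesis
    by (intro bexI[of _ "?v + y *\<^sub>R axis j 1"]) (auto simp: algebra_simps)
qed

text \<open>The second difference is symmetric in \<open>i\<close> and \<open>j\<close>, so the two
  mixed partials agree when taken at suitable, possibly different, points near \<open>u\<close>.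
  Continuity at \<open>u\<close> does the rest.\<close>

lemma partial_commute_real:
  fixes f :: "real^'n \<Rightarrow> real"
  assumes f: "smooth_on U f" and "open U" "u \<in> U"
  shows "partial i (partial j f) u = partial j (partial i f) u"
proof (rule ccontr)
  assume neq: "\<not> ?thesis"
  \<comment> \<open>Half the supposed gap: two errors smaller than \<open>e\<close> cannot bridge
    it.\<close>
  define e where "e = \<bar>partial i (partial j f) u - partial j (partial i f) u\<bar> / 2"
  have "0 < e" using neq by (simp add: e_def)
  have close: "\<exists>d>0. \<forall>w. dist w u < d \<longrightarrow> \<bar>partial k (partial l f) w - partial k (partial l f) u\<bar> < e" for k l
  proof -
    have "isCont (partial k (partial l f)) u"
      using smooth_on_continuous_on[OF smooth_on_partial[OF smooth_on_partial[OF f]]] \<open>open U\<close> \<open>u \<in> U\<close>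
      by (simp add: continuous_on_eq_continuous_at)
    then show ?thesis
      using \<open>0 < e\<close> unfolding continuous_at_eps_delta by (auto simp: dist_real_def)
  qed
  obtain d1 where d1: "0 < d1"
    "\<And>w. dist w u < d1 \<Longrightarrow> \<bar>partial i (partial j f) w - partial i (partial j f) u\<bar> < e"
    using close by blast
  obtain d2 where d2: "0 < d2"
    "\<And>w. dist w u < d2 \<Longrightarrow> \<bar>partial j (partial i f) w - partial j (partial i f) u\<bar> < e"
    using close by blast
  obtain d3 where d3: "0 < d3" "cball u d3 \<subseteq> U"
    using \<open>open U\<close> \<open>u \<in> U\<close> open_contains_cball by blast
  \<comment> \<open>A third, so that \<open>2 * s\<close> is strictly below all three radii.\<close>
  define s where "s = min d3 (min d1 d2) / 3"
  have s: "0 < s" "2 * s < d1" "2 * s < d2" "cball u (2 * s) \<subseteq> U"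
    using d1(1) d2(1) d3 by (auto simp: s_def min_def)
  have diff: "f differentiable at w" "partial k f differentiable at w" if "w \<in> U" for w k
    using smooth_on_differentiable[OF f \<open>open U\<close> that]
      smooth_on_differentiable[OF smooth_on_partial[OF f] \<open>open U\<close> that] .
  obtain w1 where w1: "w1 \<in> cball u (2 * s)" "f (u + s *\<^sub>R axis i 1 + s *\<^sub>R axis j 1)
      - f (u + s *\<^sub>R axis i 1) - f (u + s *\<^sub>R axis j 1) + f u = s\<^sup>2 * partial j (partial i f) w1"
    using second_difference_eq_partial[OF s(1,4), of f i j] diff by blast
  obtain w2 where w2: "w2 \<in> cball u (2 * s)" "f (u + s *\<^sub>R axis j 1 + s *\<^sub>R axis i 1)
      - f (u + s *\<^sub>R axis j 1) - f (u + s *\<^sub>R axis i 1) + f u = s\<^sup>2 * partial i (partial j f) w2"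
    using second_difference_eq_partial[OF s(1,4), of f j i] diff by blast
  have "s\<^sup>2 * partial j (partial i f) w1 = s\<^sup>2 * partial i (partial j f) w2"
    using w1(2) w2(2) by (simp add: algebra_simps)
  then have "partial j (partial i f) w1 = partial i (partial j f) w2"
    using s(1) by simp
  moreover have "\<bar>partial j (partial i f) w1 - partial j (partial i f) u\<bar> < e"
    "\<bar>partial i (partial j f) w2 - partial i (partial j f) u\<bar> < e"
    using w1(1) w2(1) s by (auto simp: dist_commute intro!: d1(2) d2(2))
  ultimately show False
    unfolding e_def by (simp add: abs_if field_simps split: if_splits)
qed

text \<open>The codomain may be infinite-dimensional, so the real case is applied to the functions
  \<open>F w \<bullet> b\<close> for every vector \<open>b\<close>; the difference of the mixed
  partials is then tested against itself.\<close>

lemma partial_commute: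
  fixes F :: "real^'n \<Rightarrow> 'b::real_inner"
  assumes F: "smooth_on U F" and U: "open U" "u \<in> U"
  shows "partial i (partial j F) u = partial j (partial i F) u"
proof -
  have *: "partial i (partial j F) u \<bullet> b = partial i (partial j (\<lambda>w. F w \<bullet> b)) u" for b i j
  proof -
    have "partial j (\<lambda>w. F w \<bullet> b) w = partial j F w \<bullet> b" if "w \<in> U" for w
      using partial_bounded_linear[OF bounded_linear_inner_left smooth_on_differentiable[OF F U(1) that]] .
    then have "partial i (\<lambda>w. partial j F w \<bullet> b) u = partial i (partial j (\<lambda>w. F w \<bullet> b)) u"
      by (intro partial_cong[OF U] differentiable_bounded_linear[OF bounded_linear_inner_left]
          smooth_on_differentiable[OF smooth_on_partial[OF F] U]) auto
    then show ?thesis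
      using partial_bounded_linear[OF bounded_linear_inner_left
          smooth_on_differentiable[OF smooth_on_partial[OF F] U]] by metis
  qed
  have "partial i (partial j F) u \<bullet> b = partial j (partial i F) u \<bullet> b" for b
    unfolding * using partial_commute_real[OF _ U] smooth_on_bounded_linear[OF U(1) bounded_linear_inner_left F]
    by blast
  then have "(partial i (partial j F) u - partial j (partial i F) u) \<bullet> b = 0" for b
    by (simp add: inner_diff_left)
  from this[of "partial i (partial j F) u - partial j (partial i F) u"] show ?thesis by simp
qed

section \<open>Derivative of determinants and inverse matrices\<close>

lemma differentiable_cong_open:
  assumes "open U" "u \<in> U" "\<And>w. w \<in> U \<Longrightarrow> F w = G w" "F differentiable at u"
  shows "G differentiable at u"
proof -
  obtain D where "(F has_derivative D) (at u)"
    using assms(4) unfolding differentiable_def by blast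
  from has_derivative_transform_within_open[OF this assms(1,2,3)] show ?thesis
    unfolding differentiable_def by blast
qed

text \<open>In the Leibniz expansion the derivative hits one row \<open>r\<close> at a time, and for
  fixed \<open>r\<close> the terms reassemble into the determinant with that row replaced by its
  derivative.\<close>

lemma has_derivative_det:
  fixes M :: "'a::real_normed_vector \<Rightarrow> real^'n^'n"
  assumes "\<And>i j. ((\<lambda>w. M w $ i $ j) has_derivative (\<lambda>v. M' v $ i $ j)) (at u)"
  shows "((\<lambda>w. Determinants.det (M w)) has_derivative
    (\<lambda>v. \<Sum>r\<in>UNIV. Determinants.det (\<chi> i. if i = r then M' v $ i else M u $ i))) (at u)"
proof -
  have "((\<lambda>w. Determinants.det (M w)) has_derivative (\<lambda>v. \<Sum>p | p permutes (UNIV :: 'n set).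
      of_int (sign p) * (\<Sum>r\<in>UNIV. M' v $ r $ p r * (\<Prod>i\<in>UNIV - {r}. M u $ i $ p i)))) (at u)"
    unfolding Determinants.det_def
    by (intro has_derivative_sum has_derivative_mult_right has_derivative_prod assms)
  moreover have "(\<Sum>p | p permutes (UNIV :: 'n set).
      of_int (sign p) * (\<Sum>r\<in>UNIV. M' v $ r $ p r * (\<Prod>i\<in>UNIV - {r}. M u $ i $ p i))) =
      (\<Sum>r\<in>UNIV. Determinants.det (\<chi> i. if i = r then M' v $ i else M u $ i))" (is "?l = ?r") for v
  proof -
    have "?r = (\<Sum>r\<in>UNIV. \<Sum>p | p permutes (UNIV :: 'n set).
        of_int (sign p) * (M' v $ r $ p r * (\<Prod>i\<in>UNIV - {r}. M u $ i $ p i)))"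
      unfolding Determinants.det_def
    proof (intro sum.cong refl arg_cong2[where f = "(*)"])
      fix r and p :: "'n \<Rightarrow> 'n"
      show "(\<Prod>i\<in>UNIV. (\<chi> i. if i = r then M' v $ i else M u $ i) $ i $ p i) =
        M' v $ r $ p r * (\<Prod>i\<in>UNIV - {r}. M u $ i $ p i)"
        by (subst prod.remove[of _ r]) (auto intro!: prod.cong)
    qed
    also have "\<dots> = ?l"
      by (subst sum.swap) (simp add: sum_distrib_left)
    finally show ?thesis by simp
  qed
  ultimately show ?thesis by (simp only:)
qed

lemma matrix_inv_mult:
  fixes A :: "real^'n^'n"
  assumes "Determinants.det A \<noteq> 0"
  shows "A ** matrix_inv A = Finite_Cartesian_Product.mat 1" "matrix_inv A ** A = Finite_Cartesian_Product.mat 1"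
proof -
  have "\<exists>B. A ** B = Finite_Cartesian_Product.mat 1 \<and> B ** A = Finite_Cartesian_Product.mat 1"
    using assms invertible_det_nz[of A] unfolding invertible_def by blast
  then have "A ** matrix_inv A = Finite_Cartesian_Product.mat 1 \<and> matrix_inv A ** A = Finite_Cartesian_Product.mat 1"
    unfolding matrix_inv_def by (rule someI_ex)
  then show "A ** matrix_inv A = Finite_Cartesian_Product.mat 1" "matrix_inv A ** A = Finite_Cartesian_Product.mat 1" by auto
qed

text \<open>Writing \<open>B\<close> as \<open>(B ** matrix_inv A) ** A\<close> makes row
  \<open>r\<close> of \<open>B\<close> a combination of the rows of \<open>A\<close>. Replacing row
  \<open>r\<close> of \<open>A\<close> by it multiplies the determinant by the diagonal coefficient,
  and these coefficients add up to a trace.\<close>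

lemma jacobi_formula:
  fixes A B :: "real^'n^'n"
  assumes "Determinants.det A \<noteq> 0"
  shows "(\<Sum>r\<in>UNIV. Determinants.det (\<chi> i. if i = r then B $ i else A $ i)) =
    Determinants.det A * (\<Sum>i\<in>UNIV. \<Sum>j\<in>UNIV. matrix_inv A $ j $ i * B $ i $ j)"
proof -
  have "Determinants.det (\<chi> i. if i = r then B $ i else A $ i) =
      (B ** matrix_inv A) $ r $ r * Determinants.det A" for r
  proof -
    have "B = (B ** matrix_inv A) ** A"
      by (simp add: matrix_mul_assoc[symmetric] matrix_inv_mult(2)[OF assms])
    then have "B $ r = ((B ** matrix_inv A) ** A) $ r"
      by simp
    also have "\<dots> = (\<Sum>i\<in>UNIV. (B ** matrix_inv A) $ r $ i *s Finite_Cartesian_Product.row i A)"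
      by (simp add: Finite_Cartesian_Product.vec_eq_iff matrix_matrix_mult_def Finite_Cartesian_Product.row_def)
    finally have "(\<chi> i. if i = r then B $ i else A $ i) =
        (\<chi> i. if i = r then (\<Sum>i\<in>UNIV. (B ** matrix_inv A) $ r $ i *s Finite_Cartesian_Product.row i A) else Finite_Cartesian_Product.row i A)"
      by (simp add: Finite_Cartesian_Product.vec_eq_iff Finite_Cartesian_Product.row_def)
    then show ?thesis
      by (simp only: cramer_lemma_transpose[of r "(B ** matrix_inv A) $ r" A])
  qed
  then show ?thesis
    by (simp add: matrix_matrix_mult_def sum_distrib_left sum_distrib_right mult_ac)
qed

text \<open>\<open>matrix_inv\<close> is a choice term and cannot be differentiated as it stands;
  quotients of determinants can.\<close>

lemma matrix_inv_cramer:
  fixes A :: "real^'n^'n"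
  assumes "Determinants.det A \<noteq> 0"
  shows "matrix_inv A $ i $ j =
    Determinants.det (\<chi> r c. if c = i then axis j 1 $ r else A $ r $ c) / Determinants.det A"
proof -
  have "A *v (matrix_inv A *v axis j 1) = axis j 1"
    by (simp add: matrix_vector_mul_assoc matrix_inv_mult[OF assms])
  then have "matrix_inv A *v axis j 1 =
      (\<chi> k. Determinants.det (\<chi> r c. if c = k then axis j 1 $ r else A $ r $ c) / Determinants.det A)"
    using cramer[OF assms] by blast
  then have "(matrix_inv A *v axis j 1) $ i =
      Determinants.det (\<chi> r c. if c = i then axis j 1 $ r else A $ r $ c) / Determinants.det A"
    by simp
  then show ?thesis by (simp add: matrix_vector_mul_component inner_axis)
qed

lemma differentiable_det:
  fixes M :: "'a::real_normed_vector \<Rightarrow> real^'n^'n"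
  assumes "\<And>i j. (\<lambda>w. M w $ i $ j) differentiable at u"
  shows "(\<lambda>w. Determinants.det (M w)) differentiable at u"
proof -
  have "((\<lambda>w. M w $ i $ j) has_derivative
      (\<lambda>v. (\<chi> i j. frechet_derivative (\<lambda>w. M w $ i $ j) (at u) v) $ i $ j)) (at u)" for i j
    using assms frechet_derivative_works by fastforce
  from has_derivative_det[OF this] show ?thesis
    unfolding differentiable_def by blast
qed

lemma partial_det:
  fixes M :: "real^'m \<Rightarrow> real^'n^'n"
  assumes "\<And>i j. (\<lambda>w. M w $ i $ j) differentiable at u" "Determinants.det (M u) \<noteq> 0"
  shows "partial k (\<lambda>w. Determinants.det (M w)) u = Determinants.det (M u) *
    (\<Sum>i\<in>UNIV. \<Sum>j\<in>UNIV. matrix_inv (M u) $ j $ i * partial k (\<lambda>w. M w $ i $ j) u)"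
proof -
  have "((\<lambda>w. M w $ i $ j) has_derivative
      (\<lambda>v. (\<chi> i j. frechet_derivative (\<lambda>w. M w $ i $ j) (at u) v) $ i $ j)) (at u)" for i j
    using assms frechet_derivative_works by fastforce
  from partial_has_derivative[OF has_derivative_det[OF this]] show ?thesis
    by (simp add: jacobi_formula[OF assms(2)] partial_def)
qed

section \<open>The Laplacian in the coordinates of an immersion\<close>

text \<open>Isabelle's \<open>sqrt\<close> is odd, so the sign of the determinant is immaterial below.\<close>

lemma DERIV_sqrt_nonzero:
  fixes d :: real
  assumes "d \<noteq> 0"
  shows "DERIV sqrt d :> sqrt d / (2 * d)"
proof (rule DERIV_real_sqrt_generic[OF assms])
  show "sqrt d / (2 * d) = inverse (sqrt d) / 2" if "d > 0"
    using that real_div_sqrt[of d] by (simp add: divide_simps)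
  show "sqrt d / (2 * d) = - inverse (sqrt d) / 2" if "d < 0"
  proof -
    have "sqrt d * sqrt d = - d" using that by simp
    then have "d = - (sqrt d * sqrt d)" by linarith
    then have "sqrt d / (2 * d) = sqrt d / (2 * (- (sqrt d * sqrt d)))" by (rule arg_cong)
    also have "\<dots> = - inverse (sqrt d) / 2"
    proof -
      have "s / (2 * (- (s * s))) = - inverse s / 2" if "s \<noteq> 0" for s :: real
        using that by (simp add: field_simps)
      then show ?thesis using assms by (simp only: real_sqrt_eq_zero_cancel_iff not_False_eq_True)
    qed
    finally show ?thesis .
  qed
qed

text \<open>The metric is induced from an ambient inner product, so second derivatives of
  \<open>\<Phi>\<close> take the place of Christoffel symbols. The Gram identity is demanded on
  \<open>U\<close> only, because \<open>\<Phi>\<close> may fail to be differentiable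
  elsewhere.\<close>

locale euclidean_immersion =
  fixes U :: "(real^'n::finite) set" and \<Phi> :: "real^'n \<Rightarrow> 'e::euclidean_space"
    and g :: "real^'n \<Rightarrow> real^'n^'n"
  assumes open_U: "open U" and smooth: "smooth_on U \<Phi>"
    and immersive: "\<And>u. u \<in> U \<Longrightarrow> inj (frechet_derivative \<Phi> (at u))"
    and metric: "\<And>u i j. u \<in> U \<Longrightarrow> g u $ i $ j = partial i \<Phi> u \<bullet> partial j \<Phi> u"
begin

text \<open>For a Gram matrix, \<open>v \<bullet> (g u *v v)\<close> is the squared length of the
  image of \<open>v\<close> under the derivative of \<open>\<Phi>\<close>, so a kernel vector of
  \<open>g u\<close> is killed by an injective map.\<close>

lemma det_metric_nonzero:
  assumes "u \<in> U"
  shows "Determinants.det (g u) \<noteq> 0"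
proof -
  have "v = 0" if v: "g u *v v = 0" for v
  proof -
    have "(\<Sum>i\<in>UNIV. (v $ i) *\<^sub>R partial i \<Phi> u) \<bullet> (\<Sum>j\<in>UNIV. (v $ j) *\<^sub>R partial j \<Phi> u) = v \<bullet> (g u *v v)"
      by (simp add: inner_sum_left inner_sum_right inner_vec_def matrix_vector_mult_def
          metric[OF assms] sum_distrib_left mult_ac inner_commute)
    then have "(\<Sum>i\<in>UNIV. (v $ i) *\<^sub>R partial i \<Phi> u) = 0"
      using v by simp
    moreover have D: "(\<Phi> has_derivative (\<lambda>v. \<Sum>i\<in>UNIV. (v $ i) *\<^sub>R partial i \<Phi> u)) (at u)"
      by (rule has_derivative_partial[OF smooth_on_differentiable[OF smooth open_U assms]])
    ultimately have "frechet_derivative \<Phi> (at u) v = frechet_derivative \<Phi> (at u) 0"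
      unfolding frechet_derivative_at[OF D, symmetric] by simp
    then show "v = 0"
      using immersive[OF assms] by (simp add: inj_eq)
  qed
  then show ?thesis
    by (metis invertible_det_nz invertible_left_inverse matrix_left_invertible_ker)
qed

definition g_inv :: "'n \<Rightarrow> 'n \<Rightarrow> real^'n \<Rightarrow> real" where
  "g_inv i j w = matrix_inv (g w) $ i $ j"

definition sqrt_det :: "real^'n \<Rightarrow> real" where
  "sqrt_det w = sqrt (Determinants.det (g w))"

lemma sqrt_det_nonzero: "u \<in> U \<Longrightarrow> sqrt_det u \<noteq> 0"
  by (simp add: sqrt_det_def det_metric_nonzero)

lemma metric_sym: "u \<in> U \<Longrightarrow> g u $ i $ j = g u $ j $ i"
  by (simp add: metric inner_commute)

lemma g_inv_metric:
  assumes "u \<in> U"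
  shows "(\<Sum>j\<in>UNIV. g_inv i j u * g u $ j $ k) = (if i = k then 1 else 0)"
  using matrix_inv_mult(2)[OF det_metric_nonzero[OF assms]]
  unfolding g_inv_def by (auto simp: Finite_Cartesian_Product.vec_eq_iff matrix_matrix_mult_def Finite_Cartesian_Product.mat_def)

lemma g_inv_sym:
  assumes "u \<in> U"
  shows "g_inv i j u = g_inv j i u"
proof -
  let ?B = "matrix_inv (g u)"
  have "Finite_Cartesian_Product.transpose (g u) = g u"
    by (simp add: Finite_Cartesian_Product.vec_eq_iff Finite_Cartesian_Product.transpose_def metric_sym[OF assms])
  then have "Finite_Cartesian_Product.transpose ?B ** g u = Finite_Cartesian_Product.mat 1"
    by (metis matrix_inv_mult(1)[OF det_metric_nonzero[OF assms]] matrix_transpose_mul transpose_mat)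
  then have "Finite_Cartesian_Product.transpose ?B = ?B"
    by (metis matrix_inv_mult(1)[OF det_metric_nonzero[OF assms]] matrix_mul_assoc matrix_mul_lid matrix_mul_rid)
  then have "Finite_Cartesian_Product.transpose ?B $ i $ j = ?B $ i $ j"
    by simp
  then show ?thesis
    by (simp add: Finite_Cartesian_Product.transpose_def g_inv_def)
qed

lemma differentiable_metric: "u \<in> U \<Longrightarrow> (\<lambda>w. g w $ i $ j) differentiable at u"
  by (rule differentiable_cong_open[OF open_U, of _ "\<lambda>w. partial i \<Phi> w \<bullet> partial j \<Phi> w"])
    (auto simp: metric intro!: differentiable_bilinear[OF bounded_bilinear_inner]
      smooth_on_differentiable[OF smooth_on_partial[OF smooth] open_U])

lemma differentiable_sqrt_det:
  assumes "u \<in> U"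
  shows "sqrt_det differentiable at u"
proof -
  obtain D where "((\<lambda>w. Determinants.det (g w)) has_derivative D) (at u)"
    using differentiable_det[OF differentiable_metric[OF assms]] unfolding differentiable_def by blast
  moreover obtain d where "DERIV sqrt (Determinants.det (g u)) :> d"
    using DERIV_sqrt_nonzero[OF det_metric_nonzero[OF assms]] by blast
  ultimately have "((\<lambda>w. sqrt (Determinants.det (g w))) has_derivative (\<lambda>v. d * D v)) (at u)"
    unfolding has_field_derivative_def by (rule has_derivative_compose)
  then show ?thesis
    unfolding sqrt_det_def[abs_def] differentiable_def by blast
qed

text \<open>Each derivative of a Gram entry is a sum of two terms. After contraction with the
  symmetric inverse both give the same double sum, and the resulting 2 cancels the 1/2 from the
  square root.\<close>

lemma partial_sqrt_det:
  assumes "u \<in> U"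
  shows "partial k sqrt_det u =
    sqrt_det u * (\<Sum>i\<in>UNIV. \<Sum>j\<in>UNIV. g_inv i j u * (partial j \<Phi> u \<bullet> partial k (partial i \<Phi>) u))"
proof -
  let ?d = "Determinants.det (g u)"
  let ?S = "\<Sum>i\<in>UNIV. \<Sum>j\<in>UNIV. g_inv i j u * (partial j \<Phi> u \<bullet> partial k (partial i \<Phi>) u)"
  have diff\<Phi>: "partial i \<Phi> differentiable at u" for i
    by (rule smooth_on_differentiable[OF smooth_on_partial[OF smooth] open_U assms])
  have "partial k (\<lambda>w. g w $ i $ j) u =
      partial i \<Phi> u \<bullet> partial k (partial j \<Phi>) u + partial k (partial i \<Phi>) u \<bullet> partial j \<Phi> u" for i j
  proof -
    have "partial k (\<lambda>w. g w $ i $ j) u = partial k (\<lambda>w. partial i \<Phi> w \<bullet> partial j \<Phi> w) u"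
      using differentiable_metric[OF assms] by (intro partial_cong[OF open_U assms]) (auto simp: metric)
    then show ?thesis
      by (simp add: partial_bilinear[OF bounded_bilinear_inner diff\<Phi> diff\<Phi>])
  qed
  then have "partial k (\<lambda>w. Determinants.det (g w)) u = ?d * (\<Sum>i\<in>UNIV. \<Sum>j\<in>UNIV. g_inv j i u *
      (partial i \<Phi> u \<bullet> partial k (partial j \<Phi>) u + partial k (partial i \<Phi>) u \<bullet> partial j \<Phi> u))"
    using partial_det[OF differentiable_metric[OF assms] det_metric_nonzero[OF assms]]
    by (simp add: g_inv_def)
  also have "(\<Sum>i\<in>UNIV. \<Sum>j\<in>UNIV. g_inv j i u *
      (partial i \<Phi> u \<bullet> partial k (partial j \<Phi>) u + partial k (partial i \<Phi>) u \<bullet> partial j \<Phi> u)) =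
      (\<Sum>i\<in>UNIV. \<Sum>j\<in>UNIV. g_inv j i u * (partial i \<Phi> u \<bullet> partial k (partial j \<Phi>) u)) +
      (\<Sum>i\<in>UNIV. \<Sum>j\<in>UNIV. g_inv j i u * (partial k (partial i \<Phi>) u \<bullet> partial j \<Phi> u))"
    by (simp only: distrib_left sum.distrib)
  also have "(\<Sum>i\<in>UNIV. \<Sum>j\<in>UNIV. g_inv j i u * (partial k (partial i \<Phi>) u \<bullet> partial j \<Phi> u)) = ?S"
  proof (rule sum.cong[OF refl], rule sum.cong[OF refl])
    show "g_inv j i u * (partial k (partial i \<Phi>) u \<bullet> partial j \<Phi> u) =
        g_inv i j u * (partial j \<Phi> u \<bullet> partial k (partial i \<Phi>) u)" for i j
      by (simp only: g_inv_sym[OF assms, of j i] inner_commute[of "partial k (partial i \<Phi>) u"])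
  qed
  also have "(\<Sum>i\<in>UNIV. \<Sum>j\<in>UNIV. g_inv j i u * (partial i \<Phi> u \<bullet> partial k (partial j \<Phi>) u)) = ?S"
    by (rule sum.swap)
  finally have det: "partial k (\<lambda>w. Determinants.det (g w)) u = 2 * ?d * ?S"
    by simp
  define c where "c = sqrt ?d / (2 * ?d)"
  have c: "DERIV sqrt ?d :> c"
    unfolding c_def by (rule DERIV_sqrt_nonzero[OF det_metric_nonzero[OF assms]])
  have "((\<lambda>w. Determinants.det (g w)) has_derivative frechet_derivative (\<lambda>w. Determinants.det (g w)) (at u)) (at u)"
    using differentiable_det[OF differentiable_metric[OF assms]] frechet_derivative_works by blast
  then have "((\<lambda>w. sqrt (Determinants.det (g w))) has_derivative
      (\<lambda>v. c * frechet_derivative (\<lambda>w. Determinants.det (g w)) (at u) v)) (at u)"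
    using c unfolding has_field_derivative_def by (rule has_derivative_compose)
  from partial_has_derivative[OF this] have "partial k sqrt_det u = c * (2 * ?d * ?S)"
    by (simp add: sqrt_det_def[abs_def] partial_def[symmetric] det)
  moreover have "c * (2 * ?d) = sqrt_det u"
    using det_metric_nonzero[OF assms] by (simp add: c_def sqrt_det_def)
  moreover have "c * (2 * ?d * ?S) = c * (2 * ?d) * ?S"
    by (simp only: mult.assoc)
  ultimately show ?thesis by (simp only:)
qed

lemma differentiable_g_inv:
  assumes "u \<in> U"
  shows "g_inv i j differentiable at u"
proof (rule differentiable_cong_open[OF open_U assms])
  show "Determinants.det (\<chi> r c. if c = i then axis j 1 $ r else g w $ r $ c) / Determinants.det (g w) = g_inv i j w"
    if "w \<in> U" for w
    using matrix_inv_cramer[OF det_metric_nonzero[OF that], of i j] by (simp add: g_inv_def)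
  have "(\<lambda>w. Determinants.det (\<chi> r c. if c = i then axis j 1 $ r else g w $ r $ c)) differentiable at u"
  proof (rule differentiable_det)
    fix r c
    show "(\<lambda>w. (\<chi> r c. if c = i then axis j 1 $ r else g w $ r $ c) $ r $ c) differentiable at u"
      by (cases "c = i") (simp_all add: differentiable_metric[OF assms])
  qed
  then show "(\<lambda>w. Determinants.det (\<chi> r c. if c = i then axis j 1 $ r else g w $ r $ c) /
      Determinants.det (g w)) differentiable at u"
    using det_metric_nonzero[OF assms] differentiable_det[OF differentiable_metric[OF assms]]
    by (intro differentiable_divide) auto
qed

text \<open>The gradient weighted by the volume density; its coordinate divergence, divided by the
  density, is the Laplacian.\<close>

definition flux :: "(real^'n \<Rightarrow> 'b::real_normed_vector) \<Rightarrow> 'n \<Rightarrow> real^'n \<Rightarrow> 'b" where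
  "flux F i w = (\<Sum>j\<in>UNIV. (sqrt_det w * g_inv i j w) *\<^sub>R partial j F w)"

lemma coord_laplacian_eq:
  "coord_laplacian g F u = (1 / sqrt_det u) *\<^sub>R (\<Sum>i\<in>UNIV. partial i (flux F i) u)"
  by (simp add: coord_laplacian_def flux_def[abs_def] sqrt_det_def g_inv_def)

lemma differentiable_flux:
  assumes "smooth_on U F" "u \<in> U"
  shows "flux F i differentiable at u"
  unfolding flux_def[abs_def]
  by (intro differentiable_sum ballI differentiable_bilinear[OF bounded_bilinear_scaleR]
      differentiable_bilinear[OF bounded_bilinear_mult] differentiable_sqrt_det differentiable_g_inv
      smooth_on_differentiable[OF smooth_on_partial[OF assms(1)] open_U] assms(2)) auto

text \<open>Up to the density, the flux of \<open>\<Phi>\<close> is the frame dual to the coordinate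
  frame, because it contracts the metric with its inverse.\<close>

lemma flux_metric:
  assumes "u \<in> U"
  shows "flux \<Phi> i u \<bullet> partial k \<Phi> u = (if i = k then sqrt_det u else 0)"
proof -
  have "flux \<Phi> i u \<bullet> partial k \<Phi> u = sqrt_det u * (\<Sum>j\<in>UNIV. g_inv i j u * g u $ j $ k)"
    by (simp add: flux_def inner_sum_left metric[OF assms] sum_distrib_left mult_ac)
  then show ?thesis by (simp add: g_inv_metric[OF assms])
qed

text \<open>Differentiate the duality relation \<open>flux_metric\<close> and sum over
  \<open>i\<close>. The right side contributes the derivative of the density, and by symmetry of
  second partials the remaining sum pairs the flux with \<open>partial k (partial i \<Phi>)\<close>,
  which is that same derivative by Jacobi's formula. The two cancel.\<close>

lemma laplacian_immersion_normal:
  assumes "u \<in> U"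
  shows "coord_laplacian g \<Phi> u \<bullet> partial k \<Phi> u = 0"
proof -
  have diff\<Phi>: "partial i \<Phi> differentiable at u" for i
    by (rule smooth_on_differentiable[OF smooth_on_partial[OF smooth] open_U assms])
  have "partial i (flux \<Phi> i) u \<bullet> partial k \<Phi> u =
      (if i = k then partial k sqrt_det u else 0) - flux \<Phi> i u \<bullet> partial k (partial i \<Phi>) u" for i
  proof -
    have "partial i (\<lambda>w. flux \<Phi> i w \<bullet> partial k \<Phi> w) u = partial i (\<lambda>w. if i = k then sqrt_det w else 0) u"
      by (intro partial_cong[OF open_U assms] differentiable_bilinear[OF bounded_bilinear_inner]
          differentiable_flux[OF smooth assms] diff\<Phi>) (simp add: flux_metric)
    also have "\<dots> = (if i = k then partial k sqrt_det u else 0)"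
      by (simp add: partial_def)
    finally show ?thesis
      by (simp add: partial_bilinear[OF bounded_bilinear_inner differentiable_flux[OF smooth assms] diff\<Phi>]
          partial_commute[OF smooth open_U assms, of k i])
  qed
  then have "(\<Sum>i\<in>UNIV. partial i (flux \<Phi> i) u) \<bullet> partial k \<Phi> u =
      partial k sqrt_det u - (\<Sum>i\<in>UNIV. flux \<Phi> i u \<bullet> partial k (partial i \<Phi>) u)"
    by (simp add: inner_sum_left sum_subtractf)
  also have "(\<Sum>i\<in>UNIV. flux \<Phi> i u \<bullet> partial k (partial i \<Phi>) u) = partial k sqrt_det u"
    by (simp add: partial_sqrt_det[OF assms] flux_def inner_sum_left sum_distrib_left mult_ac)
  finally show ?thesis
    by (simp add: coord_laplacian_eq)
qed

lemma laplacian_bounded_linear: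
  assumes "bounded_linear L" "smooth_on U F" "u \<in> U"
  shows "coord_laplacian g (\<lambda>w. L (F w)) u = L (coord_laplacian g F u)"
proof -
  interpret L: bounded_linear L by fact
  have "flux (\<lambda>w. L (F w)) i w = L (flux F i w)" if "w \<in> U" for i w
    by (simp add: flux_def L.sum L.scaleR
        partial_bounded_linear[OF assms(1) smooth_on_differentiable[OF assms(2) open_U that]])
  then have "partial i (\<lambda>w. L (flux F i w)) u = partial i (flux (\<lambda>w. L (F w)) i) u" for i
    by (intro partial_cong[OF open_U assms(3)] differentiable_bounded_linear[OF assms(1)]
        differentiable_flux[OF assms(2,3)]) auto
  then have "partial i (flux (\<lambda>w. L (F w)) i) u = L (partial i (flux F i) u)" for i
    using partial_bounded_linear[OF assms(1) differentiable_flux[OF assms(2,3)]] by metis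
  then show ?thesis
    by (simp add: coord_laplacian_eq L.sum L.scaleR)
qed

text \<open>Stated for a general bilinear map because it is applied both to the inner product
  (constant squared norms) and to scalar multiplication (a trigonometric factor times a sphere
  coordinate).\<close>

lemma laplacian_bilinear:
  assumes "bounded_bilinear B" and F: "smooth_on U F" and H: "smooth_on U H" and u: "u \<in> U"
  shows "coord_laplacian g (\<lambda>w. B (F w) (H w)) u =
    B (F u) (coord_laplacian g H u) + B (coord_laplacian g F u) (H u) +
    2 *\<^sub>R (\<Sum>i\<in>UNIV. \<Sum>j\<in>UNIV. g_inv i j u *\<^sub>R B (partial i F u) (partial j H u))"
proof -
  interpret B: bounded_bilinear B by fact
  let ?T = "\<lambda>i j. (sqrt_det u * g_inv i j u) *\<^sub>R B (partial i F u) (partial j H u)"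
  note diff = smooth_on_differentiable[OF F open_U] smooth_on_differentiable[OF H open_U]
  have "flux (\<lambda>w. B (F w) (H w)) i w = B (F w) (flux H i w) + B (flux F i w) (H w)" if "w \<in> U" for i w
    by (simp add: flux_def partial_bilinear[OF assms(1) diff[OF that]] scaleR_add_right sum.distrib
        B.sum_left B.sum_right B.scaleR_left B.scaleR_right)
  then have "partial i (\<lambda>w. B (F w) (flux H i w) + B (flux F i w) (H w)) u =
      partial i (flux (\<lambda>w. B (F w) (H w)) i) u" for i
    by (intro partial_cong[OF open_U u] differentiable_add differentiable_bilinear[OF assms(1)]
        differentiable_flux[OF F u] differentiable_flux[OF H u] diff u) auto
  moreover have "partial i (\<lambda>w. B (F w) (flux H i w) + B (flux F i w) (H w)) u =
      (B (F u) (partial i (flux H i) u) + B (partial i F u) (flux H i u)) +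
      (B (flux F i u) (partial i H u) + B (partial i (flux F i) u) (H u))" for i
  proof -
    have "partial i (\<lambda>w. B (F w) (flux H i w) + B (flux F i w) (H w)) u =
        partial i (\<lambda>w. B (F w) (flux H i w)) u + partial i (\<lambda>w. B (flux F i w) (H w)) u"
      using partial_has_derivative[OF has_derivative_add[OF
            frechet_derivative_works[THEN iffD1, OF differentiable_bilinear[OF assms(1) diff(1)[OF u] differentiable_flux[OF H u]]]
            frechet_derivative_works[THEN iffD1, OF differentiable_bilinear[OF assms(1) differentiable_flux[OF F u] diff(2)[OF u]]]]]
      unfolding partial_def .
    then show ?thesis
      by (simp add: partial_bilinear[OF assms(1)] differentiable_flux[OF F u] differentiable_flux[OF H u] diff u)
  qed
  ultimately have "partial i (flux (\<lambda>w. B (F w) (H w)) i) u =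
      (B (F u) (partial i (flux H i) u) + B (partial i F u) (flux H i u)) +
      (B (flux F i u) (partial i H u) + B (partial i (flux F i) u) (H u))" for i
    by metis
  then have "(\<Sum>i\<in>UNIV. partial i (flux (\<lambda>w. B (F w) (H w)) i) u) =
      B (F u) (\<Sum>i\<in>UNIV. partial i (flux H i) u) + B (\<Sum>i\<in>UNIV. partial i (flux F i) u) (H u) +
      ((\<Sum>i\<in>UNIV. B (partial i F u) (flux H i u)) + (\<Sum>i\<in>UNIV. B (flux F i u) (partial i H u)))"
    by (simp add: sum.distrib B.sum_left B.sum_right)
  also have "(\<Sum>i\<in>UNIV. B (partial i F u) (flux H i u)) = (\<Sum>i\<in>UNIV. \<Sum>j\<in>UNIV. ?T i j)"
    by (simp add: flux_def B.sum_right B.scaleR_right)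
  \<comment> \<open>The two kinds of cross terms differ by exchanging \<open>i\<close> and
    \<open>j\<close>, so symmetry of the inverse metric identifies them.\<close>
  also have "(\<Sum>i\<in>UNIV. B (flux F i u) (partial i H u)) = (\<Sum>i\<in>UNIV. \<Sum>j\<in>UNIV. ?T i j)"
    by (subst sum.swap) (simp add: flux_def B.sum_left B.scaleR_left g_inv_sym[OF u])
  also have "(\<Sum>i\<in>UNIV. \<Sum>j\<in>UNIV. ?T i j) + (\<Sum>i\<in>UNIV. \<Sum>j\<in>UNIV. ?T i j) =
      (2 * sqrt_det u) *\<^sub>R (\<Sum>i\<in>UNIV. \<Sum>j\<in>UNIV. g_inv i j u *\<^sub>R B (partial i F u) (partial j H u))"
    by (simp add: scaleR_2[symmetric] scaleR_sum_right mult.assoc)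
  finally show ?thesis
    using sqrt_det_nonzero[OF u]
    by (simp add: coord_laplacian_eq scaleR_add_right B.scaleR_left B.scaleR_right)
qed

lemma laplacian_compose:
  assumes \<psi>: "\<And>x. (\<psi> has_real_derivative \<psi>' x) (at x)" and \<psi>': "\<And>x. (\<psi>' has_real_derivative \<psi>'' x) (at x)"
    and h: "smooth_on U h" and u: "u \<in> U"
  shows "coord_laplacian g (\<lambda>w. \<psi> (h w)) u = \<psi>' (h u) * coord_laplacian g h u +
    \<psi>'' (h u) * (\<Sum>i\<in>UNIV. \<Sum>j\<in>UNIV. g_inv i j u * (partial i h u * partial j h u))"
proof -
  have comp: "((\<lambda>w. \<eta> (h w)) has_derivative (\<lambda>v. d * frechet_derivative h (at w) v)) (at w)"
    if "w \<in> U" "(\<eta> has_real_derivative d) (at (h w))" for w \<eta> d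
    using smooth_on_has_derivative[OF h open_U that(1)] that(2)
    unfolding has_field_derivative_def by (rule has_derivative_compose)
  have partial_comp: "partial i (\<lambda>w. \<eta> (h w)) w = d * partial i h w"
    if "w \<in> U" "(\<eta> has_real_derivative d) (at (h w))" for i w \<eta> d
    using partial_has_derivative[OF comp[OF that]] by (simp add: partial_def)
  have diff': "(\<lambda>w. \<psi>' (h w)) differentiable at u"
    using comp[OF u \<psi>'] unfolding differentiable_def by blast
  have "flux (\<lambda>w. \<psi> (h w)) i w = \<psi>' (h w) * flux h i w" if "w \<in> U" for i w
    by (simp add: flux_def partial_comp[OF that \<psi>] sum_distrib_left mult_ac)
  then have "partial i (\<lambda>w. \<psi>' (h w) * flux h i w) u = partial i (flux (\<lambda>w. \<psi> (h w)) i) u" for i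
    by (intro partial_cong[OF open_U u] differentiable_bilinear[OF bounded_bilinear_mult]
        diff' differentiable_flux[OF h u]) auto
  then have "partial i (flux (\<lambda>w. \<psi> (h w)) i) u =
      \<psi>' (h u) * partial i (flux h i) u + \<psi>'' (h u) * partial i h u * flux h i u" for i
    using partial_bilinear[OF bounded_bilinear_mult diff' differentiable_flux[OF h u], of i i]
      partial_comp[OF u \<psi>', of i] by simp
  then have "(\<Sum>i\<in>UNIV. partial i (flux (\<lambda>w. \<psi> (h w)) i) u) = \<psi>' (h u) * (\<Sum>i\<in>UNIV. partial i (flux h i) u) +
      sqrt_det u * (\<psi>'' (h u) * (\<Sum>i\<in>UNIV. \<Sum>j\<in>UNIV. g_inv i j u * (partial i h u * partial j h u)))"
    by (simp add: sum.distrib flux_def sum_distrib_left mult_ac)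
  then show ?thesis
    using sqrt_det_nonzero[OF u] by (simp add: coord_laplacian_eq field_simps)
qed

section \<open>Orthogonal projection onto the tangent space\<close>

definition tangent_proj :: "real^'n \<Rightarrow> 'e \<Rightarrow> 'e" where
  "tangent_proj u v = (\<Sum>i\<in>UNIV. \<Sum>j\<in>UNIV. (g_inv i j u * (partial j \<Phi> u \<bullet> v)) *\<^sub>R partial i \<Phi> u)"

lemma linear_tangent_proj: "linear (tangent_proj u)"
proof (rule linearI)
  show "tangent_proj u (v + w) = tangent_proj u v + tangent_proj u w" for v w
    by (simp add: tangent_proj_def inner_add_right distrib_left scaleR_add_left sum.distrib)
  show "tangent_proj u (r *\<^sub>R v) = r *\<^sub>R tangent_proj u v" for r v
    by (simp add: tangent_proj_def scaleR_sum_right mult.left_commute)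
qed

text \<open>Contracting the inverse metric with the metric fixes each coordinate vector, and these
  span the range of the derivative.\<close>

lemma tangent_proj_tangent:
  assumes "u \<in> U" "v \<in> range (frechet_derivative \<Phi> (at u))"
  shows "tangent_proj u v = v"
proof -
  interpret P: linear "tangent_proj u" by (rule linear_tangent_proj)
  have "tangent_proj u (partial k \<Phi> u) = partial k \<Phi> u" for k
  proof -
    have "tangent_proj u (partial k \<Phi> u) = (\<Sum>i\<in>UNIV. (\<Sum>j\<in>UNIV. g_inv i j u * g u $ j $ k) *\<^sub>R partial i \<Phi> u)"
      by (simp add: tangent_proj_def metric[OF assms(1)] scaleR_sum_left)
    also have "\<dots> = partial k \<Phi> u"
      by (simp add: g_inv_metric[OF assms(1)] if_distrib[of "\<lambda>c. c *\<^sub>R _"] cong: if_cong)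
    finally show ?thesis .
  qed
  moreover obtain a where "v = frechet_derivative \<Phi> (at u) a"
    using assms(2) by blast
  moreover have "frechet_derivative \<Phi> (at u) a = (\<Sum>i\<in>UNIV. (a $ i) *\<^sub>R partial i \<Phi> u)"
    using fun_cong[OF frechet_derivative_at[OF has_derivative_partial[OF
          smooth_on_differentiable[OF smooth open_U assms(1)]]], of a] by simp
  ultimately show ?thesis by (simp add: P.sum P.scale)
qed

lemma tangent_proj_normal:
  assumes "\<And>k. partial k \<Phi> u \<bullet> v = 0"
  shows "tangent_proj u v = 0"
  by (simp add: tangent_proj_def assms)

end

context euclidean_immersion
begin

lemma laplacian_cong:
  assumes "smooth_on U F" "\<And>w. w \<in> U \<Longrightarrow> F w = H w" "u \<in> U"
  shows "coord_laplacian g F u = coord_laplacian g H u"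
proof -
  have "partial j F w = partial j H w" if "w \<in> U" for j w
    using smooth_on_differentiable[OF assms(1) open_U that] assms(2) by (intro partial_cong[OF open_U that]) auto
  then have "flux F i w = flux H i w" if "w \<in> U" for i w
    using that by (simp add: flux_def)
  then have "partial i (flux F i) u = partial i (flux H i) u" for i
    by (intro partial_cong[OF open_U assms(3)] differentiable_flux[OF assms(1,3)]) auto
  then show ?thesis by (simp add: coord_laplacian_eq)
qed

lemma laplacian_const: "coord_laplacian g (\<lambda>w. c) u = 0"
  by (simp add: coord_laplacian_eq flux_def[abs_def] partial_def)

lemma laplacian_norm_one:
  fixes F :: "real^'n \<Rightarrow> 'b::real_inner"
  assumes F: "smooth_on U F" and "\<And>w. w \<in> U \<Longrightarrow> F w \<bullet> F w = 1" and u: "u \<in> U"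
  shows "F u \<bullet> coord_laplacian g F u = - coord_energy g F u"
proof -
  have "coord_laplacian g (\<lambda>w. F w \<bullet> F w) u = coord_laplacian g (\<lambda>w. 1) u"
    by (intro laplacian_cong smooth_on_bilinear[OF open_U bounded_bilinear_inner] F assms(2) u)
  then have "0 = F u \<bullet> coord_laplacian g F u + coord_laplacian g F u \<bullet> F u + 2 * coord_energy g F u"
    using laplacian_bilinear[OF bounded_bilinear_inner F F u]
    by (simp add: laplacian_const coord_energy_def g_inv_def)
  then show ?thesis by (simp add: inner_commute)
qed

lemma laplacian_immersion_tangent_proj: "u \<in> U \<Longrightarrow> tangent_proj u (coord_laplacian g \<Phi> u) = 0"
  by (rule tangent_proj_normal) (metis inner_commute laplacian_immersion_normal)

end

section \<open>The product metric as a Euclidean one\<close>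

definition rescale :: "real \<Rightarrow> real \<Rightarrow> ('p::finite, 'q::finite) ambient \<Rightarrow> ('p, 'q) ambient" where
  "rescale l1 l2 = (\<lambda>(a, v, w). (a, l1 *\<^sub>R v, l2 *\<^sub>R w))"

lemma rescale_Pair [simp]: "rescale l1 l2 (a, v, w) = (a, l1 *\<^sub>R v, l2 *\<^sub>R w)"
  by (simp add: rescale_def)

lemma bounded_linear_rescale: "bounded_linear (rescale l1 l2)"
  unfolding linear_conv_bounded_linear[symmetric]
  by (rule linearI) (auto simp: rescale_def algebra_simps split: prod.splits)

lemma product_metric_rescale: "product_metric l1 l2 v w = rescale l1 l2 v \<bullet> rescale l1 l2 w"
  by (auto simp: product_metric_def rescale_def power2_eq_square split: prod.splits)

text \<open>The space is the orthogonal complement of the two orthogonal vectors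
  \<open>(0, x, 0)\<close> and \<open>(0, 0, y)\<close> in dimension 1 + (p + 1) + (q + 1).\<close>

lemma dim_tangent_space:
  fixes x :: "real^(1 + 'p::finite)" and y :: "real^(1 + 'q::finite)"
  assumes "norm x = 1" "norm y = 1"
  shows "dim {(a :: real, v, w). x \<bullet> v = 0 \<and> y \<bullet> w = 0} = 1 + CARD('p) + CARD('q)"
proof -
  let ?B = "{(0 :: real, x, 0 :: real^(1 + 'q)), (0, 0, y)}"
  have "x \<noteq> 0" "y \<noteq> 0" using assms by auto
  have "pairwise real_inner_class.orthogonal ?B" "0 \<notin> ?B"
    using \<open>x \<noteq> 0\<close> \<open>y \<noteq> 0\<close> by (auto simp: pairwise_def real_inner_class.orthogonal_def zero_prod_def)
  then have "independent ?B" by (rule pairwise_orthogonal_independent)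
  moreover have "card ?B = 2"
    using \<open>x \<noteq> 0\<close> by simp
  ultimately have "dim (span ?B) = 2"
    by (metis dim_eq_card_independent dim_span)
  moreover have "dim {z \<in> UNIV. \<forall>b\<in>span ?B. real_inner_class.orthogonal b z} + dim (span ?B) =
      dim (UNIV :: ('p, 'q) ambient set)"
    by (rule dim_subspace_orthogonal_to_vectors) auto
  moreover have "{z \<in> UNIV. \<forall>b\<in>span ?B. real_inner_class.orthogonal b z} = {(a, v, w). x \<bullet> v = 0 \<and> y \<bullet> w = 0}"
  proof -
    have "(\<forall>b\<in>span ?B. real_inner_class.orthogonal b z) \<longleftrightarrow> (\<forall>b\<in>?B. real_inner_class.orthogonal b z)" for z
    proof (intro iffI ballI)
      show "real_inner_class.orthogonal b z" if "\<forall>b\<in>span ?B. real_inner_class.orthogonal b z" "b \<in> ?B" for b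
        using that(1) span_base[OF that(2)] by (rule bspec)
      show "real_inner_class.orthogonal b z" if "\<forall>b\<in>?B. real_inner_class.orthogonal b z" "b \<in> span ?B" for b
        by (subst orthogonal_commute, rule orthogonal_to_span[OF that(2)], subst orthogonal_commute)
          (rule bspec[OF that(1)])
    qed
    then show ?thesis by (auto simp: real_inner_class.orthogonal_def)
  qed
  ultimately show ?thesis by simp
qed

section \<open>The product of spheres\<close>

locale chart =
  fixes P l1 l2 :: real and U :: "(real^(1 + 'p::finite + 'q::finite)) set"
    and \<phi> :: "real^(1 + 'p + 'q) \<Rightarrow> ('p, 'q) ambient"
  assumes l: "l1 > 0" "l2 > 0" and chart: "local_param P U \<phi>"
begin

lemma U: "open U" and smooth_phi: "smooth_on U \<phi>" and phi_cover: "\<And>u. u \<in> U \<Longrightarrow> \<phi> u \<in> cover"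
  using chart by (auto simp: local_param_def)

lemma diff_phi: "u \<in> U \<Longrightarrow> \<phi> differentiable at u"
  by (rule smooth_on_differentiable[OF smooth_phi U])

lemma partial_rescale_phi: "u \<in> U \<Longrightarrow> partial i (\<lambda>u. rescale l1 l2 (\<phi> u)) u = rescale l1 l2 (partial i \<phi> u)"
  by (rule partial_bounded_linear[OF bounded_linear_rescale diff_phi])

text \<open>Here the general results become available for an arbitrary chart: the rescaled chart has
  \<open>coord_metric\<close> as its Gram matrix, and it stays immersive because
  \<open>rescale\<close> is injective for positive radii.\<close>

sublocale euclidean_immersion U "\<lambda>u. rescale l1 l2 (\<phi> u)" "coord_metric l1 l2 \<phi>"
proof
  show "open U" by (rule U)
  show "smooth_on U (\<lambda>u. rescale l1 l2 (\<phi> u))"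
    by (rule smooth_on_bounded_linear[OF U bounded_linear_rescale smooth_phi])
  show "inj (frechet_derivative (\<lambda>u. rescale l1 l2 (\<phi> u)) (at u))" if "u \<in> U" for u
  proof -
    have "frechet_derivative (\<lambda>u. rescale l1 l2 (\<phi> u)) (at u) = (\<lambda>v. rescale l1 l2 (frechet_derivative \<phi> (at u) v))"
      using frechet_derivative_at[OF bounded_linear.has_derivative[OF bounded_linear_rescale
            smooth_on_has_derivative[OF smooth_phi U that]]] by simp
    moreover have "inj (rescale l1 l2 :: ('p, 'q) ambient \<Rightarrow> _)"
      using l by (auto simp: inj_def)
    moreover have "inj (frechet_derivative \<phi> (at u))"
      using chart that by (auto simp: local_param_def)
    ultimately show ?thesis
      using inj_compose[of "rescale l1 l2" "frechet_derivative \<phi> (at u)"] by (simp only: o_def)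
  qed
  show "coord_metric l1 l2 \<phi> u $ i $ j =
    partial i (\<lambda>u. rescale l1 l2 (\<phi> u)) u \<bullet> partial j (\<lambda>u. rescale l1 l2 (\<phi> u)) u" if "u \<in> U" for u i j
    by (simp add: coord_metric_def product_metric_rescale partial_rescale_phi[OF that])
qed

definition T :: "real^(1 + 'p + 'q) \<Rightarrow> real" where "T u = fst (\<phi> u)"
definition X :: "real^(1 + 'p + 'q) \<Rightarrow> real^(1 + 'p)" where "X u = fst (snd (\<phi> u))"
definition Y :: "real^(1 + 'p + 'q) \<Rightarrow> real^(1 + 'q)" where "Y u = snd (snd (\<phi> u))"

lemma phi_eq: "\<phi> u = (T u, X u, Y u)"
  by (simp add: T_def X_def Y_def)

lemma norm_XY: "u \<in> U \<Longrightarrow> norm (X u) = 1" "u \<in> U \<Longrightarrow> norm (Y u) = 1"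
  using phi_cover by (fastforce simp: cover_def phi_eq)+

lemma smooth_TXY: "smooth_on U T" "smooth_on U X" "smooth_on U Y"
  unfolding T_def[abs_def] X_def[abs_def] Y_def[abs_def]
  using smooth_on_bounded_linear[OF U bounded_linear_fst smooth_phi]
    smooth_on_bounded_linear[OF U bounded_linear_fst smooth_on_bounded_linear[OF U bounded_linear_snd smooth_phi]]
    smooth_on_bounded_linear[OF U bounded_linear_snd smooth_on_bounded_linear[OF U bounded_linear_snd smooth_phi]] .

lemma partial_phi:
  assumes "u \<in> U"
  shows "partial i \<phi> u = (partial i T u, partial i X u, partial i Y u)"
  using partial_bounded_linear[OF bounded_linear_fst diff_phi[OF assms], of i]
    partial_bounded_linear[OF bounded_linear_compose[OF bounded_linear_fst bounded_linear_snd] diff_phi[OF assms], of i]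
    partial_bounded_linear[OF bounded_linear_compose[OF bounded_linear_snd bounded_linear_snd] diff_phi[OF assms], of i]
  by (simp add: T_def[abs_def] X_def[abs_def] Y_def[abs_def] prod_eq_iff)

lemma inner_partial_norm_one:
  assumes F: "smooth_on U F" and "\<And>w. w \<in> U \<Longrightarrow> norm (F w :: 'b::real_inner) = 1" and u: "u \<in> U"
  shows "F u \<bullet> partial i F u = 0"
proof -
  note diff = smooth_on_differentiable[OF F U u]
  have "partial i (\<lambda>w. F w \<bullet> F w) u = partial i (\<lambda>w. 1 :: real) u"
    by (intro partial_cong[OF U u] differentiable_bilinear[OF bounded_bilinear_inner] diff)
      (simp add: assms(2) dot_square_norm)
  then show ?thesis
    using partial_bilinear[OF bounded_bilinear_inner diff diff, of i]
    by (simp add: partial_def inner_commute)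
qed

text \<open>Differentiating the unit norms of \<open>X\<close> and \<open>Y\<close> gives one
  inclusion; equality follows since an injective derivative has range of dimension p + q +
  1.\<close>

lemma range_derivative:
  assumes u: "u \<in> U"
  shows "range (frechet_derivative (\<lambda>u. rescale l1 l2 (\<phi> u)) (at u)) = {(a, v, w). X u \<bullet> v = 0 \<and> Y u \<bullet> w = 0}"
proof -
  let ?D = "frechet_derivative (\<lambda>u. rescale l1 l2 (\<phi> u)) (at u)"
  have "bounded_linear ?D"
    by (rule has_derivative_bounded_linear[OF smooth_on_has_derivative[OF smooth U u]])
  then have lin: "linear ?D" by (rule bounded_linear.linear)
  show ?thesis
  proof (rule subspace_dim_equal)
    show "subspace (range ?D)"
      using lin by (simp add: linear_subspace_image)
    show "subspace {(a :: real, v, w). X u \<bullet> v = 0 \<and> Y u \<bullet> w = 0}"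
      by (auto simp: subspace_def inner_add_right zero_prod_def)
    show "range ?D \<subseteq> {(a, v, w). X u \<bullet> v = 0 \<and> Y u \<bullet> w = 0}"
    proof
      fix z assume "z \<in> range ?D"
      then obtain c where "z = ?D c" by blast
      also have "?D c = (\<Sum>i\<in>UNIV. (c $ i) *\<^sub>R rescale l1 l2 (partial i \<phi> u))"
        using fun_cong[OF frechet_derivative_at[OF has_derivative_partial[OF
            smooth_on_differentiable[OF smooth U u]]], of c] by (simp add: partial_rescale_phi[OF u])
      finally show "z \<in> {(a, v, w). X u \<bullet> v = 0 \<and> Y u \<bullet> w = 0}"
        by (simp add: partial_phi[OF u] case_prod_beta fst_sum snd_sum inner_sum_right
            inner_partial_norm_one[OF smooth_TXY(2) norm_XY(1) u] inner_partial_norm_one[OF smooth_TXY(3) norm_XY(2) u])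
    qed
    have "dim (range ?D) = dim (UNIV :: (real^(1 + 'p + 'q)) set)"
      using immersive[OF u] by (intro dim_image_eq lin) (simp add: inj_on_def inj_def)
    then show "dim {(a :: real, v, w). X u \<bullet> v = 0 \<and> Y u \<bullet> w = 0} \<le> dim (range ?D)"
      by (simp add: dim_tangent_space norm_XY[OF u])
  qed
qed

text \<open>The vector splits into a tangential part, which the projection fixes, and a part normal
  to both spheres, which it kills. The result mentions the chart only through the point it
  parametrizes, so everything derived from it is the same in all charts.\<close>

lemma tangent_proj_eq:
  assumes u: "u \<in> U"
  shows "tangent_proj u (a, v, w) = (a, v - (X u \<bullet> v) *\<^sub>R X u, w - (Y u \<bullet> w) *\<^sub>R Y u)"
proof -
  interpret P: linear "tangent_proj u" by (rule linear_tangent_proj)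
  let ?t = "(a, v - (X u \<bullet> v) *\<^sub>R X u, w - (Y u \<bullet> w) *\<^sub>R Y u)"
  let ?n = "(0 :: real, (X u \<bullet> v) *\<^sub>R X u, (Y u \<bullet> w) *\<^sub>R Y u)"
  have "tangent_proj u ?t = ?t"
    by (rule tangent_proj_tangent[OF u])
      (simp add: range_derivative[OF u] inner_diff_right dot_square_norm norm_XY[OF u])
  moreover have "tangent_proj u ?n = 0"
    by (rule tangent_proj_normal)
      (simp add: partial_rescale_phi[OF u] partial_phi[OF u] inner_commute[of "partial _ _ _"]
        inner_partial_norm_one[OF smooth_TXY(2) norm_XY(1) u] inner_partial_norm_one[OF smooth_TXY(3) norm_XY(2) u])
  moreover have "(a, v, w) = ?t + ?n" by simp
  ultimately show ?thesis by (metis P.add add.right_neutral)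
qed

text \<open>The vector \<open>(1, 0, 0)\<close> is tangent, hence fixed by the projection. Its
  components carry all needed information about the gradient of \<open>T\<close>: unit length, and
  orthogonality to the gradients of \<open>X\<close> and \<open>Y\<close>.\<close>

lemma tangent_proj_T:
  assumes u: "u \<in> U"
  shows "(\<Sum>i\<in>UNIV. \<Sum>j\<in>UNIV. (g_inv i j u * partial j T u) *\<^sub>R rescale l1 l2 (partial i \<phi> u)) = (1, 0, 0)"
  using tangent_proj_eq[OF u, of 1 0 0]
  by (simp add: tangent_proj_def partial_rescale_phi[OF u] partial_phi[OF u])

lemma energy_T: "u \<in> U \<Longrightarrow> (\<Sum>i\<in>UNIV. \<Sum>j\<in>UNIV. g_inv i j u * (partial i T u * partial j T u)) = 1"
  using arg_cong[OF tangent_proj_T, of u fst]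
  by (simp add: partial_phi fst_sum mult_ac)

lemma energy_T_XY:
  assumes u: "u \<in> U"
  shows "(\<Sum>i\<in>UNIV. \<Sum>j\<in>UNIV. g_inv i j u *\<^sub>R (partial i T u *\<^sub>R partial j X u)) = 0"
    "(\<Sum>i\<in>UNIV. \<Sum>j\<in>UNIV. g_inv i j u *\<^sub>R (partial i T u *\<^sub>R partial j Y u)) = 0"
proof -
  have "(\<Sum>j\<in>UNIV. \<Sum>i\<in>UNIV. (g_inv i j u * partial i T u) *\<^sub>R rescale l1 l2 (partial j \<phi> u)) = (1, 0, 0)"
    using tangent_proj_T[OF u] by (simp only: g_inv_sym[OF u])
  then have *: "(\<Sum>i\<in>UNIV. \<Sum>j\<in>UNIV. (g_inv i j u * partial i T u) *\<^sub>R rescale l1 l2 (partial j \<phi> u)) = (1, 0, 0)"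
    by (subst sum.swap)
  have "l1 *\<^sub>R (\<Sum>i\<in>UNIV. \<Sum>j\<in>UNIV. g_inv i j u *\<^sub>R (partial i T u *\<^sub>R partial j X u)) = 0"
    using arg_cong[OF *, of "fst \<circ> snd"]
    by (simp add: partial_phi[OF u] case_prod_beta fst_sum snd_sum scaleR_sum_right mult_ac)
  then show "(\<Sum>i\<in>UNIV. \<Sum>j\<in>UNIV. g_inv i j u *\<^sub>R (partial i T u *\<^sub>R partial j X u)) = 0"
    using l by simp
  have "l2 *\<^sub>R (\<Sum>i\<in>UNIV. \<Sum>j\<in>UNIV. g_inv i j u *\<^sub>R (partial i T u *\<^sub>R partial j Y u)) = 0"
    using arg_cong[OF *, of "snd \<circ> snd"]
    by (simp add: partial_phi[OF u] case_prod_beta fst_sum snd_sum scaleR_sum_right mult_ac)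
  then show "(\<Sum>i\<in>UNIV. \<Sum>j\<in>UNIV. g_inv i j u *\<^sub>R (partial i T u *\<^sub>R partial j Y u)) = 0"
    using l by simp
qed

text \<open>\<open>e\<close> embeds the space of \<open>F\<close> as one block of the ambient space
  and \<open>c\<close> is the radius of that sphere. Summing
  \<open>e b \<bullet> tangent_proj u (e b)\<close> over an orthonormal basis gives the trace of the
  projection on the block, where only the normal direction \<open>F u\<close> is lost; expanding the
  projection gives \<open>c\<^sup>2\<close> times the energy.\<close>

lemma energy_trace:
  fixes F :: "real^(1 + 'p + 'q) \<Rightarrow> real^'m" and e :: "real^'m \<Rightarrow> ('p, 'q) ambient"
  assumes u: "u \<in> U" and "c \<noteq> 0" "norm (F u) = 1"
    and e: "\<And>j b. rescale l1 l2 (partial j \<phi> u) \<bullet> e b = c * (partial j F u \<bullet> b)"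
    and proj: "\<And>b. e b \<bullet> tangent_proj u (e b) = b \<bullet> b - (F u \<bullet> b)\<^sup>2"
  shows "coord_energy (coord_metric l1 l2 \<phi>) F u = (real CARD('m) - 1) / c\<^sup>2"
proof -
  have "(\<Sum>i\<in>UNIV. \<Sum>j\<in>UNIV. c\<^sup>2 * (g_inv i j u * ((partial i F u \<bullet> b) * (partial j F u \<bullet> b)))) = b \<bullet> b - (F u \<bullet> b)\<^sup>2" for b
    unfolding proj[symmetric] tangent_proj_def
    by (simp add: inner_sum_right partial_rescale_phi[OF u] e inner_commute[of "e b"] power2_eq_square mult_ac)
  then have "(\<Sum>b\<in>Basis. \<Sum>i\<in>UNIV. \<Sum>j\<in>UNIV. c\<^sup>2 * (g_inv i j u * ((partial i F u \<bullet> b) * (partial j F u \<bullet> b)))) =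
      (\<Sum>b\<in>Basis. b \<bullet> b - (F u \<bullet> b)\<^sup>2)"
    by simp
  also have "\<dots> = real CARD('m) - F u \<bullet> F u"
    by (simp add: sum_subtractf power2_eq_square euclidean_inner[of "F u" "F u"] inner_Basis)
  also have "(\<Sum>b\<in>Basis. \<Sum>i\<in>UNIV. \<Sum>j\<in>UNIV. c\<^sup>2 * (g_inv i j u * ((partial i F u \<bullet> b) * (partial j F u \<bullet> b)))) =
      (\<Sum>i\<in>UNIV. \<Sum>j\<in>UNIV. \<Sum>b\<in>Basis. c\<^sup>2 * (g_inv i j u * ((partial i F u \<bullet> b) * (partial j F u \<bullet> b))))"
    by (subst sum.swap, rule sum.cong[OF refl], rule sum.swap)
  also have "\<dots> = c\<^sup>2 * coord_energy (coord_metric l1 l2 \<phi>) F u"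
    by (simp add: coord_energy_def g_inv_def euclidean_inner[of "partial _ F u" "partial _ F u"] sum_distrib_left)
  finally show ?thesis
    using \<open>c \<noteq> 0\<close> by (simp add: field_simps dot_square_norm assms(3))
qed

lemma energy_XY:
  assumes u: "u \<in> U"
  shows "coord_energy (coord_metric l1 l2 \<phi>) X u = real CARD('p) / l1\<^sup>2"
    "coord_energy (coord_metric l1 l2 \<phi>) Y u = real CARD('q) / l2\<^sup>2"
proof -
  have "coord_energy (coord_metric l1 l2 \<phi>) X u = (real CARD(1 + 'p) - 1) / l1\<^sup>2"
    by (rule energy_trace[OF u, where e = "\<lambda>b. (0, b, 0)"])
      (use l in \<open>auto simp: norm_XY[OF u] partial_phi[OF u] tangent_proj_eq[OF u]
        inner_diff_right power2_eq_square inner_commute\<close>)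
  then show "coord_energy (coord_metric l1 l2 \<phi>) X u = real CARD('p) / l1\<^sup>2" by simp
  have "coord_energy (coord_metric l1 l2 \<phi>) Y u = (real CARD(1 + 'q) - 1) / l2\<^sup>2"
    by (rule energy_trace[OF u, where e = "\<lambda>b. (0, 0, b)"])
      (use l in \<open>auto simp: norm_XY[OF u] partial_phi[OF u] tangent_proj_eq[OF u]
        inner_diff_right power2_eq_square inner_commute\<close>)
  then show "coord_energy (coord_metric l1 l2 \<phi>) Y u = real CARD('q) / l2\<^sup>2" by simp
qed

lemma laplacian_TXY:
  assumes u: "u \<in> U"
  shows "coord_laplacian (coord_metric l1 l2 \<phi>) T u = 0"
    "coord_laplacian (coord_metric l1 l2 \<phi>) X u = - (real CARD('p) / l1\<^sup>2) *\<^sub>R X u"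
    "coord_laplacian (coord_metric l1 l2 \<phi>) Y u = - (real CARD('q) / l2\<^sup>2) *\<^sub>R Y u"
proof -
  let ?L = "coord_laplacian (coord_metric l1 l2 \<phi>) \<phi> u"
  note lap = laplacian_bounded_linear[OF _ smooth_phi u]
  have L: "?L = (coord_laplacian (coord_metric l1 l2 \<phi>) T u, coord_laplacian (coord_metric l1 l2 \<phi>) X u,
      coord_laplacian (coord_metric l1 l2 \<phi>) Y u)"
    using lap[OF bounded_linear_fst] lap[OF bounded_linear_compose[OF bounded_linear_fst bounded_linear_snd]]
      lap[OF bounded_linear_compose[OF bounded_linear_snd bounded_linear_snd]]
    by (simp add: T_def[abs_def] X_def[abs_def] Y_def[abs_def] prod_eq_iff)
  have "tangent_proj u (rescale l1 l2 ?L) = 0"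
    using laplacian_immersion_tangent_proj[OF u] lap[OF bounded_linear_rescale] by simp
  \<comment> \<open>A vanishing projection leaves only the normal part: nothing along the circle,
    and multiples of \<open>X u\<close> and \<open>Y u\<close> in the two blocks once the radii are
    cancelled.\<close>
  then have *: "coord_laplacian (coord_metric l1 l2 \<phi>) T u = 0"
    "coord_laplacian (coord_metric l1 l2 \<phi>) X u = (X u \<bullet> coord_laplacian (coord_metric l1 l2 \<phi>) X u) *\<^sub>R X u"
    "coord_laplacian (coord_metric l1 l2 \<phi>) Y u = (Y u \<bullet> coord_laplacian (coord_metric l1 l2 \<phi>) Y u) *\<^sub>R Y u"
    using l by (auto simp: L tangent_proj_eq[OF u] zero_prod_def scaleR_scaleR[symmetric]
        scaleR_diff_right[symmetric] simp del: scaleR_scaleR)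
  show "coord_laplacian (coord_metric l1 l2 \<phi>) T u = 0" by (rule *)
  show "coord_laplacian (coord_metric l1 l2 \<phi>) X u = - (real CARD('p) / l1\<^sup>2) *\<^sub>R X u"
    using *(2) laplacian_norm_one[OF smooth_TXY(2) _ u] energy_XY(1)[OF u]
    by (simp add: dot_square_norm norm_XY)
  show "coord_laplacian (coord_metric l1 l2 \<phi>) Y u = - (real CARD('q) / l2\<^sup>2) *\<^sub>R Y u"
    using *(3) laplacian_norm_one[OF smooth_TXY(3) _ u] energy_XY(2)[OF u]
    by (simp add: dot_square_norm norm_XY)
qed

text \<open>Treats the cosine and the sine block alike: since \<open>T\<close> is harmonic with unit
  gradient, \<open>\<psi> (T u)\<close> is an eigenfunction, and the cross term of the product rule
  vanishes by \<open>orth\<close>.\<close>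

lemma laplacian_trig_scaleR:
  assumes \<psi>: "\<And>x. (\<psi> has_real_derivative \<psi>' x) (at x)"
    and \<psi>': "\<And>x. (\<psi>' has_real_derivative - (a\<^sup>2) * \<psi> x) (at x)"
    and smooth_\<psi>: "smooth_on U (\<lambda>u. \<psi> (T u))" and F: "smooth_on U F" and u: "u \<in> U"
    and lapF: "coord_laplacian (coord_metric l1 l2 \<phi>) F u = - lam *\<^sub>R F u"
    and orth: "(\<Sum>i\<in>UNIV. \<Sum>j\<in>UNIV. g_inv i j u *\<^sub>R (partial i T u *\<^sub>R partial j F u)) = 0"
  shows "coord_laplacian (coord_metric l1 l2 \<phi>) (\<lambda>u. \<psi> (T u) *\<^sub>R F u) u = - (lam + a\<^sup>2) *\<^sub>R (\<psi> (T u) *\<^sub>R F u)"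
proof -
  have "partial i (\<lambda>u. \<psi> (T u)) u = \<psi>' (T u) * partial i T u" for i
    using partial_has_derivative[OF has_derivative_compose[OF smooth_on_has_derivative[OF smooth_TXY(1) U u]
          \<psi>[of "T u", unfolded has_field_derivative_def]], of i]
    by (simp add: partial_def)
  then have "(\<Sum>i\<in>UNIV. \<Sum>j\<in>UNIV. g_inv i j u *\<^sub>R (partial i (\<lambda>u. \<psi> (T u)) u *\<^sub>R partial j F u)) =
      \<psi>' (T u) *\<^sub>R (\<Sum>i\<in>UNIV. \<Sum>j\<in>UNIV. g_inv i j u *\<^sub>R (partial i T u *\<^sub>R partial j F u))"
    by (simp add: scaleR_sum_right mult_ac)
  then have cross: "(\<Sum>i\<in>UNIV. \<Sum>j\<in>UNIV. g_inv i j u *\<^sub>R (partial i (\<lambda>u. \<psi> (T u)) u *\<^sub>R partial j F u)) = 0"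
    unfolding orth by simp
  have lap\<psi>: "coord_laplacian (coord_metric l1 l2 \<phi>) (\<lambda>u. \<psi> (T u)) u = - (a\<^sup>2) * \<psi> (T u)"
    using laplacian_compose[OF \<psi> \<psi>' smooth_TXY(1) u] by (simp add: laplacian_TXY[OF u] energy_T[OF u])
  show ?thesis
    unfolding laplacian_bilinear[OF bounded_bilinear_scaleR smooth_\<psi> F u] cross lapF lap\<psi>
    by (simp add: algebra_simps)
qed

lemma smooth_trig: "smooth_on U (\<lambda>u. cos (a * T u))" "smooth_on U (\<lambda>u. sin (a * T u))"
  by (intro smooth_on_cos smooth_on_sin U smooth_on_bounded_linear[OF U bounded_linear_mult_right] smooth_TXY)+

lemma smooth_G: "smooth_on U (\<lambda>u. (cos (a * T u) *\<^sub>R X u, sin (a * T u) *\<^sub>R Y u))"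
  by (intro smooth_on_Pair U smooth_on_bilinear[OF U bounded_bilinear_scaleR] smooth_trig smooth_TXY)

lemma laplacian_G:
  assumes u: "u \<in> U" and lam: "real CARD('p) / l1\<^sup>2 = lam" "real CARD('q) / l2\<^sup>2 = lam"
  shows "coord_laplacian (coord_metric l1 l2 \<phi>) (\<lambda>u. (cos (a * T u) *\<^sub>R X u, sin (a * T u) *\<^sub>R Y u)) u =
    - (lam + a\<^sup>2) *\<^sub>R (cos (a * T u) *\<^sub>R X u, sin (a * T u) *\<^sub>R Y u)"
proof -
  let ?G = "\<lambda>u. (cos (a * T u) *\<^sub>R X u, sin (a * T u) *\<^sub>R Y u)"
  have "coord_laplacian (coord_metric l1 l2 \<phi>) (\<lambda>u. cos (a * T u) *\<^sub>R X u) u = - (lam + a\<^sup>2) *\<^sub>R (cos (a * T u) *\<^sub>R X u)"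
  proof (rule laplacian_trig_scaleR[where \<psi> = "\<lambda>x. cos (a * x)" and \<psi>' = "\<lambda>x. - a * sin (a * x)"])
    show "((\<lambda>x. cos (a * x)) has_real_derivative - a * sin (a * x)) (at x)" for x
      by (auto intro!: derivative_eq_intros)
    show "((\<lambda>x. - a * sin (a * x)) has_real_derivative - a\<^sup>2 * cos (a * x)) (at x)" for x
      by (auto intro!: derivative_eq_intros simp: power2_eq_square)
  qed (use u laplacian_TXY(2)[OF u] energy_T_XY(1)[OF u] lam in \<open>simp_all add: smooth_trig smooth_TXY\<close>)
  moreover have "coord_laplacian (coord_metric l1 l2 \<phi>) (\<lambda>u. sin (a * T u) *\<^sub>R Y u) u = - (lam + a\<^sup>2) *\<^sub>R (sin (a * T u) *\<^sub>R Y u)"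
  proof (rule laplacian_trig_scaleR[where \<psi> = "\<lambda>x. sin (a * x)" and \<psi>' = "\<lambda>x. a * cos (a * x)"])
    show "((\<lambda>x. sin (a * x)) has_real_derivative a * cos (a * x)) (at x)" for x
      by (auto intro!: derivative_eq_intros)
    show "((\<lambda>x. a * cos (a * x)) has_real_derivative - a\<^sup>2 * sin (a * x)) (at x)" for x
      by (auto intro!: derivative_eq_intros simp: power2_eq_square)
  qed (use u laplacian_TXY(3)[OF u] energy_T_XY(2)[OF u] lam in \<open>simp_all add: smooth_trig smooth_TXY\<close>)
  moreover have "fst (coord_laplacian (coord_metric l1 l2 \<phi>) ?G u) =
      coord_laplacian (coord_metric l1 l2 \<phi>) (\<lambda>u. cos (a * T u) *\<^sub>R X u) u"
    using laplacian_bounded_linear[OF bounded_linear_fst smooth_G u] by simp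
  moreover have "snd (coord_laplacian (coord_metric l1 l2 \<phi>) ?G u) =
      coord_laplacian (coord_metric l1 l2 \<phi>) (\<lambda>u. sin (a * T u) *\<^sub>R Y u) u"
    using laplacian_bounded_linear[OF bounded_linear_snd smooth_G u] by simp
  ultimately show ?thesis
    by (simp add: prod_eq_iff)
qed

lemma energy_G:
  assumes u: "u \<in> U" and lam: "real CARD('p) / l1\<^sup>2 = lam" "real CARD('q) / l2\<^sup>2 = lam"
  shows "coord_energy (coord_metric l1 l2 \<phi>) (\<lambda>u. (cos (a * T u) *\<^sub>R X u, sin (a * T u) *\<^sub>R Y u)) u = lam + a\<^sup>2"
proof -
  let ?G = "\<lambda>u. (cos (a * T u) *\<^sub>R X u, sin (a * T u) *\<^sub>R Y u)"
  have *: "?G w \<bullet> ?G w = 1" if "w \<in> U" for w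
    using norm_XY[OF that] by (simp add: norm_eq_1 power2_eq_square[symmetric])
  have "?G u \<bullet> coord_laplacian (coord_metric l1 l2 \<phi>) ?G u = - coord_energy (coord_metric l1 l2 \<phi>) ?G u"
    by (rule laplacian_norm_one[OF smooth_G _ u]) (rule *)
  then show ?thesis
    unfolding laplacian_G[OF assms] inner_scaleR_right *[OF u] by simp
qed

end

section \<open>Stereographic charts\<close>

text \<open>Subspaces of equal dimension are isometric; polarization turns preserved norms into
  preserved inner products.\<close>

lemma isometry_onto_hyperplane:
  fixes x :: "real^(1 + 'p::finite)"
  assumes "norm x = 1"
  obtains L :: "real^'p \<Rightarrow> real^(1 + 'p)" where "linear L" "\<And>v. x \<bullet> L v = 0" "\<And>v w. L v \<bullet> L w = v \<bullet> w"
proof -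
  have "x \<noteq> 0" using assms by auto
  have "dim (UNIV :: (real^'p) set) = dim {v. x \<bullet> v = 0}"
    using dim_hyperplane[OF \<open>x \<noteq> 0\<close>] by simp
  then obtain L :: "real^'p \<Rightarrow> real^(1 + 'p)" where L: "linear L" "range L = {v. x \<bullet> v = 0}"
    "\<And>v. norm (L v) = norm v"
    using isometry_subspaces[OF subspace_UNIV subspace_hyperplane] by (metis UNIV_I)
  have "L v \<bullet> L w = v \<bullet> w" for v w
    by (simp add: dot_norm L(3) linear_add[OF L(1), symmetric])
  then show ?thesis
    using that[of L] L by blast
qed

text \<open>
  For an isometry \<open>L\<close> onto the orthogonal complement of \<open>x\<close>, \<open>stereo x L\<close> is the inverse of the
  stereographic projection from \<open>- x\<close>. The function \<open>stereo_inv\<close> recovers only \<open>L v\<close> from it, which is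
  enough for injectivity.
\<close>

definition stereo :: "'b::real_inner \<Rightarrow> ('a::real_inner \<Rightarrow> 'b) \<Rightarrow> 'a \<Rightarrow> 'b" where
  "stereo x L v = inverse (1 + v \<bullet> v) *\<^sub>R (2 *\<^sub>R L v + (1 - v \<bullet> v) *\<^sub>R x)"

definition stereo_inv :: "'b::real_inner \<Rightarrow> 'b \<Rightarrow> 'b" where
  "stereo_inv x s = inverse (1 + x \<bullet> s) *\<^sub>R (s - (x \<bullet> s) *\<^sub>R x)"

context
  fixes x :: "'b::euclidean_space" and L :: "'a::euclidean_space \<Rightarrow> 'b"
  assumes x: "norm x = 1" and L: "linear L" "\<And>v. x \<bullet> L v = 0" "\<And>v w. L v \<bullet> L w = v \<bullet> w"
begin

lemma one_plus_inner_pos: "1 + v \<bullet> v > (0::real)" for v :: 'a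
  by (simp add: add_pos_nonneg)

text \<open>With r = \<open>v \<bullet> v\<close>, this is 4 r + (1 - r)^2 = (1 + r)^2.\<close>

lemma norm_stereo: "norm (stereo x L v) = 1"
proof -
  have "(2 *\<^sub>R L v + (1 - v \<bullet> v) *\<^sub>R x) \<bullet> (2 *\<^sub>R L v + (1 - v \<bullet> v) *\<^sub>R x) = (1 + v \<bullet> v)\<^sup>2"
    using x by (simp add: inner_add_left inner_add_right L inner_commute[of "L v" x] norm_eq_1
        power2_eq_square algebra_simps)
  then have "(norm (2 *\<^sub>R L v + (1 - v \<bullet> v) *\<^sub>R x))\<^sup>2 = (1 + v \<bullet> v)\<^sup>2"
    by (simp add: power2_norm_eq_inner)
  then have "norm (2 *\<^sub>R L v + (1 - v \<bullet> v) *\<^sub>R x) = 1 + v \<bullet> v"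
    using one_plus_inner_pos[of v] by (simp add: power2_eq_iff_nonneg)
  then show ?thesis
    using one_plus_inner_pos[of v] by (simp add: stereo_def)
qed

lemma stereo_0: "stereo x L 0 = x"
  by (simp add: stereo_def linear_0[OF L(1)])

lemma inner_stereo: "x \<bullet> stereo x L v = inverse (1 + v \<bullet> v) * (1 - v \<bullet> v)"
  using x by (simp add: stereo_def inner_add_right L norm_eq_1)

lemma one_plus_inner_stereo: "1 + x \<bullet> stereo x L v = 2 * inverse (1 + v \<bullet> v)"
  unfolding inner_stereo using one_plus_inner_pos[of v] by (simp add: field_simps)

lemma stereo_inv_stereo: "stereo_inv x (stereo x L v) = L v"
proof -
  let ?r = "inverse (1 + v \<bullet> v)"
  have "?r \<noteq> 0" using one_plus_inner_pos[of v] by simp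
  have "stereo x L v - (x \<bullet> stereo x L v) *\<^sub>R x = (2 * ?r) *\<^sub>R L v"
    unfolding inner_stereo unfolding stereo_def by (simp add: scaleR_add_right)
  then show ?thesis
    using \<open>?r \<noteq> 0\<close> by (simp add: stereo_inv_def one_plus_inner_stereo)
qed

lemma smooth_stereo:
  assumes "open U" "smooth_on U h"
  shows "smooth_on U (\<lambda>u. stereo x L (h u))"
proof -
  have r: "smooth_on U (\<lambda>u. h u \<bullet> h u)"
    by (intro smooth_on_bilinear[OF assms(1) bounded_bilinear_inner] assms)
  have "smooth_on U (\<lambda>u. 1 + (- 1) * (h u \<bullet> h u))"
    by (intro smooth_on_add smooth_on_const smooth_on_bounded_linear[OF assms(1) bounded_linear_mult_right] r assms)
  then have "smooth_on U (\<lambda>u. 1 - h u \<bullet> h u)"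
    by simp
  then show ?thesis
    unfolding stereo_def
    by (intro smooth_on_bilinear[OF assms(1) bounded_bilinear_scaleR] smooth_on_inverse smooth_on_add
        smooth_on_const r assms smooth_on_bounded_linear[OF assms(1) bounded_linear_scaleR_right]
        smooth_on_bounded_linear[OF assms(1) linear_conv_bounded_linear[THEN iffD1, OF L(1)]])
      (use one_plus_inner_pos less_irrefl in metis)
qed

text \<open>The denominator \<open>1 + x \<bullet> s\<close> vanishes on the sphere only at
  \<open>- x\<close>, which \<open>stereo\<close> never reaches.\<close>

lemma differentiable_stereo_inv: "stereo_inv x differentiable at (stereo x L v)"
  unfolding stereo_inv_def[abs_def]
  using one_plus_inner_pos[of v]
  by (intro differentiable_bilinear[OF bounded_bilinear_scaleR] differentiable_inverse differentiable_diff
      differentiable_add differentiable_const differentiable_ident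
      differentiable_bilinear[OF bounded_bilinear_inner]) (simp add: one_plus_inner_stereo)

end

text \<open>By the chain rule the derivative of \<open>f\<close> has the injective linear map
  \<open>g\<close> as a composite with that of \<open>K\<close>. This shows that the stereographic
  chart is an immersion without computing its derivative.\<close>

lemma inj_derivative_left_inverse:
  assumes f: "f differentiable at u" and K: "K differentiable at (f u)"
    and "\<And>w. K (f w) = g w" and g: "bounded_linear g" "inj g"
  shows "inj (frechet_derivative f (at u))"
proof -
  let ?f = "frechet_derivative f (at u)" and ?K = "frechet_derivative K (at (f u))"
  have "((\<lambda>w. K (f w)) has_derivative (\<lambda>v. ?K (?f v))) (at u)"
    by (rule has_derivative_compose[OF f[unfolded frechet_derivative_works] K[unfolded frechet_derivative_works]])
  then have "(g has_derivative (\<lambda>v. ?K (?f v))) (at u)"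
    by (simp only: assms(3) eta_contract_eq)
  then have "(\<lambda>v. ?K (?f v)) = g"
    by (rule has_derivative_unique[OF _ bounded_linear_imp_has_derivative[OF g(1)]])
  then show ?thesis
    using g(2) unfolding inj_def by metis
qed

section \<open>Points of the circle and existence of charts\<close>

lemma circle_point_eq_iff: "circle_point P s = circle_point P t \<longleftrightarrow> (\<exists>k::int. s = t + of_int k * P)"
proof
  assume "circle_point P s = circle_point P t"
  moreover have "s \<in> circle_point P s"
    unfolding circle_point_def by (auto intro: exI[of _ 0])
  ultimately show "\<exists>k::int. s = t + of_int k * P"
    unfolding circle_point_def by auto
next
  assume "\<exists>k::int. s = t + of_int k * P"
  then obtain k :: int where k: "s = t + of_int k * P" by blast
  have "\<exists>l. s + of_int i * P = t + of_int l * P" for i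
    using k by (intro exI[of _ "k + i"]) (simp add: algebra_simps)
  moreover have "\<exists>l. t + of_int i * P = s + of_int l * P" for i
    using k by (intro exI[of _ "i - k"]) (simp add: algebra_simps)
  ultimately show "circle_point P s = circle_point P t"
    unfolding circle_point_def by blast
qed

lemma manifold_eq_proj: "manifold P = proj P ` cover"
  by (force simp: manifold_def cover_def proj_def)

text \<open>An interval times two stereographic parametrizations, centred so that the origin maps to
  \<open>z\<close>. Such charts are what keeps the descriptions in \<open>laplacian\<close> and
  \<open>energy_density\<close> from being vacuous.\<close>

lemma local_param_exists:
  fixes z :: "('p::finite, 'q::finite) ambient"
  assumes "P > 0" "z \<in> cover"
  shows "\<exists>U \<phi>. local_param P U \<phi> \<and> 0 \<in> U \<and> \<phi> 0 = z"
proof -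
  obtain t x y where z: "z = (t, x, y)" by (cases z)
  have xy: "norm x = 1" "norm y = 1"
    using assms(2) by (auto simp: z cover_def)
  obtain L :: "real^'p \<Rightarrow> real^(1 + 'p)" where
    L: "linear L" "\<And>v. x \<bullet> L v = 0" "\<And>v w. L v \<bullet> L w = v \<bullet> w"
    using isometry_onto_hyperplane[OF xy(1)] by blast
  obtain M :: "real^'q \<Rightarrow> real^(1 + 'q)" where
    M: "linear M" "\<And>v. y \<bullet> M v = 0" "\<And>v w. M v \<bullet> M w = v \<bullet> w"
    using isometry_onto_hyperplane[OF xy(2)] by blast
  have injL: "v = w" if "L v = L w" for v w
  proof -
    have "(v - w) \<bullet> (v - w) = L (v - w) \<bullet> L (v - w)" by (simp add: L(3))
    then show ?thesis using that by (simp add: linear_diff[OF L(1)])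
  qed
  have injM: "v = w" if "M v = M w" for v w
  proof -
    have "(v - w) \<bullet> (v - w) = M (v - w) \<bullet> M (v - w)" by (simp add: M(3))
    then show ?thesis using that by (simp add: linear_diff[OF M(1)])
  qed
  define a :: "real^(1 + 'p + 'q) \<Rightarrow> real" where "a u = u $ Inl 1" for u
  define b :: "real^(1 + 'p + 'q) \<Rightarrow> real^'p" where "b u = (\<chi> i. u $ Inr (Inl i))" for u
  define c :: "real^(1 + 'p + 'q) \<Rightarrow> real^'q" where "c u = (\<chi> i. u $ Inr (Inr i))" for u
  have lin: "linear a" "linear b" "linear c"
    by (auto intro!: linearI simp: a_def b_def c_def Finite_Cartesian_Product.vec_eq_iff)
  then have blin: "bounded_linear a" "bounded_linear b" "bounded_linear c"
    by (simp_all add: linear_conv_bounded_linear)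
  have abc: "u = w" if "a u = a w" "b u = b w" "c u = c w" for u w
  proof -
    have "u $ i = w $ i" for i
    proof (cases i)
      case (Inl j)
      then show ?thesis using that(1) num1_eq1[of j] by (simp add: a_def)
    next
      case (Inr k)
      then show ?thesis
        using that(2,3) by (cases k) (auto simp: b_def c_def Finite_Cartesian_Product.vec_eq_iff)
    qed
    then show ?thesis by (simp add: Finite_Cartesian_Product.vec_eq_iff)
  qed
  \<comment> \<open>Parameters in \<open>U\<close> have \<open>a\<close>-values less than
    \<open>P\<close> apart, so \<open>proj P\<close> glues none of them. The map
    \<open>\<phi>\<close> itself is smooth on the whole parameter space.\<close>
  define U where "U = {u. \<bar>a u\<bar> < P / 2}"
  define \<phi> where "\<phi> u = (t + a u, stereo x L (b u), stereo y M (c u))" for u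
  \<comment> \<open>A left inverse up to the linear injections \<open>L\<close> and
    \<open>M\<close>: it yields both injectivity of \<open>\<phi>\<close> and injectivity of its
    derivative.\<close>
  define K where "K = (\<lambda>(s, v, w). (s - t, stereo_inv x v, stereo_inv y w))"
  have K\<phi>: "K (\<phi> u) = (a u, L (b u), M (c u))" for u
    by (simp add: K_def \<phi>_def stereo_inv_stereo[OF xy(1) L] stereo_inv_stereo[OF xy(2) M])
  have inj: "u = w" if "K (\<phi> u) = K (\<phi> w)" for u w
    using that injL injM by (auto simp: K\<phi> intro: abc)
  have "open U"
    unfolding U_def using linear_continuous_on[OF blin(1)]
    by (intro open_Collect_less continuous_on_rabs continuous_on_const) (auto intro: continuous_on_subset)
  have smooth: "smooth_on V \<phi>" if "open V" for V
    unfolding \<phi>_def[abs_def]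
    by (intro smooth_on_Pair smooth_on_add smooth_on_const smooth_on_linear blin that
        smooth_stereo[OF xy(1) L] smooth_stereo[OF xy(2) M])
  have "local_param P U \<phi>"
    unfolding local_param_def
  proof (intro conjI ballI)
    show "open U" by fact
    show "smooth_on U \<phi>" by (rule smooth) fact
    show "\<phi> ` U \<subseteq> cover"
      by (auto simp: \<phi>_def cover_def norm_stereo[OF xy(1) L] norm_stereo[OF xy(2) M])
    show "inj_on (proj P \<circ> \<phi>) U"
    proof (rule inj_onI)
      fix u w assume uw: "u \<in> U" "w \<in> U" "(proj P \<circ> \<phi>) u = (proj P \<circ> \<phi>) w"
      then have "circle_point P (t + a u) = circle_point P (t + a w)"
        and eq: "stereo x L (b u) = stereo x L (b w)" "stereo y M (c u) = stereo y M (c w)"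
        by (auto simp: proj_def \<phi>_def)
      then obtain k :: int where k: "t + a u = t + a w + of_int k * P"
        using circle_point_eq_iff by blast
      have "of_int k * P = a u - a w"
        using k by simp
      then have "\<bar>of_int k * P\<bar> < 1 * P"
        using uw(1,2) unfolding U_def mem_Collect_eq abs_less_iff by linarith
      then have "\<bar>of_int k :: real\<bar> < 1"
        using \<open>P > 0\<close> by (simp add: abs_mult)
      then have "k = 0" by linarith
      then show "u = w"
        using k eq by (intro inj) (simp add: \<phi>_def)
    qed
    fix u
    show "inj (frechet_derivative \<phi> (at u))"
    proof (rule inj_derivative_left_inverse[where K = K])
      show "\<phi> differentiable at u"
        by (rule smooth_on_differentiable[OF smooth[OF open_UNIV] open_UNIV UNIV_I])
      have "((\<lambda>z. (fst z - t, stereo_inv x (fst (snd z)), stereo_inv y (snd (snd z)))) has_derivative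
          (\<lambda>z. (fst z, frechet_derivative (stereo_inv x) (at (fst (snd (\<phi> u)))) (fst (snd z)),
            frechet_derivative (stereo_inv y) (at (snd (snd (\<phi> u)))) (snd (snd z))))) (at (\<phi> u))"
      proof (intro has_derivative_Pair)
        show "((\<lambda>z. fst z - t) has_derivative fst) (at (\<phi> u))"
          by (auto intro!: derivative_eq_intros)
        show "((\<lambda>z. stereo_inv x (fst (snd z))) has_derivative
            (\<lambda>z. frechet_derivative (stereo_inv x) (at (fst (snd (\<phi> u)))) (fst (snd z)))) (at (\<phi> u))"
          by (rule has_derivative_compose[of "\<lambda>z. fst (snd z)" "\<lambda>z. fst (snd z)"])
            (use differentiable_stereo_inv[OF xy(1) L, of "b u"] in \<open>auto simp: \<phi>_def frechet_derivative_works
              intro!: derivative_eq_intros\<close>)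
        show "((\<lambda>z. stereo_inv y (snd (snd z))) has_derivative
            (\<lambda>z. frechet_derivative (stereo_inv y) (at (snd (snd (\<phi> u)))) (snd (snd z)))) (at (\<phi> u))"
          by (rule has_derivative_compose[of "\<lambda>z. snd (snd z)" "\<lambda>z. snd (snd z)"])
            (use differentiable_stereo_inv[OF xy(2) M, of "c u"] in \<open>auto simp: \<phi>_def frechet_derivative_works
              intro!: derivative_eq_intros\<close>)
      qed
      then show "K differentiable at (\<phi> u)"
        unfolding differentiable_def K_def case_prod_unfold by blast
      show "K (\<phi> w) = (a w, L (b w), M (c w))" for w by (rule K\<phi>)
      show "bounded_linear (\<lambda>w. (a w, L (b w), M (c w)))"
        using L(1) M(1) by (intro bounded_linear_Pair blin bounded_linear_compose[OF _ blin(2)]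
            bounded_linear_compose[OF _ blin(3)]) (simp_all add: linear_conv_bounded_linear)
      show "inj (\<lambda>w. (a w, L (b w), M (c w)))"
        using inj by (simp add: inj_def K\<phi>)
    qed
  qed
  moreover have "0 \<in> U"
    using \<open>P > 0\<close> by (simp add: U_def a_def)
  moreover have "\<phi> 0 = z"
  proof -
    have "a 0 = 0" "b 0 = 0" "c 0 = 0"
      by (simp_all add: a_def b_def c_def Finite_Cartesian_Product.vec_eq_iff)
    then show ?thesis
      by (simp add: \<phi>_def z stereo_0[OF xy(1) L] stereo_0[OF xy(2) M])
  qed
  ultimately show ?thesis by blast
qed

section \<open>The maps as eigenmaps\<close>

text \<open>Moving by \<open>k\<close> periods changes the angle by 2 pi m k; integrality of
  \<open>m\<close> is what lets the formula descend to the circle.\<close>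

lemma trig_circle_point:
  assumes "P > 0" "circle_point P s = circle_point P t"
  shows "cos (2 * pi * real m * s / P) = cos (2 * pi * real m * t / P)"
    "sin (2 * pi * real m * s / P) = sin (2 * pi * real m * t / P)"
proof -
  obtain k :: int where k: "s = t + of_int k * P"
    using assms(2) circle_point_eq_iff by blast
  have "2 * pi * real m * s / P = 2 * pi * real m * t / P + 2 * pi * of_int (int m * k)"
    using assms(1) by (simp add: k field_simps)
  then show "cos (2 * pi * real m * s / P) = cos (2 * pi * real m * t / P)"
    "sin (2 * pi * real m * s / P) = sin (2 * pi * real m * t / P)"
    by (simp_all only: cos_add sin_add cos_int_2pin sin_int_2pin mult_1_right mult_zero_right diff_zero add_0_right)
qed

lemma G_hat_proj:
  assumes "P > 0"
  shows "G_hat P m (proj P (t, x, y)) =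
    (cos (2 * pi * real m * t / P) *\<^sub>R x, sin (2 * pi * real m * t / P) *\<^sub>R y)"
proof -
  have "t \<in> circle_point P t"
    unfolding circle_point_def by (auto intro: exI[of _ 0])
  then have "(SOME s. s \<in> circle_point P t) \<in> circle_point P t" by (rule someI)
  then have "circle_point P (SOME s. s \<in> circle_point P t) = circle_point P t"
    unfolding circle_point_eq_iff by (auto simp: circle_point_def)
  from trig_circle_point[OF assms this, of m] show ?thesis
    by (simp add: G_hat_def proj_def)
qed

lemma G_hat_sphere:
  fixes z :: "('p::finite, 'q::finite) point"
  assumes "P > 0" "z \<in> manifold P"
  shows "G_hat P m z \<in> sphere 0 1"
  using assms by (auto simp: manifold_eq_proj cover_def G_hat_proj norm_Pair)

context
  fixes P l1 l2 lam :: real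
  assumes P: "P > 0" and l: "l1 > 0" "l2 > 0"
    and lam: "real CARD('p::finite) / l1\<^sup>2 = lam" "real CARD('q::finite) / l2\<^sup>2 = lam"
begin

lemma G_hat_chart:
  assumes "chart P l1 l2 U (\<phi> :: _ \<Rightarrow> ('p, 'q) ambient)"
  shows "G_hat P m \<circ> proj P \<circ> \<phi> = (\<lambda>u. (cos (2 * pi * real m / P * chart.T \<phi> u) *\<^sub>R chart.X \<phi> u,
    sin (2 * pi * real m / P * chart.T \<phi> u) *\<^sub>R chart.Y \<phi> u))"
proof
  fix u
  interpret chart P l1 l2 U \<phi> by fact
  show "(G_hat P m \<circ> proj P \<circ> \<phi>) u = (cos (2 * pi * real m / P * T u) *\<^sub>R X u,
      sin (2 * pi * real m / P * T u) *\<^sub>R Y u)"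
    by (simp add: phi_eq G_hat_proj[OF P])
qed

lemma smooth_map_G_hat: "smooth_map P (G_hat P m :: ('p, 'q) point \<Rightarrow> _)"
  unfolding smooth_map_def
proof (intro allI impI)
  fix U and \<phi> :: "_ \<Rightarrow> ('p, 'q) ambient"
  assume "local_param P U \<phi>"
  then interpret chart P l1 l2 U \<phi> by unfold_locales (use l in auto)
  show "smooth_on U (G_hat P m \<circ> proj P \<circ> \<phi>)"
    unfolding G_hat_chart[OF chart_axioms] by (rule smooth_G)
qed

text \<open>A value found in an arbitrary chart satisfies the description, and evaluating a
  competitor in one existing chart forces it to be the same.\<close>

lemma the_chart_value:
  fixes z :: "('p, 'q) point"
  assumes "z \<in> manifold P"
    and "\<And>U \<phi> u. chart P l1 l2 U \<phi> \<Longrightarrow> u \<in> U \<Longrightarrow> proj P (\<phi> u) = z \<Longrightarrow> Q \<phi> u = v"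
  shows "(THE L. \<forall>U \<phi> u. local_param P U \<phi> \<and> u \<in> U \<and> proj P (\<phi> u) = z \<longrightarrow> Q \<phi> u = L) = v"
proof (rule the_equality)
  have chart: "chart P l1 l2 U \<phi>" if "local_param P U \<phi>" for U and \<phi> :: "_ \<Rightarrow> ('p, 'q) ambient"
    using that l by (simp add: chart_def)
  then show "\<forall>U \<phi> u. local_param P U \<phi> \<and> u \<in> U \<and> proj P (\<phi> u) = z \<longrightarrow> Q \<phi> u = v"
    using assms(2) by blast
  obtain w where w: "w \<in> cover" "z = proj P w"
    using assms(1) unfolding manifold_eq_proj by blast
  obtain U \<phi> where U: "local_param P U \<phi>" "0 \<in> U" "\<phi> 0 = w"
    using local_param_exists[OF P w(1)] by blast
  show "L = v" if "\<forall>U \<phi> u. local_param P U \<phi> \<and> u \<in> U \<and> proj P (\<phi> u) = z \<longrightarrow> Q \<phi> u = L" for L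
    using that U w(2) assms(2)[OF chart[OF U(1)] U(2)] by blast
qed

lemma laplacian_G_hat:
  fixes z :: "('p, 'q) point"
  assumes "z \<in> manifold P"
  shows "laplacian P l1 l2 (G_hat P m) z = - (lam + 4 * pi\<^sup>2 * (real m)\<^sup>2 / P\<^sup>2) *\<^sub>R G_hat P m z"
  unfolding laplacian_def
proof (rule the_chart_value[OF assms])
  fix U u and \<phi> :: "_ \<Rightarrow> ('p, 'q) ambient"
  assume *: "chart P l1 l2 U \<phi>" "u \<in> U" "proj P (\<phi> u) = z"
  interpret chart P l1 l2 U \<phi> by fact
  have "G_hat P m z = (G_hat P m \<circ> proj P \<circ> \<phi>) u" using *(3) by simp
  then show "coord_laplacian (coord_metric l1 l2 \<phi>) (G_hat P m \<circ> proj P \<circ> \<phi>) u =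
      - (lam + 4 * pi\<^sup>2 * (real m)\<^sup>2 / P\<^sup>2) *\<^sub>R G_hat P m z"
    unfolding G_hat_chart[OF *(1)] laplacian_G[OF *(2) lam]
    by (simp add: power_divide power_mult_distrib)
qed

lemma energy_density_G_hat:
  fixes z :: "('p, 'q) point"
  assumes "z \<in> manifold P"
  shows "energy_density P l1 l2 (G_hat P m) z = lam + 4 * pi\<^sup>2 * (real m)\<^sup>2 / P\<^sup>2"
  unfolding energy_density_def
proof (rule the_chart_value[OF assms])
  fix U u and \<phi> :: "_ \<Rightarrow> ('p, 'q) ambient"
  assume *: "chart P l1 l2 U \<phi>" "u \<in> U" "proj P (\<phi> u) = z"
  interpret chart P l1 l2 U \<phi> by fact
  show "coord_energy (coord_metric l1 l2 \<phi>) (G_hat P m \<circ> proj P \<circ> \<phi>) u = lam + 4 * pi\<^sup>2 * (real m)\<^sup>2 / P\<^sup>2"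
    unfolding G_hat_chart[OF *(1)] energy_G[OF *(2) lam]
    by (simp add: power_divide power_mult_distrib)
qed

lemma spherical_eigenmap_G_hat: "spherical_eigenmap P l1 l2 (G_hat P m :: ('p, 'q) point \<Rightarrow> _)"
  unfolding spherical_eigenmap_def harmonic_sphere_map_def
  using smooth_map_G_hat G_hat_sphere[OF P] laplacian_G_hat energy_density_G_hat
  by (auto intro!: exI[of _ "lam + 4 * pi\<^sup>2 * (real m)\<^sup>2 / P\<^sup>2"])

end

section \<open>Determinants of frames\<close>

text \<open>Negating a column is multiplication by a diagonal matrix of determinant -1. The first
  entry \<open>x\<close> is the normal, so index 1 is the first tangent vector; flipping it reverses
  the orientation of a frame.\<close>

lemma list_det_flip:
  assumes "length es = length vs + 2"
  shows "list_det es (x # (- v) # vs) = - list_det es (x # v # vs)"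
proof -
  let ?n = "length es"
  let ?M = "\<lambda>us. Matrix.mat ?n ?n (\<lambda>(i, j). (es ! i) \<bullet> (us ! j))"
  let ?D = "multrow_mat ?n 1 (- 1) :: real mat"
  have "multcol 1 (- 1) (?M (x # v # vs)) = ?M (x # v # vs) * ?D"
    by (rule multcol_mat) auto
  moreover have "multcol 1 (- 1) (?M (x # v # vs)) = ?M (x # (- v) # vs)"
    by (rule eq_matI) (auto simp: nth_Cons split: nat.splits)
  ultimately have "?M (x # (- v) # vs) = ?M (x # v # vs) * ?D" by simp
  then have "Determinant.det (?M (x # (- v) # vs)) = Determinant.det (?M (x # v # vs)) * Determinant.det ?D"
    using det_mult[of "?M (x # v # vs)" ?n ?D] by simp
  also have "Determinant.det ?D = - 1"
    using assms by (intro det_multrow_mat) simp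
  finally show ?thesis by (simp add: list_det_def)
qed

lemma det_2x2:
  assumes "A \<in> carrier_mat 2 2"
  shows "Determinant.det A = A $$ (0, 0) * A $$ (1, 1) - A $$ (0, 1) * (A $$ (1, 0) :: real)"
proof -
  have "Determinant.det A = (\<Sum>i<2. A $$ (i, 0) * cofactor A i 0)"
    by (rule laplace_expansion_column[OF assms]) simp
  also have "\<dots> = A $$ (0, 0) * cofactor A 0 0 + A $$ (1, 0) * cofactor A 1 0"
    by (simp add: numeral_2_eq_2)
  also have "cofactor A 0 0 = A $$ (1, 1)"
    using assms by (simp add: cofactor_def det_single mat_delete_def)
  also have "cofactor A 1 0 = - A $$ (0, 1)"
    using assms by (simp add: cofactor_def det_single mat_delete_def)
  finally show ?thesis by simp
qed

lemma list_det_block: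
  fixes es vs :: "'a::real_inner list" and fs ws :: "'b::real_inner list"
  assumes "length vs = length es" "length ws = length fs"
  shows "list_det (map (\<lambda>e. (e, 0)) es @ map (\<lambda>e. (0, e)) fs) (map (\<lambda>v. (v, 0)) vs @ map (\<lambda>w. (0, w)) ws) =
    list_det es vs * list_det fs ws"
proof -
  let ?A = "Matrix.mat (length es) (length es) (\<lambda>(i, j). (es ! i) \<bullet> (vs ! j))"
  let ?C = "Matrix.mat (length fs) (length fs) (\<lambda>(i, j). (fs ! i) \<bullet> (ws ! j))"
  let ?B = "four_block_mat ?A (0\<^sub>m (length es) (length fs)) (0\<^sub>m (length fs) (length es)) ?C"
  have "Matrix.mat (length es + length fs) (length es + length fs) (\<lambda>(i, j).
      ((map (\<lambda>e. (e, 0)) es @ map (\<lambda>e. (0, e)) fs) ! i) \<bullet> ((map (\<lambda>v. (v, 0)) vs @ map (\<lambda>w. (0, w)) ws) ! j)) = ?B"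
    using assms by (intro eq_matI) (auto simp: nth_append)
  moreover have "Determinant.det ?B = Determinant.det ?A * Determinant.det ?C"
    by (rule det_four_block_mat_lower_left_zero) auto
  ultimately show ?thesis by (simp add: list_det_def)
qed

text \<open>Moving \<open>(0, y)\<close> to the front costs (-1)^(p + 1). The leading 2x2 block of
  the transition matrix has determinant - k (c^2 + s^2) = - k, and the remaining diagonal
  contributes c^p s^q; the signs combine to (-1)^p.\<close>

lemma list_det_join_frame:
  fixes es vs :: "'a::real_inner list" and fs ws :: "'b::real_inner list"
  assumes es: "length es = length vs + 1" and fs: "length fs = length ws + 1" and cs: "c\<^sup>2 + s\<^sup>2 = 1"
  shows "list_det (map (\<lambda>e. (e, 0)) es @ map (\<lambda>e. (0, e)) fs)
      ((c *\<^sub>R x, s *\<^sub>R y) # (- (k * s) *\<^sub>R x, (k * c) *\<^sub>R y) #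
       map (\<lambda>v. (c *\<^sub>R v, 0)) vs @ map (\<lambda>w. (0, s *\<^sub>R w)) ws) =
    (- 1) ^ length vs * k * c ^ length vs * s ^ length ws * list_det es (x # vs) * list_det fs (y # ws)"
proof -
  let ?p = "length vs" and ?q = "length ws"
  let ?n = "?p + ?q + 2"
  define E where "E = map (\<lambda>e. (e, 0 :: 'b)) es @ map (\<lambda>e. (0 :: 'a, e)) fs"
  define V where "V = map (\<lambda>v. (v, 0 :: 'b)) (x # vs) @ map (\<lambda>w. (0 :: 'a, w)) (y # ws)"
  \<comment> \<open>With \<open>(0, y)\<close> moved to the front, the transition matrix \<open>N\<close> is diagonal apart from its first 2x2 block.\<close>
  define V' where "V' = (0, y) # (x, 0) # map (\<lambda>v. (v, 0)) vs @ map (\<lambda>w. (0, w)) ws"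
  define W where "W = (c *\<^sub>R x, s *\<^sub>R y) # (- (k * s) *\<^sub>R x, (k * c) *\<^sub>R y) #
       map (\<lambda>v. (c *\<^sub>R v, 0)) vs @ map (\<lambda>w. (0, s *\<^sub>R w)) ws"
  define M where "M us = Matrix.mat ?n ?n (\<lambda>(i, j). (E ! i) \<bullet> (us ! j))" for us :: "('a \<times> 'b) list"
  have len: "length E = ?n" "length V = ?n" "length V' = ?n" "length W = ?n"
    using es fs by (simp_all add: E_def V_def V'_def W_def)
  have M: "M us \<in> carrier_mat ?n ?n" for us
    by (simp add: M_def)
  have det_V: "Determinant.det (M V) = list_det es (x # vs) * list_det fs (y # ws)"
    using list_det_block[of "x # vs" es "y # ws" fs] es fs
    by (simp only: E_def[symmetric] V_def[symmetric] list_det_def len M_def) simp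
  \<comment> \<open>In \<open>V\<close> the vector \<open>(0, y)\<close> comes after
    \<open>(x, 0)\<close> and all of \<open>vs\<close>, that is, at index
    \<open>?p + 1\<close>.\<close>
  have "swap_col_to_front (M V) (?p + 1) = M V'"
    by (subst swap_col_to_front_result[OF M])
      (auto simp: M_def V_def V'_def nth_append nth_Cons Suc_diff_le not_less_eq_eq intro!: eq_matI split: nat.splits)
  then have det_V': "Determinant.det (M V') = (- 1) ^ (?p + 1) * Determinant.det (M V)"
    using swap_col_to_front_det[OF M, of "?p + 1" V] by simp
  \<comment> \<open>\<open>f j\<close> and \<open>h j\<close> are the coefficients of
    \<open>(0, y)\<close> and \<open>(x, 0)\<close> in \<open>W ! j\<close>; \<open>d j\<close> is
    the factor on the remaining basis vector, set to 0 for the first two columns, which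
    \<open>f\<close> and \<open>h\<close> already describe.\<close>
  define f where "f j = (if j = 0 then s else if j = 1 then k * c else 0)" for j :: nat
  define h where "h j = (if j = 0 then c else if j = 1 then - (k * s) else 0)" for j :: nat
  define d where "d j = (if j < 2 then 0 else if j < ?p + 2 then c else s)" for j :: nat
  define N where "N = Matrix.mat ?n ?n (\<lambda>(i, j). (if i = 0 then f j else 0) + (if i = 1 then h j else 0) +
      (if i = j then d j else 0))"
  have N: "N \<in> carrier_mat ?n ?n" by (simp add: N_def)
  let ?N2 = "Matrix.mat 2 2 (\<lambda>(i, j). if i = 0 then f j else h j)"
  let ?D = "four_block_mat (c \<cdot>\<^sub>m 1\<^sub>m ?p) (0\<^sub>m ?p ?q) (0\<^sub>m ?q ?p) (s \<cdot>\<^sub>m 1\<^sub>m ?q)"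
  have "N = four_block_mat ?N2 (0\<^sub>m 2 (?p + ?q)) (0\<^sub>m (?p + ?q) 2) ?D"
    by (rule eq_matI) (auto simp: N_def f_def h_def d_def)
  then have "Determinant.det N = Determinant.det ?N2 * Determinant.det ?D"
    using det_four_block_mat_lower_left_zero[of ?N2 2 "0\<^sub>m 2 (?p + ?q)" "?p + ?q" "0\<^sub>m (?p + ?q) 2" ?D] by simp
  also have "Determinant.det ?N2 = - k * (c\<^sup>2 + s\<^sup>2)"
    by (subst det_2x2) (simp_all add: f_def h_def power2_eq_square algebra_simps)
  also have "Determinant.det ?D = Determinant.det (c \<cdot>\<^sub>m 1\<^sub>m ?p) * Determinant.det (s \<cdot>\<^sub>m 1\<^sub>m ?q)"
    by (rule det_four_block_mat_lower_left_zero) auto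
  also have "\<dots> = c ^ ?p * s ^ ?q"
    by simp
  finally have det_N: "Determinant.det N = - k * c ^ ?p * s ^ ?q"
    by (simp add: cs)
  have sum3: "(\<Sum>l = 0..<n. F l * ((if l = 0 then a else 0) + (if l = 1 then b else 0) + (if l = j then e else 0))) =
      F 0 * a + F 1 * b + F j * e" if "0 < n" "1 < n" "j < n" for n j and F :: "nat \<Rightarrow> real" and a b e
    using that by (simp add: distrib_left sum.distrib if_distrib[of "\<lambda>t. _ * t"] cong: if_cong)
  have "M W = M V' * N"
  proof (rule eq_matI)
    fix i j assume "i < dim_row (M V' * N)" "j < dim_col (M V' * N)"
    then have ij: "i < ?n" "j < ?n" by (simp_all add: M_def N_def)
    have "(M V' * N) $$ (i, j) = (\<Sum>l = 0..<?n. (E ! i \<bullet> V' ! l) *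
        ((if l = 0 then f j else 0) + (if l = 1 then h j else 0) + (if l = j then d j else 0)))"
      using ij by (simp add: M_def N_def Matrix.scalar_prod_def)
    also have "\<dots> = (E ! i \<bullet> V' ! 0) * f j + (E ! i \<bullet> V' ! 1) * h j + (E ! i \<bullet> V' ! j) * d j"
      using ij by (intro sum3) auto
    also have "\<dots> = E ! i \<bullet> (f j *\<^sub>R V' ! 0 + h j *\<^sub>R V' ! 1 + d j *\<^sub>R V' ! j)"
      by (simp add: inner_add_right mult.commute)
    also have "f j *\<^sub>R V' ! 0 + h j *\<^sub>R V' ! 1 + d j *\<^sub>R V' ! j = W ! j"
      using ij by (auto simp: f_def h_def d_def V'_def W_def nth_append nth_Cons split: nat.splits)
    finally show "M W $$ (i, j) = (M V' * N) $$ (i, j)"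
      using ij by (simp add: M_def)
  qed (simp_all add: M_def N_def)
  then have "Determinant.det (M W) = Determinant.det (M V') * Determinant.det N"
    using det_mult[OF M N] by simp
  then have "Determinant.det (M W) =
      (- 1) ^ ?p * k * c ^ ?p * s ^ ?q * (list_det es (x # vs) * list_det fs (y # ws))"
    by (simp add: det_N det_V' det_V)
  moreover have "list_det E W = Determinant.det (M W)"
    by (simp only: list_det_def M_def len)
  ultimately show ?thesis
    unfolding E_def[symmetric] W_def[symmetric] by (simp only: mult.assoc)
qed

lemma length_std_basis [simp]: "length (std_basis :: (real^(1 + 'p::{finite,linorder})) list) = CARD('p) + 1"
  by (simp add: std_basis_def)

text \<open>Parseval's identity, with \<open>Basis\<close> enumerated once by the list; in this form
  it evaluates the entries of a matrix product.\<close>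

lemma sum_std_basis:
  fixes a b :: "real^(1 + 'p::{finite,linorder})"
  shows "(\<Sum>i = 0..<CARD('p) + 1. (std_basis ! i \<bullet> a) * (std_basis ! i \<bullet> b)) = a \<bullet> b"
proof -
  have "distinct (map (\<lambda>i. axis (Inr i) 1 :: real^(1 + 'p)) (sorted_list_of_set UNIV))"
    by (auto simp: distinct_map inj_on_def axis_eq_axis)
  then have dist: "distinct (std_basis :: (real^(1 + 'p)) list)"
    by (auto simp: std_basis_def axis_eq_axis)
  have "(axis i 1 :: real^(1 + 'p)) \<in> set std_basis" for i
  proof (cases i)
    case (Inl j)
    then show ?thesis by (simp add: std_basis_def num1_eq1[of j])
  next
    case (Inr j)
    then show ?thesis by (simp add: std_basis_def)
  qed
  then have set: "set (std_basis :: (real^(1 + 'p)) list) = Basis"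
    by (auto simp: Basis_vec_def std_basis_def)
  have "a \<bullet> b = (\<Sum>e\<in>set std_basis. (e \<bullet> a) * (e \<bullet> b))"
    by (simp add: euclidean_inner[of a b] set inner_commute)
  also have "\<dots> = (\<Sum>i<CARD('p) + 1. (std_basis ! i \<bullet> a) * (std_basis ! i \<bullet> b))"
    using sum.reindex_bij_betw[OF bij_betw_nth[OF dist refl refl], of "\<lambda>e. (e \<bullet> a) * (e \<bullet> b)"] by simp
  finally show ?thesis by (simp add: lessThan_atLeast0)
qed

text \<open>An orthonormal frame has a coordinate matrix with \<open>transpose_mat ?A * ?A\<close>
  the identity, hence nonzero determinant; a wrong sign is repaired by negating one tangent
  vector.\<close>

lemma positive_sphere_frame_exists:
  fixes x :: "real^(1 + 'p::{finite,linorder})"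
  assumes x: "norm x = 1"
  obtains vs where "positive_sphere_frame std_basis x vs"
proof -
  obtain L :: "real^('p::{finite,linorder}) \<Rightarrow> real^(1 + 'p)" where
    L: "linear L" "\<And>v. x \<bullet> L v = 0" "\<And>v w. L v \<bullet> L w = v \<bullet> w"
    using isometry_onto_hyperplane[OF x] by blast
  define vs where "vs = map (\<lambda>i. L (axis i 1)) (sorted_list_of_set UNIV)"
  let ?n = "CARD('p) + 1"
  let ?A = "Matrix.mat ?n ?n (\<lambda>(i, j). (std_basis ! i) \<bullet> ((x # vs) ! j))"
  have len: "length vs = CARD('p)" by (simp add: vs_def)
  have orth: "(x # vs) ! i \<bullet> (x # vs) ! j = (if i = j then 1 else 0)" if "i < ?n" "j < ?n" for i j
    using that x distinct_conv_nth[of "sorted_list_of_set (UNIV :: 'p set)"]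
    by (auto simp: nth_Cons vs_def L inner_commute[of "L _" x] norm_eq_1 inner_axis_axis nth_eq_iff_index_eq
        split: nat.splits)
  have "transpose_mat ?A * ?A = 1\<^sub>m ?n"
  proof (rule eq_matI)
    fix i j assume "i < dim_row (1\<^sub>m ?n)" "j < dim_col (1\<^sub>m ?n)"
    then have ij: "i < ?n" "j < ?n" by auto
    have "(transpose_mat ?A * ?A) $$ (i, j) =
        (\<Sum>k = 0..<?n. (std_basis ! k \<bullet> (x # vs) ! i) * (std_basis ! k \<bullet> (x # vs) ! j))"
      using ij by (simp add: Matrix.scalar_prod_def)
    then show "(transpose_mat ?A * ?A) $$ (i, j) = 1\<^sub>m ?n $$ (i, j)"
      using ij by (simp only: sum_std_basis orth index_one_mat)
  qed simp_all
  then have "Determinant.det (transpose_mat ?A) * Determinant.det ?A = 1"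
    using det_mult[of "transpose_mat ?A" ?n ?A] by simp
  then have nz: "list_det std_basis (x # vs) \<noteq> 0"
    by (auto simp: list_det_def)
  have vs_orth: "\<forall>v\<in>set vs. x \<bullet> v = 0"
    by (auto simp: vs_def L)
  show ?thesis
  proof (cases "list_det std_basis (x # vs) > 0")
    case True
    then show ?thesis using that[of vs] vs_orth len by (simp add: positive_sphere_frame_def)
  next
    case False
    \<comment> \<open>There is a vector to flip because the index type \<open>'p\<close> is
      nonempty.\<close>
    obtain v us where vs: "vs = v # us"
      using len by (cases vs) auto
    have "list_det std_basis (x # (- v) # us) = - list_det std_basis (x # v # us)"
      using len vs by (intro list_det_flip) simp
    then have "list_det std_basis (x # (- v) # us) > 0"
      using False nz vs by simp
    then show ?thesis using that[of "- v # us"] vs_orth len vs by (simp add: positive_sphere_frame_def)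
  qed
qed

section \<open>The differential\<close>

text \<open>The line \<open>s \<mapsto> (s / 2) v\<close> in inverse stereographic projection from \<open>- x\<close>.\<close>

definition sphere_curve :: "'a::real_inner \<Rightarrow> 'a \<Rightarrow> real \<Rightarrow> 'a" where
  "sphere_curve x v s = inverse (1 + s\<^sup>2 * (v \<bullet> v) / 4) *\<^sub>R (s *\<^sub>R v + (1 - s\<^sup>2 * (v \<bullet> v) / 4) *\<^sub>R x)"

lemma sphere_curve_0 [simp]: "sphere_curve x v 0 = x"
  by (simp add: sphere_curve_def)

lemma norm_sphere_curve:
  assumes x: "norm x = 1" and v: "x \<bullet> v = 0"
  shows "norm (sphere_curve x v s) = 1"
proof -
  let ?r = "s\<^sup>2 * (v \<bullet> v) / 4"
  let ?w = "s *\<^sub>R v + (1 - ?r) *\<^sub>R x"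
  have pos: "1 + ?r > 0" by (simp add: add_pos_nonneg)
  have "?w \<bullet> ?w = s\<^sup>2 * (v \<bullet> v) + (1 - ?r) * (1 - ?r)"
    using x v by (simp add: inner_add_left inner_add_right inner_commute[of v x] norm_eq_1 power2_eq_square)
  also have "\<dots> = (1 + ?r)\<^sup>2"
    by (simp add: power2_eq_square field_simps)
  finally have "(norm ?w)\<^sup>2 = (1 + ?r)\<^sup>2"
    by (simp add: power2_norm_eq_inner)
  then have "norm ?w = 1 + ?r"
    using pos by (simp add: power2_eq_iff_nonneg)
  then show ?thesis
    using pos by (simp add: sphere_curve_def)
qed

text \<open>Both scalar coefficients are even in \<open>s\<close>, hence stationary at 0, so only
  the term \<open>s *\<^sub>R v\<close> contributes.\<close>

lemma sphere_curve_has_vector_derivative: "(sphere_curve x v has_vector_derivative v) (at 0)"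
proof -
  have "((\<lambda>s. 1 + s\<^sup>2 * (v \<bullet> v) / 4) has_real_derivative 0) (at 0)"
    "((\<lambda>s. 1 - s\<^sup>2 * (v \<bullet> v) / 4) has_real_derivative 0) (at 0)"
    by (auto intro!: derivative_eq_intros)
  note d = DERIV_inverse_fun[OF this(1)] this(2)
  have "((\<lambda>s. s *\<^sub>R v) has_vector_derivative v) (at 0)"
    by (auto intro!: derivative_eq_intros)
  moreover have "((\<lambda>s. (1 - s\<^sup>2 * (v \<bullet> v) / 4) *\<^sub>R x) has_vector_derivative 0) (at 0)"
    using has_vector_derivative_scaleR[OF d(2) has_vector_derivative_const, of x] by simp
  ultimately have "((\<lambda>s. s *\<^sub>R v + (1 - s\<^sup>2 * (v \<bullet> v) / 4) *\<^sub>R x) has_vector_derivative v + 0) (at 0)"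
    by (rule has_vector_derivative_add)
  from has_vector_derivative_scaleR[OF d(1) this] show ?thesis
    unfolding sphere_curve_def[abs_def] by simp
qed

text \<open>The product rule gives the same derivative along every admissible curve; the description
  is met uniquely because at least one curve with the prescribed velocity stays in
  \<open>cover\<close>.\<close>

lemma differential_G_hat:
  fixes P t :: real and m :: nat and x :: "real^(1 + 'p::finite)" and y :: "real^(1 + 'q::finite)"
  assumes P: "P > 0" and x: "norm x = 1" "x \<bullet> v = 0" and y: "norm y = 1" "y \<bullet> w = 0"
  defines "k \<equiv> 2 * pi * real m / P"
  defines "c \<equiv> cos (2 * pi * real m * t / P)" and "s \<equiv> sin (2 * pi * real m * t / P)"
  shows "differential P (G_hat P m) (proj P (t, x, y)) (a, v, w) =
    (c *\<^sub>R v - (k * a * s) *\<^sub>R x, s *\<^sub>R w + (k * a * c) *\<^sub>R y)"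
  unfolding differential_def
proof (rule the_equality)
  let ?d = "(c *\<^sub>R v - (k * a * s) *\<^sub>R x, s *\<^sub>R w + (k * a * c) *\<^sub>R y)"
  show *: "\<forall>\<gamma>. range \<gamma> \<subseteq> cover \<and> proj P (\<gamma> 0) = proj P (t, x, y) \<and> (\<gamma> has_vector_derivative (a, v, w)) (at 0) \<longrightarrow>
      ((G_hat P m \<circ> proj P \<circ> \<gamma>) has_vector_derivative ?d) (at 0)"
  proof (intro allI impI, elim conjE)
    fix \<gamma> :: "real \<Rightarrow> ('p, 'q) ambient"
    assume z: "proj P (\<gamma> 0) = proj P (t, x, y)" and \<gamma>: "(\<gamma> has_vector_derivative (a, v, w)) (at 0)"
    let ?t = "\<lambda>r. fst (\<gamma> r)" and ?x = "\<lambda>r. fst (snd (\<gamma> r))" and ?y = "\<lambda>r. snd (snd (\<gamma> r))"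
    have \<gamma>0: "circle_point P (?t 0) = circle_point P t" "?x 0 = x" "?y 0 = y"
      using z by (simp_all add: proj_def split: prod.splits)
    \<comment> \<open>The lift may start at any representative of the circle point, so
      \<open>?t 0\<close> equals \<open>t\<close> only modulo \<open>P\<close>.\<close>
    have cs: "cos (k * ?t 0) = c" "sin (k * ?t 0) = s"
      using trig_circle_point[OF P \<gamma>0(1), of m] by (simp_all add: k_def c_def s_def)
    have dt: "(?t has_real_derivative a) (at 0)"
      using bounded_linear.has_vector_derivative[OF bounded_linear_fst \<gamma>]
      by (simp add: has_real_derivative_iff_has_vector_derivative)
    have dx: "(?x has_vector_derivative v) (at 0)"
      using bounded_linear.has_vector_derivative[OF bounded_linear_compose[OF bounded_linear_fst bounded_linear_snd] \<gamma>]
      by simp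
    have dy: "(?y has_vector_derivative w) (at 0)"
      using bounded_linear.has_vector_derivative[OF bounded_linear_compose[OF bounded_linear_snd bounded_linear_snd] \<gamma>]
      by simp
    have "((\<lambda>r. cos (k * ?t r)) has_real_derivative - (k * a * s)) (at 0)"
      "((\<lambda>r. sin (k * ?t r)) has_real_derivative k * a * c) (at 0)"
      using dt by (auto intro!: derivative_eq_intros simp: cs)
    from has_vector_derivative_Pair[OF has_vector_derivative_scaleR[OF this(1) dx] has_vector_derivative_scaleR[OF this(2) dy]]
    have "((\<lambda>r. (cos (k * ?t r) *\<^sub>R ?x r, sin (k * ?t r) *\<^sub>R ?y r)) has_vector_derivative ?d) (at 0)"
      by (simp add: cs \<gamma>0)
    moreover have "G_hat P m \<circ> proj P \<circ> \<gamma> = (\<lambda>r. (cos (k * ?t r) *\<^sub>R ?x r, sin (k * ?t r) *\<^sub>R ?y r))"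
    proof
      show "(G_hat P m \<circ> proj P \<circ> \<gamma>) r = (cos (k * ?t r) *\<^sub>R ?x r, sin (k * ?t r) *\<^sub>R ?y r)" for r
        using G_hat_proj[OF P, of m "?t r" "?x r" "?y r"] by (simp add: k_def)
    qed
    ultimately show "((G_hat P m \<circ> proj P \<circ> \<gamma>) has_vector_derivative ?d) (at 0)" by simp
  qed
  define \<gamma> where "\<gamma> r = (t + a * r, sphere_curve x v r, sphere_curve y w r)" for r
  have "((\<lambda>r. t + a * r) has_vector_derivative a) (at 0)"
    by (auto intro!: derivative_eq_intros simp: has_real_derivative_iff_has_vector_derivative[symmetric])
  then have "(\<gamma> has_vector_derivative (a, v, w)) (at 0)"
    unfolding \<gamma>_def[abs_def] by (intro has_vector_derivative_Pair sphere_curve_has_vector_derivative)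
  moreover have "range \<gamma> \<subseteq> cover" "\<gamma> 0 = (t, x, y)"
    by (auto simp: \<gamma>_def cover_def norm_sphere_curve[OF x] norm_sphere_curve[OF y])
  ultimately show "d = ?d" if "\<forall>\<gamma>. range \<gamma> \<subseteq> cover \<and> proj P (\<gamma> 0) = proj P (t, x, y) \<and>
      (\<gamma> has_vector_derivative (a, v, w)) (at 0) \<longrightarrow> ((G_hat P m \<circ> proj P \<circ> \<gamma>) has_vector_derivative d) (at 0)" for d
    using that * by (metis vector_derivative_unique_at)
qed

section \<open>Regular values and the degree\<close>

lemma tangent_space_proj: "tangent_space (proj P (t, x, y)) = {(a, v, w). x \<bullet> v = 0 \<and> y \<bullet> w = 0}"
  by (simp add: tangent_space_def proj_def)

text \<open>Surjectivity by an explicit preimage: the component of \<open>d\<close> along the image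
  of the circle direction determines \<open>a\<close>, and the rest is divided by the nonzero
  factors \<open>c\<close> and \<open>s\<close>.\<close>

lemma regular_point_G_hat:
  fixes x :: "real^(1 + 'p::finite)" and y :: "real^(1 + 'q::finite)"
  assumes P: "P > 0" and "m \<ge> 1" and x: "norm x = 1" and y: "norm y = 1"
    and nz: "cos (2 * pi * real m * t / P) \<noteq> 0" "sin (2 * pi * real m * t / P) \<noteq> 0"
  shows "regular_point P (G_hat P m) (proj P (t, x, y))"
proof -
  define k c s where "k = 2 * pi * real m / P" and "c = cos (2 * pi * real m * t / P)"
    and "s = sin (2 * pi * real m * t / P)"
  have "k > 0" using assms(1,2) by (simp add: k_def)
  have cs: "c \<noteq> 0" "s \<noteq> 0" "c * c + s * s = 1"
    using nz by (simp_all add: c_def s_def power2_eq_square[symmetric])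
  have xy: "x \<bullet> x = 1" "y \<bullet> y = 1" using x y by (simp_all add: norm_eq_1)
  let ?z = "proj P (t, x, y)"
  have D: "differential P (G_hat P m) ?z (a, v, w) = (c *\<^sub>R v - (k * a * s) *\<^sub>R x, s *\<^sub>R w + (k * a * c) *\<^sub>R y)"
    if "x \<bullet> v = 0" "y \<bullet> w = 0" for a v w
    using differential_G_hat[OF P x that(1) y that(2)] by (simp add: k_def c_def s_def)
  have Gz: "G_hat P m ?z = (c *\<^sub>R x, s *\<^sub>R y)"
    by (simp add: G_hat_proj[OF P] c_def s_def)
  have "differential P (G_hat P m) ?z ` tangent_space ?z \<subseteq> {w. G_hat P m ?z \<bullet> w = 0}"
  proof (rule image_subsetI)
    fix z assume "z \<in> tangent_space ?z"
    then obtain a v w where z: "z = (a, v, w)" and orth: "x \<bullet> v = 0" "y \<bullet> w = 0"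
      by (auto simp: tangent_space_proj)
    show "differential P (G_hat P m) ?z z \<in> {w. G_hat P m ?z \<bullet> w = 0}"
      by (simp add: z D[OF orth] Gz inner_diff_right inner_add_right xy orth)
  qed
  moreover have "d \<in> differential P (G_hat P m) ?z ` tangent_space ?z" if d: "G_hat P m ?z \<bullet> d = 0" for d
  proof -
    obtain V W where VW: "d = (V, W)" by (cases d)
    have orth: "c * (x \<bullet> V) + s * (y \<bullet> W) = 0"
      using d by (simp add: Gz VW)
    \<comment> \<open>The inner product of \<open>(V, W)\<close> with the unit vector
      \<open>(- s *\<^sub>R x, c *\<^sub>R y)\<close>, which is the image of the circle direction
      divided by \<open>k\<close>.\<close>
    define e where "e = c * (y \<bullet> W) - s * (x \<bullet> V)"
    define a where "a = e / k"
    define v where "v = (1 / c) *\<^sub>R (V + (e * s) *\<^sub>R x)"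
    define w where "w = (1 / s) *\<^sub>R (W - (e * c) *\<^sub>R y)"
    \<comment> \<open>Inserting \<open>c * c + s * s = 1\<close> exhibits this number as
      \<open>c\<close> times the tangency relation \<open>orth\<close>, hence 0.\<close>
    have "x \<bullet> V + e * s = (x \<bullet> V) * (c * c + s * s) + s * e"
      using cs(3) by simp
    also have "\<dots> = c * (c * (x \<bullet> V) + s * (y \<bullet> W))"
      by (simp add: e_def algebra_simps)
    finally have v: "x \<bullet> v = 0"
      using orth by (simp add: v_def inner_add_right xy)
    have "y \<bullet> W - e * c = (y \<bullet> W) * (c * c + s * s) - c * e"
      using cs(3) by simp
    also have "\<dots> = s * (c * (x \<bullet> V) + s * (y \<bullet> W))"
      by (simp add: e_def algebra_simps)
    finally have w: "y \<bullet> w = 0"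
      using orth by (simp add: w_def inner_diff_right xy)
    have "differential P (G_hat P m) ?z (a, v, w) = d"
      unfolding D[OF v w] using cs(1,2) \<open>k > 0\<close> by (simp add: VW a_def v_def w_def)
    then show ?thesis
      using v w by (force simp: tangent_space_proj)
  qed
  ultimately show ?thesis
    unfolding regular_point_def by blast
qed

text \<open>If a block of the value is 0, pick a preimage with the collapsed sphere coordinate at a
  coordinate vector. That block of the differential then takes only multiples of this vector, while
  the target tangent space contains every vector of the block.\<close>

lemma regular_value_G_hat_nonzero:
  fixes X :: "real^(1 + 'p::finite)" and Y :: "real^(1 + 'q::finite)"
  assumes P: "P > 0" and m: "m \<ge> 1" and reg: "regular_value P (G_hat P m) (X, Y)"
  shows "X \<noteq> 0" "Y \<noteq> 0"
proof -
  have norm: "norm (X, Y) = 1" and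
    reg: "\<And>t x y. norm x = 1 \<Longrightarrow> norm y = 1 \<Longrightarrow> G_hat P m (proj P (t, x, y)) = (X, Y) \<Longrightarrow>
      differential P (G_hat P m) (proj P (t, x, y)) ` {(a, v, w). x \<bullet> v = 0 \<and> y \<bullet> w = 0} = {w. (X, Y) \<bullet> w = 0}"
    using reg by (auto simp: regular_value_def regular_point_def manifold_eq_proj cover_def tangent_space_proj)
  define k where "k = 2 * pi * real m / P"
  show "X \<noteq> 0"
  proof
    assume "X = 0"
    then have Y: "norm Y = 1" using norm by (simp add: norm_Pair)
    let ?x = "axis (Inl 1) 1 :: real^(1 + 'p)" and ?e = "axis (Inr undefined) 1 :: real^(1 + 'p)"
    \<comment> \<open>A quarter turn: the angle is pi / 2, where the cosine vanishes and the sine is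
      1.\<close>
    let ?t = "P / (4 * real m)"
    have t: "2 * pi * real m * ?t / P = pi / 2" using P m by (simp add: field_simps)
    have x: "norm ?x = 1" by simp
    have "G_hat P m (proj P (?t, ?x, Y)) = (X, Y)"
      unfolding G_hat_proj[OF P] t by (simp add: \<open>X = 0\<close>)
    from reg[OF x Y this] have "(?e, 0) \<in> differential P (G_hat P m) (proj P (?t, ?x, Y)) ` {(a, v, w). ?x \<bullet> v = 0 \<and> Y \<bullet> w = 0}"
      by (simp add: \<open>X = 0\<close>)
    then obtain a v w where "?x \<bullet> v = 0" "Y \<bullet> w = 0" and "(?e, 0) = differential P (G_hat P m) (proj P (?t, ?x, Y)) (a, v, w)"
      by blast
    then have "?e = - (k * a) *\<^sub>R ?x"
      using differential_G_hat[OF P x _ Y, of v w m ?t a] unfolding t by (simp add: k_def)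
    then have "?e $ Inr undefined = (- (k * a) *\<^sub>R ?x) $ Inr undefined" by simp
    then show False by (simp add: axis_def)
  qed
  show "Y \<noteq> 0"
  proof
    assume "Y = 0"
    then have X: "norm X = 1" using norm by (simp add: norm_Pair)
    let ?y = "axis (Inl 1) 1 :: real^(1 + 'q)" and ?e = "axis (Inr undefined) 1 :: real^(1 + 'q)"
    have y: "norm ?y = 1" by simp
    have "G_hat P m (proj P (0, X, ?y)) = (X, Y)"
      unfolding G_hat_proj[OF P] by (simp add: \<open>Y = 0\<close>)
    from reg[OF X y this] have "(0, ?e) \<in> differential P (G_hat P m) (proj P (0, X, ?y)) ` {(a, v, w). X \<bullet> v = 0 \<and> ?y \<bullet> w = 0}"
      by (simp add: \<open>Y = 0\<close>)
    then obtain a v w where "X \<bullet> v = 0" "?y \<bullet> w = 0" and "(0, ?e) = differential P (G_hat P m) (proj P (0, X, ?y)) (a, v, w)"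
      by blast
    then have "?e = (k * a) *\<^sub>R ?y"
      using differential_G_hat[OF P X _ y, of v w m 0 a] by (simp add: k_def)
    then have "?e $ Inr undefined = ((k * a) *\<^sub>R ?y) $ Inr undefined" by simp
    then show False by (simp add: axis_def)
  qed
qed

text \<open>The definition asks for some pair of positive frames, so any choice on the two spheres
  will do, and \<open>list_det_join_frame\<close> reveals the sign.\<close>

lemma orientation_preserving_G_hat:
  fixes x :: "real^(1 + 'p::{finite,linorder})" and y :: "real^(1 + 'q::{finite,linorder})"
  assumes P: "P > 0" and "m \<ge> 1" and pq: "even CARD('p)" "even CARD('q)" and x: "norm x = 1" and y: "norm y = 1"
    and nz: "cos (2 * pi * real m * t / P) \<noteq> 0" "sin (2 * pi * real m * t / P) \<noteq> 0"
  shows "orientation_preserving_at P (G_hat P m) (proj P (t, x, y))"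
proof -
  define k c s where "k = 2 * pi * real m / P" and "c = cos (2 * pi * real m * t / P)"
    and "s = sin (2 * pi * real m * t / P)"
  have "k > 0" using assms(1,2) by (simp add: k_def)
  have cs: "c \<noteq> 0" "s \<noteq> 0" "c\<^sup>2 + s\<^sup>2 = 1"
    using nz by (simp_all add: c_def s_def)
  have xy: "x \<bullet> x = 1" "y \<bullet> y = 1" using x y by (simp_all add: norm_eq_1)
  let ?z = "proj P (t, x, y)"
  have D: "differential P (G_hat P m) ?z (a, v, w) = (c *\<^sub>R v - (k * a * s) *\<^sub>R x, s *\<^sub>R w + (k * a * c) *\<^sub>R y)"
    if "x \<bullet> v = 0" "y \<bullet> w = 0" for a v w
    using differential_G_hat[OF P x that(1) y that(2)] by (simp add: k_def c_def s_def)
  have Gz: "G_hat P m ?z = (c *\<^sub>R x, s *\<^sub>R y)"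
    by (simp add: G_hat_proj[OF P] c_def s_def)
  obtain vs where vs: "positive_sphere_frame std_basis x vs"
    using positive_sphere_frame_exists[OF x] .
  obtain ws where ws: "positive_sphere_frame std_basis y ws"
    using positive_sphere_frame_exists[OF y] .
  have len: "length vs = CARD('p)" "length ws = CARD('q)"
    using vs ws by (simp_all add: positive_sphere_frame_def)
  have orthx: "x \<bullet> v = 0" if "v \<in> set vs" for v
    using vs that by (simp add: positive_sphere_frame_def)
  have orthy: "y \<bullet> w = 0" if "w \<in> set ws" for w
    using ws that by (simp add: positive_sphere_frame_def)
  let ?F = "(- (k * s) *\<^sub>R x, (k * c) *\<^sub>R y) # map (\<lambda>v. (c *\<^sub>R v, 0)) vs @ map (\<lambda>w. (0, s *\<^sub>R w)) ws"
  have F: "map (differential P (G_hat P m) ?z) (product_frame vs ws) = ?F"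
    by (simp add: product_frame_def D orthx orthy)
  have "list_det std_basis_sum (G_hat P m ?z # ?F) = (- 1) ^ length vs * k * c ^ length vs * s ^ length ws *
      list_det std_basis (x # vs) * list_det std_basis (y # ws)"
    unfolding std_basis_sum_def Gz by (rule list_det_join_frame) (simp_all add: len cs(3))
  \<comment> \<open>\<open>c\<close> and \<open>s\<close> may be negative at this preimage; even
    \<open>p\<close> makes (-1)^p and c^p positive, even \<open>q\<close> makes s^q
    positive.\<close>
  also have "\<dots> > 0"
    using vs ws \<open>k > 0\<close> cs(1,2) pq by (simp add: len positive_sphere_frame_def zero_less_power_eq)
  finally have "positive_sphere_frame std_basis_sum (G_hat P m ?z) ?F"
    using orthx orthy by (auto simp: positive_sphere_frame_def std_basis_sum_def len Gz xy)
  then show ?thesis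
    using vs ws F unfolding orientation_preserving_at_def
    by (auto simp: proj_def intro!: exI[of _ vs] exI[of _ ws])
qed

section \<open>Counting preimages and evaluating the degree\<close>

lemma cos_sin_int_pi_plus:
  fixes k :: int
  shows "(cos (of_int k * pi + \<phi>))\<^sup>2 = (cos \<phi>)\<^sup>2" "(sin (of_int k * pi + \<phi>))\<^sup>2 = (sin \<phi>)\<^sup>2"
proof -
  have sin: "sin (of_int k * pi) = (0 :: real)"
    by (simp add: sin_zero_iff_int2)
  then have "(cos (of_int k * pi :: real))\<^sup>2 = 1"
    using sin_cos_squared_add[of "of_int k * pi :: real"] by simp
  then show "(cos (of_int k * pi + \<phi>))\<^sup>2 = (cos \<phi>)\<^sup>2" "(sin (of_int k * pi + \<phi>))\<^sup>2 = (sin \<phi>)\<^sup>2"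
    by (simp_all add: cos_add sin_add sin power_mult_distrib)
qed

text \<open>
  If \<open>\<bar>X\<bar> = cos \<theta>\<close> and \<open>\<bar>Y\<bar> = sin \<theta>\<close>, then the preimages of \<open>(X, Y)\<close> lie over the points \<open>t\<close> of the
  circle with \<open>2 \<pi> m t / P = k \<pi> \<plusminus> \<theta>\<close>, where \<open>0 \<le> k < 2 m\<close>.
\<close>

lemma card_preimage_G_hat:
  fixes X :: "real^(1 + 'p::finite)" and Y :: "real^(1 + 'q::finite)"
  assumes P: "P > 0" and m: "m \<ge> 1" and XY: "norm (X, Y) = 1" "X \<noteq> 0" "Y \<noteq> 0"
  shows "card {z \<in> manifold P. G_hat P m z = (X, Y)} = 4 * m"
proof -
  have "(norm (X, Y))\<^sup>2 = (norm X)\<^sup>2 + (norm Y)\<^sup>2"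
    by (simp add: norm_Pair)
  then have norms: "(norm X)\<^sup>2 + (norm Y)\<^sup>2 = 1"
    using XY(1) by simp
  moreover have "(norm Y)\<^sup>2 > 0" using XY(3) by simp
  ultimately have "(norm X)\<^sup>2 < 1" by linarith
  then have "norm X < 1" by (simp add: power2_less_1_iff[symmetric] abs_square_less_1)
  \<comment> \<open>Since both blocks are nonzero, \<open>norm X\<close> lies strictly between 0 and
    1, which puts \<open>\<theta>\<close> strictly inside the first quadrant; this later keeps the
    angles k pi + \<open>\<theta>\<close> and k pi - \<open>\<theta>\<close> apart.\<close>
  define \<theta> where "\<theta> = arccos (norm X)"
  have cos\<theta>: "cos \<theta> = norm X"
    using \<open>norm X < 1\<close> by (simp add: \<theta>_def cos_arccos_abs)
  have sin\<theta>: "(sin \<theta>)\<^sup>2 = (norm Y)\<^sup>2"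
    using norms by (simp add: sin_squared_eq cos\<theta>)
  have \<theta>: "0 < \<theta>" "\<theta> < pi / 2"
  proof -
    have "0 \<le> \<theta>" "\<theta> \<le> pi"
      using \<open>norm X < 1\<close> by (simp_all add: \<theta>_def arccos_lbound arccos_ubound order_trans[OF _ norm_ge_zero])
    moreover have "\<theta> \<noteq> 0" using cos\<theta> \<open>norm X < 1\<close> by auto
    moreover have "cos \<theta> > 0" using cos\<theta> XY(2) by simp
    moreover have "cos \<theta> \<le> 0" if "pi / 2 \<le> \<theta>" "\<theta> \<le> pi"
      using cos_monotone_0_pi_le[of "pi / 2" \<theta>] that by simp
    ultimately show "0 < \<theta>" "\<theta> < pi / 2" by force+
  qed
  define \<alpha> where "\<alpha> = (\<lambda>(k :: int, e :: int). of_int k * pi + of_int e * \<theta>)"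
  define t where "t i = \<alpha> i * P / (2 * pi * real m)" for i
  \<comment> \<open>Over \<open>t i\<close> the sphere coordinates are forced by the value; they
    have unit length because |cos| and |sin| of \<open>\<alpha> i\<close> are the norms of
    \<open>X\<close> and \<open>Y\<close>.\<close>
  define z where "z i = proj P (t i, X /\<^sub>R cos (\<alpha> i), Y /\<^sub>R sin (\<alpha> i))" for i
  let ?I = "{0..<2 * int m} \<times> {1, -1 :: int}"
  have t\<alpha>: "2 * pi * real m * t i / P = \<alpha> i" for i
    using P m by (simp add: t_def)
  have norm_cos: "(cos (\<alpha> i))\<^sup>2 = (norm X)\<^sup>2" "(sin (\<alpha> i))\<^sup>2 = (norm Y)\<^sup>2" if "snd i \<in> {1, -1}" for i
  proof -
    have "(cos (of_int (snd i) * \<theta>))\<^sup>2 = (cos \<theta>)\<^sup>2" "(sin (of_int (snd i) * \<theta>))\<^sup>2 = (sin \<theta>)\<^sup>2"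
      using that by auto
    then show "(cos (\<alpha> i))\<^sup>2 = (norm X)\<^sup>2" "(sin (\<alpha> i))\<^sup>2 = (norm Y)\<^sup>2"
      by (simp_all add: \<alpha>_def case_prod_unfold cos_sin_int_pi_plus cos\<theta> sin\<theta>)
  qed
  have abs_cos: "\<bar>cos (\<alpha> i)\<bar> = norm X" "\<bar>sin (\<alpha> i)\<bar> = norm Y" if "snd i \<in> {1, -1}" for i
    using arg_cong[OF norm_cos(1)[OF that], of sqrt] arg_cong[OF norm_cos(2)[OF that], of sqrt] by simp_all
  have nz: "cos (\<alpha> i) \<noteq> 0" "sin (\<alpha> i) \<noteq> 0" if "snd i \<in> {1, -1}" for i
    using abs_cos[OF that] XY(2,3) by auto
  have "{z \<in> manifold P. G_hat P m z = (X, Y)} = z ` ?I"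
  proof (intro equalityI subsetI)
    fix w assume "w \<in> {z \<in> manifold P. G_hat P m z = (X, Y)}"
    then obtain r x y where w: "w = proj P (r, x, y)" and xy: "norm x = 1" "norm y = 1"
      and G: "G_hat P m w = (X, Y)"
      unfolding manifold_eq_proj cover_def by auto
    define \<beta> where "\<beta> = 2 * pi * real m * r / P"
    have XY_eq: "X = cos \<beta> *\<^sub>R x" "Y = sin \<beta> *\<^sub>R y"
      using G by (simp_all add: w G_hat_proj[OF P] \<beta>_def)
    \<comment> \<open>The identity turns equality of the squared cosines and sines of
      \<open>\<beta>\<close> and \<open>\<theta>\<close> into \<open>\<beta>\<close> being
      \<open>\<theta>\<close> or its negative modulo pi.\<close>
    have "sin (\<beta> - \<theta>) * sin (\<beta> + \<theta>) = (sin \<beta>)\<^sup>2 * (cos \<theta>)\<^sup>2 - (cos \<beta>)\<^sup>2 * (sin \<theta>)\<^sup>2"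
      by (simp add: sin_diff sin_add power2_eq_square algebra_simps)
    also have "\<dots> = 0"
      unfolding cos\<theta> sin\<theta> by (simp add: XY_eq xy power_mult_distrib)
    finally have "sin (\<beta> - \<theta>) = 0 \<or> sin (\<beta> + \<theta>) = 0" by simp
    then obtain k e where e: "e \<in> {1, -1 :: int}" and \<beta>: "\<beta> = of_int k * pi + of_int e * \<theta>"
    proof
      assume "sin (\<beta> - \<theta>) = 0"
      then obtain k :: int where "\<beta> - \<theta> = of_int k * pi" unfolding sin_zero_iff_int2 by blast
      then show ?thesis using that[of 1 k] by simp
    next
      assume "sin (\<beta> + \<theta>) = 0"
      then obtain k :: int where "\<beta> + \<theta> = of_int k * pi" unfolding sin_zero_iff_int2 by blast
      then show ?thesis using that[of "-1" k] by simp
    qed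
    \<comment> \<open>Reducing \<open>k\<close> modulo \<open>2 * int m\<close> changes the angle by
      a multiple of 2 pi m, hence \<open>r\<close> by a multiple of \<open>P\<close>: the circle
      point is the same.\<close>
    define i where "i = (k mod (2 * int m), e)"
    have "i \<in> ?I" using e m by (simp add: i_def)
    define d where "d = k div (2 * int m)"
    have "k = 2 * int m * d + k mod (2 * int m)" by (simp add: d_def)
    from arg_cong[OF this, of real_of_int]
    have "of_int k = 2 * real m * of_int d + of_int (k mod (2 * int m))"
      by (simp only: of_int_add of_int_mult of_int_numeral of_int_of_nat_eq)
    then have "\<beta> = (2 * real m * of_int d + of_int (k mod (2 * int m))) * pi + of_int e * \<theta>"
      by (simp only: \<beta>)
    also have "\<dots> = \<alpha> i + 2 * pi * real m * of_int d"
      by (simp add: \<alpha>_def i_def algebra_simps)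
    finally have "\<beta> = \<alpha> i + 2 * pi * real m * of_int d" .
    then have "r = t i + of_int d * P"
      using P m by (simp add: \<beta>_def t_def field_simps)
    then have circ: "circle_point P r = circle_point P (t i)"
      using circle_point_eq_iff by blast
    then have "cos \<beta> = cos (\<alpha> i)" "sin \<beta> = sin (\<alpha> i)"
      using trig_circle_point[OF P circ, of m] by (simp_all add: \<beta>_def t\<alpha>)
    then have "x = X /\<^sub>R cos (\<alpha> i)" "y = Y /\<^sub>R sin (\<alpha> i)"
      using XY_eq nz[of i] e by (simp_all add: i_def)
    then have "w = z i"
      by (simp add: w z_def proj_def circ)
    then show "w \<in> z ` ?I" using \<open>i \<in> ?I\<close> by blast
  next
    fix w assume "w \<in> z ` ?I"
    then obtain i where i: "w = z i" "snd i \<in> {1, -1}" by auto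
    have "norm (X /\<^sub>R cos (\<alpha> i)) = 1" "norm (Y /\<^sub>R sin (\<alpha> i)) = 1"
      using nz[OF i(2)] XY(2,3) by (simp_all add: abs_cos[OF i(2)])
    then have "w \<in> manifold P"
      unfolding i(1) z_def manifold_eq_proj cover_def by (intro imageI) simp
    moreover have "G_hat P m w = (X, Y)"
      unfolding i(1) z_def G_hat_proj[OF P] t\<alpha> using nz[OF i(2)] by simp
    ultimately show "w \<in> {z \<in> manifold P. G_hat P m z = (X, Y)}" by simp
  qed
  moreover have "inj_on z ?I"
  proof (rule inj_onI)
    fix i j assume ij: "i \<in> ?I" "j \<in> ?I" "z i = z j"
    obtain k e k' e' where i: "i = (k, e)" and j: "j = (k', e')" by (metis surj_pair)
    have "circle_point P (t i) = circle_point P (t j)"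
      using ij(3) by (simp add: z_def proj_def)
    then obtain n :: int where "t i = t j + of_int n * P"
      using circle_point_eq_iff by blast
    then have "\<alpha> i = 2 * pi * real m * (t j + of_int n * P) / P"
      using t\<alpha>[of i] by simp
    also have "\<dots> = 2 * pi * real m * t j / P + 2 * pi * real m * of_int n"
      using P by (simp add: field_simps)
    finally have "\<alpha> i = \<alpha> j + 2 * pi * real m * of_int n"
      by (simp only: t\<alpha>)
    \<comment> \<open>An integer multiple of pi equals \<open>\<theta>\<close> times 0, 2 or -2. As
      2 \<open>\<theta>\<close> is less than pi, the integer is 0, and then the signs agree
      too.\<close>
    then have eq: "of_int (k - k' - 2 * int m * n) * pi = of_int (e' - e) * \<theta>"
      by (simp add: \<alpha>_def i j algebra_simps)
    have "\<bar>of_int (e' - e) :: real\<bar> \<le> 2"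
      using ij(1,2) by (auto simp: i j)
    then have "\<bar>of_int (e' - e) * \<theta>\<bar> \<le> 2 * \<theta>"
      using \<theta>(1) by (simp add: abs_mult)
    then have "\<bar>of_int (k - k' - 2 * int m * n) * pi\<bar> < 1 * pi"
      unfolding eq using \<theta>(2) by linarith
    then have "\<bar>of_int (k - k' - 2 * int m * n) :: real\<bar> < 1"
      by (simp only: abs_mult abs_of_pos[OF pi_gt_zero] mult_less_cancel_right_pos[OF pi_gt_zero])
    then have k: "k - k' - 2 * int m * n = 0" by linarith
    then have "e' = e" using eq \<theta>(1) by simp
    moreover have "k = k'"
    proof -
      have "k mod (2 * int m) = (k' + 2 * int m * n) mod (2 * int m)" using k by (simp add: algebra_simps)
      then have "k mod (2 * int m) = k' mod (2 * int m)" by simp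
      then show ?thesis using ij(1,2) by (simp add: i j)
    qed
    ultimately show "i = j" by (simp add: i j)
  qed
  ultimately have "card {z \<in> manifold P. G_hat P m z = (X, Y)} = card ?I"
    by (simp only: card_image)
  moreover have "card {1, -1 :: int} = 2"
    by (simp add: card_insert_if)
  ultimately show ?thesis by (simp only: card_cartesian_product) simp
qed

lemma G_hat_eq_nonzero:
  fixes X :: "real^(1 + 'p::finite)" and Y :: "real^(1 + 'q::finite)"
  assumes "P > 0" "z \<in> manifold P" "G_hat P m z = (X, Y)" "X \<noteq> 0" "Y \<noteq> 0"
  obtains t x y where "z = proj P (t, x, y)" "norm x = 1" "norm y = 1"
    "cos (2 * pi * real m * t / P) \<noteq> 0" "sin (2 * pi * real m * t / P) \<noteq> 0"
proof -
  obtain t x y where z: "z = proj P (t, x, y)" and "norm x = 1" "norm y = 1"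
    using assms(2) unfolding manifold_eq_proj cover_def by auto
  moreover have "cos (2 * pi * real m * t / P) *\<^sub>R x = X" "sin (2 * pi * real m * t / P) *\<^sub>R y = Y"
    using assms(3) by (simp_all add: z G_hat_proj[OF assms(1)])
  ultimately show ?thesis using that assms(4,5) by (metis scale_zero_left)
qed

text \<open>Every regular value has both blocks nonzero, so all its preimages count +1 and there are
  always 4 m of them; exhibiting one regular value makes the description unique.\<close>

lemma mapping_degree_G_hat:
  assumes P: "P > 0" and m: "m \<ge> 1" and pq: "even CARD('p::{finite,linorder})" "even CARD('q::{finite,linorder})"
  shows "mapping_degree P (G_hat P m :: ('p, 'q) point \<Rightarrow> ('p, 'q) target) = 4 * int m"
proof -
  let ?G = "G_hat P m :: ('p, 'q) point \<Rightarrow> ('p, 'q) target"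
  let ?count = "\<lambda>v. \<Sum>z | z \<in> manifold P \<and> ?G z = v. if orientation_preserving_at P ?G z then 1 else - 1 :: int"
  have count: "?count v = 4 * int m" if v: "regular_value P ?G v" for v
  proof -
    obtain X Y where XY: "v = (X, Y)" by (cases v)
    have nz: "X \<noteq> 0" "Y \<noteq> 0"
      using regular_value_G_hat_nonzero[OF P m] v unfolding XY by blast+
    have "norm (X, Y) = 1"
      using v by (simp add: XY regular_value_def)
    have "?count v = (\<Sum>z | z \<in> manifold P \<and> ?G z = v. 1)"
    proof (intro sum.cong refl)
      fix z :: "('p, 'q) point" assume "z \<in> {z \<in> manifold P. ?G z = v}"
      then have "z \<in> manifold P" "?G z = (X, Y)" by (auto simp: XY)
      then obtain t x y where z: "z = proj P (t, x, y)" "norm x = 1" "norm y = 1"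
        "cos (2 * pi * real m * t / P) \<noteq> 0" "sin (2 * pi * real m * t / P) \<noteq> 0"
        by (rule G_hat_eq_nonzero[OF P _ _ nz])
      show "(if orientation_preserving_at P ?G z then 1 else - 1) = (1 :: int)"
        using orientation_preserving_G_hat[OF P m pq z(2-)] by (simp add: z(1))
    qed
    also have "\<dots> = int (card {z \<in> manifold P. ?G z = (X, Y)})"
      by (simp add: XY)
    also have "\<dots> = 4 * int m"
      using card_preimage_G_hat[OF P m \<open>norm (X, Y) = 1\<close> nz] by simp
    finally show ?thesis .
  qed
  \<comment> \<open>3/5 and 4/5 are the coordinates of a rational point of the unit circle with both
    blocks nonzero, so the value is regular.\<close>
  define X where "X = (3 / 5) *\<^sub>R (axis (Inl 1) 1 :: real^(1 + 'p))"
  define Y where "Y = (4 / 5) *\<^sub>R (axis (Inl 1) 1 :: real^(1 + 'q))"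
  have nz: "X \<noteq> 0" "Y \<noteq> 0" by (simp_all add: X_def Y_def axis_eq_0_iff)
  have "norm (X, Y) = 1"
    by (simp add: norm_Pair X_def Y_def power2_eq_square)
  then have "regular_value P ?G (X, Y)"
    unfolding regular_value_def
  proof (intro conjI ballI impI)
    fix z :: "('p, 'q) point" assume "z \<in> manifold P" "?G z = (X, Y)"
    then obtain t x y where z: "z = proj P (t, x, y)" "norm x = 1" "norm y = 1"
      "cos (2 * pi * real m * t / P) \<noteq> 0" "sin (2 * pi * real m * t / P) \<noteq> 0"
      by (rule G_hat_eq_nonzero[OF P _ _ nz])
    show "regular_point P ?G z"
      unfolding z(1) by (rule regular_point_G_hat[OF P m z(2-)])
  qed simp
  then show ?thesis
    unfolding mapping_degree_def using count by (intro the_equality) auto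
qed

theorem corollary6p5:
  fixes P l1 l2 lam :: real
  assumes "even CARD('p::{finite,linorder})" and "CARD('p) \<ge> 2"
    and "even CARD('q::{finite,linorder})" and "CARD('q) \<ge> 2"
    and "P > 0" and "l1 > 0" and "l2 > 0"
    and "real CARD('p) / l1\<^sup>2 = lam" and "real CARD('q) / l2\<^sup>2 = lam"
  shows "(\<forall>m\<ge>1.
      (\<forall>t. \<forall>x\<in>sphere 0 1. \<forall>y\<in>sphere 0 1.
         (G_hat P m :: ('p, 'q) point \<Rightarrow> ('p, 'q) target) (proj P (t, x, y)) =
           (cos (2 * pi * real m * t / P) *\<^sub>R x, sin (2 * pi * real m * t / P) *\<^sub>R y)) \<and>
      smooth_map P (G_hat P m :: ('p, 'q) point \<Rightarrow> ('p, 'q) target) \<and>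
      (G_hat P m :: ('p, 'q) point \<Rightarrow> ('p, 'q) target) ` manifold P \<subseteq> sphere 0 1 \<and>
      (\<forall>z\<in>manifold P. laplacian P l1 l2 (G_hat P m :: ('p, 'q) point \<Rightarrow> ('p, 'q) target) z =
         - (lam + 4 * pi\<^sup>2 * (real m)\<^sup>2 / P\<^sup>2) *\<^sub>R G_hat P m z) \<and>
      mapping_degree P (G_hat P m :: ('p, 'q) point \<Rightarrow> ('p, 'q) target) = 4 * int m) \<and>
    (\<forall>N. \<exists>f :: ('p, 'q) point \<Rightarrow> ('p, 'q) target.
       spherical_eigenmap P l1 l2 f \<and> mapping_degree P f \<ge> N)"
proof (intro conjI allI impI ballI)
  fix m :: nat assume m: "m \<ge> 1"
  show "(G_hat P m :: ('p, 'q) point \<Rightarrow> ('p, 'q) target) (proj P (t, x, y)) =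
      (cos (2 * pi * real m * t / P) *\<^sub>R x, sin (2 * pi * real m * t / P) *\<^sub>R y)" for t x y
    by (rule G_hat_proj[OF \<open>P > 0\<close>])
  show "smooth_map P (G_hat P m :: ('p, 'q) point \<Rightarrow> ('p, 'q) target)"
    by (rule smooth_map_G_hat[OF assms(5-9)])
  show "(G_hat P m :: ('p, 'q) point \<Rightarrow> ('p, 'q) target) ` manifold P \<subseteq> sphere 0 1"
    using G_hat_sphere[OF \<open>P > 0\<close>] by blast
  show "laplacian P l1 l2 (G_hat P m :: ('p, 'q) point \<Rightarrow> ('p, 'q) target) z =
      - (lam + 4 * pi\<^sup>2 * (real m)\<^sup>2 / P\<^sup>2) *\<^sub>R G_hat P m z" if "z \<in> manifold P" for z
    by (rule laplacian_G_hat[OF assms(5-9) that])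
  show "mapping_degree P (G_hat P m :: ('p, 'q) point \<Rightarrow> ('p, 'q) target) = 4 * int m"
    by (rule mapping_degree_G_hat[OF \<open>P > 0\<close> m assms(1,3)])
next
  fix N :: int
  \<comment> \<open>The maximum with 1 keeps \<open>m\<close> admissible for nonpositive
    \<open>N\<close>; then 4 m is at least \<open>N\<close>.\<close>
  define m where "m = nat (max 1 N)"
  have "m \<ge> 1" "int m \<ge> N" by (auto simp: m_def)
  then have "mapping_degree P (G_hat P m :: ('p, 'q) point \<Rightarrow> ('p, 'q) target) \<ge> N"
    by (simp add: mapping_degree_G_hat[OF \<open>P > 0\<close> _ assms(1,3)])
  then show "\<exists>f :: ('p, 'q) point \<Rightarrow> ('p, 'q) target. spherical_eigenmap P l1 l2 f \<and> mapping_degree P f \<ge> N"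
    using spherical_eigenmap_G_hat[OF assms(5-9)] by blast
qed

end
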